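(* Let $\alpha_1,\alpha_2,\gamma_1,\gamma_2,\Gamma$ be real constants with $\Gamma>0$, $\alpha_1\neq 0$ and $\frac{2\alpha_2}{3\alpha_1}\notin\mathbf{Z}$, and consider $$\partial_t u=\alpha_1\partial_x^3u+i\alpha_2\partial_x^2u+i\gamma_1|u|^2u+\gamma_2\partial_x(|u|^2u)-i\Gamma u\,\partial_x(|u|^2),\quad x\in\mathbf{T}.\qquad (E)$$ Let real numbers $s,s_1$ satisfy $$1\le s_1\le s<\min\{\tfrac53s_1+\tfrac12,\ s_1+\tfrac32\}.$$ Then for any $\varepsilon,\tau>0$ there exists a real analytic function $\psi_{\varepsilon,\tau}$ on $\mathbf{T}$ satisfying $\|\psi_{\varepsilon,\tau}\|_{H^s}\le\varepsilon$ such that, if there exists a solution $u\in C([0,\tau];H^{s_1}(\mathbf{T}))$ to (E) on $[0,\tau]$ with the initial condition $u(0)=\psi_{\varepsilon,\tau}$, it holds that $$\sup_{t\in[0,\tau]}\|u(t)\|_{H^{s_1}}\ge\varepsilon^{-1}.$$ The same is true for the negative time direction (i.e. with $[0,\tau]$ replaced by $[-\tau,0]$).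
   Context: Notation: $\mathbf{T}=\mathbf{R}/2\pi\mathbf{Z}$; functions are complex-valued; $\hat f(k)=\frac1{\sqrt{2\pi}}\int_{\mathbf{T}}e^{-ikx}f(x)\,dx$ for $k\in\mathbf{Z}$; $\langle\xi\rangle=1+|\xi|$; $\|f\|_{H^s}=\|\langle k\rangle^s\hat f(k)\|_{\ell^2(\mathbf{Z})}$. Notion of solution: Let $T>0$, $s\ge0$, $u_0\in H^s(\mathbf{T})$. A function $u$ is a solution of (E) with $u(0)=u_0$ on $[0,T)$ if $u\in L^\infty_{loc}([0,T);H^s(\mathbf{T}))\cap L^3_{loc}([0,T)\times\mathbf{T})$, $\partial_x(|u|^2)\in L^1_{loc}([0,T);H^{-s}(\mathbf{T}))$, and for every $\phi\in C_0^\infty([0,T)\times\mathbf{T})$, $$-\int_0^T\!\!\int_{\mathbf{T}}u\,\partial_t\phi\,dx\,dt-\int_{\mathbf{T}}u_0\phi(0,\cdot)\,dx=\int_0^T\!\!\int_{\mathbf{T}}\big[u(-\alpha_1\partial_x^3\phi+i\alpha_2\partial_x^2\phi)+|u|^2u(i\gamma_1\phi-\gamma_2\partial_x\phi)\big]dx\,dt-i\Gamma\int_0^T\langle\partial_x(|u|^2)(t),u(t)\phi(t)\rangle_{H^{-s},H^s}\,dt .$$ A function $u$ is a solution on the closed interval $[0,T]$ if $u\in C([0,T];H^{s}(\mathbf{T}))$ for some $s>1/2$ and $u|_{[0,T)}$ is a solution on $[0,T)$, that is, $u|_{[0,T)}\in L^\infty_{loc}([0,T);H^s(\mathbf{T}))\cap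 L^3_{loc}([0,T)\times\mathbf{T})$, $\partial_x(|u|^2)\in L^1_{loc}([0,T);H^{-s}(\mathbf{T}))$, and the displayed integral identity holds for every $\phi\in C_0^\infty([0,T)\times\mathbf{T})$. Solutions on $(-T,0]$ and $[-T,0]$ are defined in a similar manner (with test functions in $C_0^\infty((-T,0]\times\mathbf{T})$, time integrals over $(-T,0)$, and the term $-\int_{\mathbf{T}}u_0\phi(0,\cdot)\,dx$ replaced by $+\int_{\mathbf{T}}u_0\phi(0,\cdot)\,dx$). *)

theory Defs
  imports "HOL-Analysis.Analysis"
begin

section \<open>Functions on the circle and Sobolev norms\<close>

text \<open>A function on the circle R/2piZ is a 2pi-periodic function on the real line; integrals over
  the circle are Lebesgue integrals over \<open>{0..2*pi}\<close>.\<close>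

definition periodic :: "(real \<Rightarrow> complex) \<Rightarrow> bool" where
  "periodic f \<longleftrightarrow> (\<forall>x. f (x + 2 * pi) = f x)"

definition torus_integral :: "(real \<Rightarrow> complex) \<Rightarrow> complex" where
  "torus_integral f = (LINT x|lebesgue_on {0..2*pi}. f x)"

definition fourier :: "(real \<Rightarrow> complex) \<Rightarrow> int \<Rightarrow> complex" where
  "fourier f k =
     complex_of_real (1 / sqrt (2 * pi)) *
     torus_integral (\<lambda>x. exp (- (\<i> * of_int k * complex_of_real x)) * f x)"

definition jap :: "real \<Rightarrow> real" where
  "jap \<xi> = 1 + \<bar>\<xi>\<bar>"

text \<open>Periodic distributions (needed for Sobolev spaces of negative order) are represented by their
  Fourier coefficients. The predicate \<open>hs_coeffs\<close> must accompany \<open>hs_norm\<close>, since \<open>infsum\<close> is 0 on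
  families that are not summable.\<close>

definition hs_coeffs :: "real \<Rightarrow> (int \<Rightarrow> complex) \<Rightarrow> bool" where
  "hs_coeffs s a \<longleftrightarrow> (\<lambda>k. (jap (of_int k) powr s * cmod (a k))\<^sup>2) summable_on UNIV"

definition hs_norm :: "real \<Rightarrow> (int \<Rightarrow> complex) \<Rightarrow> real" where
  "hs_norm s a = sqrt (\<Sum>\<^sub>\<infinity>k. (jap (of_int k) powr s * cmod (a k))\<^sup>2)"

text \<open>The space \<open>H\<^sup>s\<close> for \<open>s \<ge> 0\<close>, as a space of square integrable functions.\<close>

definition in_Hs :: "real \<Rightarrow> (real \<Rightarrow> complex) \<Rightarrow> bool" where
  "in_Hs s f \<longleftrightarrow>
     periodic f \<and>
     f \<in> borel_measurable (lebesgue_on {0..2*pi}) \<and>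
     integrable (lebesgue_on {0..2*pi}) (\<lambda>x. (cmod (f x))\<^sup>2) \<and>
     hs_coeffs s (fourier f)"

definition Hs_norm :: "real \<Rightarrow> (real \<Rightarrow> complex) \<Rightarrow> real" where
  "Hs_norm s f = hs_norm s (fourier f)"

text \<open>Distributional derivative on the Fourier side: the k-th Fourier coefficient of the
  derivative of \<open>f\<close> is \<open>i k\<close> times that of \<open>f\<close>.\<close>

definition dist_deriv :: "(int \<Rightarrow> complex) \<Rightarrow> int \<Rightarrow> complex" where
  "dist_deriv a k = \<i> * of_int k * a k"

text \<open>The duality between \<open>H\<close> of order \<open>-s\<close> and \<open>H\<close> of order \<open>s\<close> is the bilinear extension of the
  integral of \<open>f g\<close> over the circle (no complex conjugation), hence the index \<open>-k\<close>.\<close>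

definition hs_pairing :: "(int \<Rightarrow> complex) \<Rightarrow> (int \<Rightarrow> complex) \<Rightarrow> complex" where
  "hs_pairing a b = (\<Sum>\<^sub>\<infinity>k. a k * b (- k))"

definition real_analytic_torus :: "(real \<Rightarrow> complex) \<Rightarrow> bool" where
  "real_analytic_torus f \<longleftrightarrow>
     periodic f \<and>
     (\<forall>x0. \<exists>r>0. \<exists>a::nat \<Rightarrow> complex.
        \<forall>x. \<bar>x - x0\<bar> < r \<longrightarrow> (\<lambda>n. a n * complex_of_real (x - x0) ^ n) sums f x)"

section \<open>Time-dependent function spaces\<close>

text \<open>Strong (Bochner) measurability of a map from the time set \<open>I\<close> into \<open>H\<^sup>s\<close>: almost everywhere
  limit, in norm, of \<open>H\<^sup>s\<close>-valued simple functions.\<close>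

definition hs_strongly_measurable :: "real \<Rightarrow> real set \<Rightarrow> (real \<Rightarrow> int \<Rightarrow> complex) \<Rightarrow> bool" where
  "hs_strongly_measurable s I F \<longleftrightarrow>
     (\<exists>S::nat \<Rightarrow> real \<Rightarrow> int \<Rightarrow> complex.
        (\<forall>n. simple_function (lebesgue_on I) (S n) \<and> (\<forall>t\<in>I. hs_coeffs s (S n t))) \<and>
        (AE t in lebesgue_on I.
           hs_coeffs s (F t) \<and> (\<lambda>n. hs_norm s (\<lambda>k. S n t k - F t k)) \<longlonglongrightarrow> 0))"

definition Linf_loc_Hs :: "real \<Rightarrow> real set \<Rightarrow> (real \<Rightarrow> real \<Rightarrow> complex) \<Rightarrow> bool" where
  "Linf_loc_Hs s I u \<longleftrightarrow>
     hs_strongly_measurable s I (\<lambda>t. fourier (u t)) \<and>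
     (\<forall>K. compact K \<and> K \<subseteq> I \<longrightarrow>
        (\<exists>C. AE t in lebesgue_on K. in_Hs s (u t) \<and> Hs_norm s (u t) \<le> C))"

definition L1_loc_hs :: "real \<Rightarrow> real set \<Rightarrow> (real \<Rightarrow> int \<Rightarrow> complex) \<Rightarrow> bool" where
  "L1_loc_hs s I F \<longleftrightarrow>
     hs_strongly_measurable s I F \<and>
     (\<forall>K. compact K \<and> K \<subseteq> I \<longrightarrow> integrable (lebesgue_on K) (\<lambda>t. hs_norm s (F t)))"

definition L3_loc :: "real set \<Rightarrow> (real \<Rightarrow> real \<Rightarrow> complex) \<Rightarrow> bool" where
  "L3_loc I u \<longleftrightarrow>
     (\<lambda>(t, x). u t x) \<in> borel_measurable (lebesgue_on (I \<times> {0..2*pi})) \<and>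
     (\<forall>K. compact K \<and> K \<subseteq> I \<longrightarrow>
        integrable (lebesgue_on (K \<times> {0..2*pi})) (\<lambda>(t, x). cmod (u t x) ^ 3))"

definition continuous_in_Hs :: "real \<Rightarrow> real set \<Rightarrow> (real \<Rightarrow> real \<Rightarrow> complex) \<Rightarrow> bool" where
  "continuous_in_Hs s I u \<longleftrightarrow>
     (\<forall>t\<in>I. in_Hs s (u t)) \<and>
     (\<forall>t0\<in>I. ((\<lambda>t. Hs_norm s (\<lambda>x. u t x - u t0 x)) \<longlongrightarrow> 0) (at t0 within I))"

section \<open>Test functions\<close>

text \<open>\<open>D m n\<close> is the partial derivative of order \<open>m\<close> in time and \<open>n\<close> in space.\<close>

definition smooth2 :: "(real \<Rightarrow> real \<Rightarrow> complex) \<Rightarrow> bool" where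
  "smooth2 \<phi> \<longleftrightarrow>
     (\<exists>D::nat \<Rightarrow> nat \<Rightarrow> real \<Rightarrow> real \<Rightarrow> complex.
        D 0 0 = \<phi> \<and>
        (\<forall>m n. continuous_on UNIV (\<lambda>(t, x). D m n t x) \<and>
          (\<forall>t x. ((\<lambda>t'. D m n t' x) has_vector_derivative D (Suc m) n t x) (at t) \<and>
                 (D m n t has_vector_derivative D m (Suc n) t x) (at x))))"

text \<open>Smooth functions on \<open>I\<close> times the circle with compact support, for a half-open interval \<open>I\<close>,
  given as restrictions of smooth functions on R times the circle. Only the values for times in \<open>I\<close>
  matter; in particular nothing is required to vanish at the closed endpoint of \<open>I\<close>.\<close>

definition test_function :: "real set \<Rightarrow> (real \<Rightarrow> real \<Rightarrow> complex) \<Rightarrow> bool" where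
  "test_function I \<phi> \<longleftrightarrow>
     smooth2 \<phi> \<and> (\<forall>t. periodic (\<phi> t)) \<and>
     (\<exists>K. compact K \<and> K \<subseteq> I \<and> (\<forall>t\<in>I - K. \<forall>x. \<phi> t x = 0))"

definition dt :: "(real \<Rightarrow> real \<Rightarrow> complex) \<Rightarrow> real \<Rightarrow> real \<Rightarrow> complex" where
  "dt \<phi> t x = vector_derivative (\<lambda>t'. \<phi> t' x) (at t)"

definition dx :: "(real \<Rightarrow> real \<Rightarrow> complex) \<Rightarrow> real \<Rightarrow> real \<Rightarrow> complex" where
  "dx \<phi> t x = vector_derivative (\<phi> t) (at x)"

section \<open>Solutions\<close>

text \<open>The parameter \<open>\<sigma>\<close> is 1 for \<open>I = {0..<T}\<close> and -1 for \<open>I = {-T<..0}\<close>: it is the sign of the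
  boundary term at time 0.\<close>

definition weak_identity ::
  "real \<Rightarrow> real \<Rightarrow> real \<Rightarrow> real \<Rightarrow> real \<Rightarrow> real set \<Rightarrow> real \<Rightarrow>
   (real \<Rightarrow> complex) \<Rightarrow> (real \<Rightarrow> real \<Rightarrow> complex) \<Rightarrow> (real \<Rightarrow> real \<Rightarrow> complex) \<Rightarrow> bool" where
  "weak_identity \<alpha>1 \<alpha>2 \<gamma>1 \<gamma>2 \<Gamma> I \<sigma> u0 u \<phi> \<longleftrightarrow>
     - (LINT t|lebesgue_on I. torus_integral (\<lambda>x. u t x * dt \<phi> t x))
     - of_real \<sigma> * torus_integral (\<lambda>x. u0 x * \<phi> 0 x)
     = (LINT t|lebesgue_on I. torus_integral (\<lambda>x.
          u t x * (- of_real \<alpha>1 * (dx ^^ 3) \<phi> t x + \<i> * of_real \<alpha>2 * (dx ^^ 2) \<phi> t x)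
          + of_real ((cmod (u t x))\<^sup>2) * u t x *
              (\<i> * of_real \<gamma>1 * \<phi> t x - of_real \<gamma>2 * dx \<phi> t x)))
       - \<i> * of_real \<Gamma> *
         (LINT t|lebesgue_on I.
            hs_pairing (dist_deriv (fourier (\<lambda>x. of_real ((cmod (u t x))\<^sup>2))))
                       (fourier (\<lambda>x. u t x * \<phi> t x)))"

definition solution_on ::
  "real \<Rightarrow> real \<Rightarrow> real \<Rightarrow> real \<Rightarrow> real \<Rightarrow> real \<Rightarrow> real set \<Rightarrow> real \<Rightarrow>
   (real \<Rightarrow> complex) \<Rightarrow> (real \<Rightarrow> real \<Rightarrow> complex) \<Rightarrow> bool" where
  "solution_on \<alpha>1 \<alpha>2 \<gamma>1 \<gamma>2 \<Gamma> s I \<sigma> u0 u \<longleftrightarrow>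
     s \<ge> 0 \<and> in_Hs s u0 \<and>
     (\<forall>t\<in>I. periodic (u t)) \<and>
     Linf_loc_Hs s I u \<and> L3_loc I u \<and>
     L1_loc_hs (- s) I (\<lambda>t. dist_deriv (fourier (\<lambda>x. of_real ((cmod (u t x))\<^sup>2)))) \<and>
     (\<forall>\<phi>. test_function I \<phi> \<longrightarrow> weak_identity \<alpha>1 \<alpha>2 \<gamma>1 \<gamma>2 \<Gamma> I \<sigma> u0 u \<phi>)"

text \<open>Solutions on \<open>{0..T}\<close> and \<open>{-T..0}\<close> with initial datum \<open>u0\<close>. As on the half-open intervals,
  the initial condition is imposed through the boundary term of the weak identity.\<close>

definition forward_solution ::
  "real \<Rightarrow> real \<Rightarrow> real \<Rightarrow> real \<Rightarrow> real \<Rightarrow> real \<Rightarrow>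
   (real \<Rightarrow> complex) \<Rightarrow> (real \<Rightarrow> real \<Rightarrow> complex) \<Rightarrow> bool" where
  "forward_solution \<alpha>1 \<alpha>2 \<gamma>1 \<gamma>2 \<Gamma> T u0 u \<longleftrightarrow>
     (\<exists>s>1/2. continuous_in_Hs s {0..T} u \<and>
        solution_on \<alpha>1 \<alpha>2 \<gamma>1 \<gamma>2 \<Gamma> s {0..<T} 1 u0 u)"

definition backward_solution ::
  "real \<Rightarrow> real \<Rightarrow> real \<Rightarrow> real \<Rightarrow> real \<Rightarrow> real \<Rightarrow>
   (real \<Rightarrow> complex) \<Rightarrow> (real \<Rightarrow> real \<Rightarrow> complex) \<Rightarrow> bool" where
  "backward_solution \<alpha>1 \<alpha>2 \<gamma>1 \<gamma>2 \<Gamma> T u0 u \<longleftrightarrow>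
     (\<exists>s>1/2. continuous_in_Hs s {-T..0} u \<and>
        solution_on \<alpha>1 \<alpha>2 \<gamma>1 \<gamma>2 \<Gamma> s {-T<..0} (- 1) u0 u)"

end

theory Submission
  imports Defs
begin

text \<open>
  On the Fourier side the modes \<open>a\<^sub>k\<close> of a solution satisfy
  \<open>a\<^sub>k' = - i \<omega>\<^sub>k a\<^sub>k + (cubic terms)\<close>. Because \<open>2 \<alpha>2 / (3 \<alpha>1)\<close> is not an integer, the only resonant cubic
  interactions are the trivial ones, and together they contribute \<open>r\<^sub>k a\<^sub>k\<close> with
  \<open>Re r\<^sub>k = \<Gamma> / (2 pi) \<Sum>\<^sub>l (k - l) |a\<^sub>l|\<^sup>2\<close>, which is of size \<open>k\<close> as long as the mean \<open>a\<^sub>0\<close> does not vanish: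
  the equation behaves like a Cauchy-Riemann equation, growing at positive and decaying at negative
  frequencies. One normal form transformation makes the nonresonant terms one power of \<open>k\<close> smaller than
  the trivial bound.

  Hence solutions bounded in \<open>H\<^sup>1\<close> are smoothed: positive modes are controlled by integrating
  backwards from a later time, negative modes by integrating forwards from the initial time, where they vanish
  for our data. Each step gains one power of \<open>k\<close> at the cost of halving the time interval, so after
  finitely many steps \<open>|a\<^sub>k(0)| \<le> C |k|\<^sup>-\<^sup>n\<close> with \<open>n > s\<close> and \<open>C\<close> depending only on the \<open>H\<^sup>1\<close> bound,
  the size of the mean and the length of the time interval. The datum
  \<open>\<epsilon>/2 + \<epsilon>/2 (1 + N)\<^sup>-\<^sup>s e\<^sup>i\<^sup>N\<^sup>x\<close> violates this bound for large \<open>N\<close>, so the \<open>H\<^sup>1\<close> bound must fail.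
  The backward case follows by reversing time and reflecting space.
\<close>

section \<open>Trilinear estimates\<close>

text \<open>The normal form is forced by counting powers. If \<open>|a_k|\<close> is of size
  \<open>|k|^-(n+1)\<close>, the nonlinearity is only \<open>O(|k|^-n)\<close>, since it contains a
  derivative; divided by a growth rate of order \<open>|k|\<close> this returns
  \<open>|k|^-(n+1)\<close>, and nothing is gained. The corrected unknown has forcing
  \<open>O(|k|^-(n+1))\<close>, which is the entire gain of a step. The division by the phase fails
  to gain a power exactly where all interacting frequencies are at least \<open>|k| / 2\<close>.
  There the missing power comes from the \<open>H^1\<close> bound: the l1 mass beyond
  \<open>R\<close> is \<open>O(R^(-1/2))\<close>, and two such tails multiply to
  \<open>1 / |k|\<close>. Only the part of the cubic sum in a finite box is transformed, so that the
  correction can be differentiated term by term; the remainder is small uniformly in time and joins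
  the forcing, and the size of the box enters no constant. The contradiction rests on the order of
  choices: the assumed bound \<open>1 / \<epsilon>\<close> fixes the l1 constant, then the number of
  steps and the decay constant are fixed, and only afterwards the high frequency
  \<open>N\<close>.\<close>

abbreviation J :: "int \<Rightarrow> real" where "J k \<equiv> jap (of_int k)"

lemma J_ge_1: "1 \<le> J k" and J_pos: "0 < J k"
  by (auto simp: jap_def)

text \<open>In a cubic sum two frequencies determine the third. Once one factor is bounded
  pointwise, injectivity of the remaining pair embeds the sum into a full product of two l1
  sums.\<close>

lemma sum_pair_le:
  fixes f g :: "int \<Rightarrow> real"
  assumes fin: "finite F" and inj: "inj_on (\<lambda>i. (x i, y i)) F"
    and f0: "\<And>l. 0 \<le> f l" and g0: "\<And>l. 0 \<le> g l"
    and f: "\<And>S. finite S \<Longrightarrow> sum f S \<le> A" and g: "\<And>S. finite S \<Longrightarrow> sum g S \<le> B"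
  shows "(\<Sum>i\<in>F. f (x i) * g (y i)) \<le> A * B"
proof -
  have A0: "0 \<le> A" using f[of "{}"] by simp
  have "(\<Sum>i\<in>F. f (x i) * g (y i)) = (\<Sum>(p,q)\<in>(\<lambda>i. (x i, y i)) ` F. f p * g q)"
    by (subst sum.reindex[OF inj]) simp
  also have "\<dots> \<le> (\<Sum>(p,q)\<in>(x ` F) \<times> (y ` F). f p * g q)"
    by (rule sum_mono2) (use fin f0 g0 in auto)
  also have "\<dots> = sum f (x ` F) * sum g (y ` F)"
    by (simp add: sum_product sum.cartesian_product)
  also have "\<dots> \<le> A * B"
    by (rule mult_mono) (use fin f g f0 g0 A0 in \<open>auto intro: sum_nonneg\<close>)
  finally show ?thesis .
qed

lemma J_mono: "\<bar>k\<bar> \<le> \<bar>l\<bar> \<Longrightarrow> J k \<le> J l"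
  by (simp add: jap_def flip: of_int_abs)

text \<open>Retains from \<open>k = p - r + q\<close> only what the estimates use: any two
  frequencies determine the third, and none of the four exceeds the sum of the others in absolute
  value. This form is invariant under permutations, so the conjugated factor needs no separate
  treatment.\<close>

definition triads :: "int \<Rightarrow> 'i set \<Rightarrow> ('i \<Rightarrow> int) \<Rightarrow> ('i \<Rightarrow> int) \<Rightarrow> ('i \<Rightarrow> int) \<Rightarrow> bool" where
  "triads k F x y z \<longleftrightarrow> finite F \<and> inj_on (\<lambda>i. (x i, y i)) F \<and> inj_on (\<lambda>i. (x i, z i)) F \<and>
     inj_on (\<lambda>i. (y i, z i)) F \<and>
     (\<forall>i\<in>F. \<bar>k\<bar> \<le> \<bar>x i\<bar> + \<bar>y i\<bar> + \<bar>z i\<bar> \<and> \<bar>x i\<bar> \<le> \<bar>k\<bar> + \<bar>y i\<bar> + \<bar>z i\<bar> \<and>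
        \<bar>y i\<bar> \<le> \<bar>k\<bar> + \<bar>x i\<bar> + \<bar>z i\<bar> \<and> \<bar>z i\<bar> \<le> \<bar>k\<bar> + \<bar>x i\<bar> + \<bar>y i\<bar>)"

lemma inj_on_swap_pair: "inj_on (\<lambda>i. (x i, y i)) F \<Longrightarrow> inj_on (\<lambda>i. (y i, x i)) F"
  by (auto simp: inj_on_def)

lemma triads_swap12: "triads k F x y z \<Longrightarrow> triads k F y x z"
  unfolding triads_def using inj_on_swap_pair[of x y F] by (simp add: add.commute add.left_commute)

lemma triads_swap23: "triads k F x y z \<Longrightarrow> triads k F x z y"
  unfolding triads_def using inj_on_swap_pair[of y z F] by (simp add: add.commute add.left_commute)

lemma triads_subset: "triads k F x y z \<Longrightarrow> G \<subseteq> F \<Longrightarrow> triads k G x y z"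
  unfolding triads_def by (auto intro: finite_subset inj_on_subset)

lemma triads_convolution:
  "finite F \<Longrightarrow> triads k F fst (\<lambda>i. fst i + snd i - k) snd"
  by (auto simp: triads_def inj_on_def)

text \<open>The consequences of an \<open>H^1\<close> bound that the estimates use. The tail rate
  \<open>1 / sqrt (1 + R)\<close> is what Cauchy-Schwarz yields; see
  \<open>small_l1_of_H1\<close>.\<close>

definition small_l1 :: "real \<Rightarrow> (int \<Rightarrow> real) \<Rightarrow> bool" where
  "small_l1 A f \<longleftrightarrow> (\<forall>l. 0 \<le> f l) \<and> (\<forall>l. J l * f l \<le> A) \<and>
     (\<forall>R\<ge>0. \<forall>S. finite S \<and> (\<forall>l\<in>S. R \<le> \<bar>real_of_int l\<bar>) \<longrightarrow> sum f S \<le> A / sqrt (1 + R))"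

text \<open>The tail sums are required separately because at \<open>n = 0\<close> the pointwise
  bound \<open>D / J l\<close> is not summable. For larger \<open>n\<close> they follow from the
  pointwise bound, up to a constant; see \<open>decay_of_pointwise\<close>.\<close>

definition decay :: "nat \<Rightarrow> real \<Rightarrow> (int \<Rightarrow> real) \<Rightarrow> bool" where
  "decay n D f \<longleftrightarrow> (\<forall>l. f l * J l ^ Suc n \<le> D) \<and>
     (\<forall>R\<ge>0. \<forall>S. finite S \<and> (\<forall>l\<in>S. R \<le> \<bar>real_of_int l\<bar>) \<longrightarrow> sum f S * (1 + R) ^ n \<le> D)"

definition high :: "real \<Rightarrow> (int \<Rightarrow> real) \<Rightarrow> int \<Rightarrow> real" where
  "high R f l = (if R \<le> \<bar>real_of_int l\<bar> then f l else 0)"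

lemma sum_high: "finite S \<Longrightarrow> sum (high R f) S = sum f {l\<in>S. R \<le> \<bar>real_of_int l\<bar>}"
  unfolding high_def by (simp add: sum.inter_filter)

lemma small_l1D:
  assumes "small_l1 A f"
  shows small_l1_nonneg: "0 \<le> f l" and small_l1_sum: "finite S \<Longrightarrow> sum f S \<le> A"
    and small_l1_J: "J l * f l \<le> A"
    and small_l1_A: "0 \<le> A" and small_l1_le: "f l \<le> A"
    and small_l1_high: "0 \<le> R \<Longrightarrow> finite S \<Longrightarrow> sum (high R f) S \<le> A / sqrt (1 + R)"
    and small_l1_high_nonneg: "0 \<le> high R f l"
proof -
  show 1: "0 \<le> f l" for l using assms by (auto simp: small_l1_def)
  show 2: "finite S \<Longrightarrow> sum f S \<le> A" for S
    using assms unfolding small_l1_def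
    by (metis (mono_tags) abs_ge_zero add_0_right div_by_1 order_refl real_sqrt_one)
  show 3: "J l * f l \<le> A" for l using assms by (auto simp: small_l1_def)
  show "0 \<le> A" using 2[of "{}"] by simp
  show "f l \<le> A" using 2[of "{l}"] by simp
  show "0 \<le> R \<Longrightarrow> finite S \<Longrightarrow> sum (high R f) S \<le> A / sqrt (1 + R)"
    using assms unfolding small_l1_def by (simp add: sum_high)
  show "0 \<le> high R f l" using 1 by (simp add: high_def)
qed

lemma decayD:
  assumes "decay n D f"
  shows decay_le: "f l * J l ^ Suc n \<le> D"
    and decay_high: "0 \<le> R \<Longrightarrow> finite S \<Longrightarrow> sum (high R f) S \<le> D / (1 + R) ^ n"
proof -
  show "f l * J l ^ Suc n \<le> D" using assms by (auto simp: decay_def)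
  show "0 \<le> R \<Longrightarrow> finite S \<Longrightarrow> sum (high R f) S \<le> D / (1 + R) ^ n"
    using assms unfolding decay_def by (simp add: sum_high pos_le_divide_eq)
qed

lemma J_high_le:
  assumes "c \<ge> 1" "\<bar>real_of_int k\<bar> \<le> c * \<bar>real_of_int l\<bar>"
  shows "J k \<le> c * J l"
  using assms by (simp add: jap_def algebra_simps)

lemma decay_transfer:
  assumes "c \<ge> 1" "\<bar>real_of_int k\<bar> \<le> c * \<bar>real_of_int l\<bar>" "b * J l ^ m \<le> D" "0 \<le> D"
  shows "b \<le> D * c ^ m / J k ^ m"
proof -
  have "b \<le> D / J l ^ m" using assms(3) by (simp add: pos_le_divide_eq J_pos)
  also have "\<dots> = D * c ^ m / (c * J l) ^ m" using assms(1) by (simp add: power_mult_distrib)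
  also have "\<dots> \<le> D * c ^ m / J k ^ m"
    using assms J_pos[of k] by (intro divide_left_mono power_mono J_high_le mult_pos_pos) (auto simp: J_pos less_imp_le)
  finally show ?thesis .
qed

text \<open>The largest of the three frequencies carries the weight and the decay; the other two are
  summed in \<open>\<ell>\<^sup>1\<close>.\<close>

lemma triad_weighted_sum:
  assumes tr: "triads k F x y z" and f: "small_l1 A f" and d: "\<And>l. f l * J l ^ Suc n \<le> D"
  shows "(\<Sum>i\<in>F. (J (x i) + J (y i) + J (z i)) * (f (x i) * f (y i) * f (z i)))
           \<le> 9 * 3 ^ n * D * A\<^sup>2 / J k ^ n"
proof -
  \<comment> \<open>The factor \<open>3 ^ n\<close> comes from \<open>|k| \<le> 3 |p|\<close> for
    the largest frequency \<open>p\<close>, the leading 3 from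
    \<open>J p + J q + J r \<le> 3 * J p\<close>. The three possible positions of the largest
    frequency give another 3, hence \<open>9 * 3 ^ n\<close>.\<close>
  define W where "W = 3 * (D * 3 ^ n / J k ^ n)"
  note f0 = small_l1_nonneg[OF f]
  have D0: "0 \<le> D" using d[of 0] f0[of 0] by (simp add: jap_def)
  have W0: "0 \<le> W" unfolding W_def using D0 J_pos[of k] by auto
  have one: "(J p + J q + J r) * (f p * f q * f r) \<le> W * (f q * f r)"
    if "\<bar>k\<bar> \<le> \<bar>p\<bar> + \<bar>q\<bar> + \<bar>r\<bar>" "\<bar>q\<bar> \<le> \<bar>p\<bar>" "\<bar>r\<bar> \<le> \<bar>p\<bar>" for p q r
  proof -
    have "\<bar>k\<bar> \<le> 3 * \<bar>p\<bar>" using that by linarith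
    then have k: "\<bar>real_of_int k\<bar> \<le> 3 * \<bar>real_of_int p\<bar>" by linarith
    have J: "J p + J q + J r \<le> 3 * J p" using J_mono[of q p] J_mono[of r p] that by simp
    have "J p * f p \<le> D * 3 ^ n / J k ^ n"
      by (rule decay_transfer[OF _ k]) (use d[of p] D0 in \<open>auto simp: algebra_simps\<close>)
    then have "3 * J p * f p \<le> W" by (simp add: W_def)
    moreover have "(J p + J q + J r) * f p \<le> 3 * J p * f p"
      using J f0[of p] by (rule mult_right_mono)
    ultimately have "(J p + J q + J r) * f p \<le> W" by linarith
    then have "(J p + J q + J r) * f p * (f q * f r) \<le> W * (f q * f r)"
      using f0 by (intro mult_right_mono) auto
    then show ?thesis by (simp add: mult.assoc)
  qed
  have term_le: "(J (x i) + J (y i) + J (z i)) * (f (x i) * f (y i) * f (z i))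
     \<le> W * (f (y i) * f (z i) + f (x i) * f (z i) + f (x i) * f (y i))" if "i \<in> F" for i
  proof -
    have k: "\<bar>k\<bar> \<le> \<bar>x i\<bar> + \<bar>y i\<bar> + \<bar>z i\<bar>" using tr that by (auto simp: triads_def)
    have nn: "0 \<le> W * (f (y i) * f (z i))" "0 \<le> W * (f (x i) * f (z i))" "0 \<le> W * (f (x i) * f (y i))"
      using W0 f0 by auto
    consider "\<bar>y i\<bar> \<le> \<bar>x i\<bar>" "\<bar>z i\<bar> \<le> \<bar>x i\<bar>" | "\<bar>x i\<bar> \<le> \<bar>y i\<bar>" "\<bar>z i\<bar> \<le> \<bar>y i\<bar>"
      | "\<bar>x i\<bar> \<le> \<bar>z i\<bar>" "\<bar>y i\<bar> \<le> \<bar>z i\<bar>" by linarith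
    then show ?thesis
    proof cases
      case 1 then show ?thesis using one[of "x i" "y i" "z i"] k nn by (simp add: distrib_left)
    next
      case 2 then show ?thesis using one[of "y i" "x i" "z i"] k nn by (simp add: algebra_simps)
    next
      case 3 then show ?thesis using one[of "z i" "x i" "y i"] k nn by (simp add: algebra_simps)
    qed
  qed
  have p: "(\<Sum>i\<in>F. f (y i) * f (z i)) \<le> A * A" "(\<Sum>i\<in>F. f (x i) * f (z i)) \<le> A * A"
    "(\<Sum>i\<in>F. f (x i) * f (y i)) \<le> A * A"
    using tr small_l1_sum[OF f] f0 unfolding triads_def by (auto intro!: sum_pair_le)
  have "(\<Sum>i\<in>F. (J (x i) + J (y i) + J (z i)) * (f (x i) * f (y i) * f (z i)))
     \<le> (\<Sum>i\<in>F. W * (f (y i) * f (z i) + f (x i) * f (z i) + f (x i) * f (y i)))"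
    using term_le by (rule sum_mono)
  also have "\<dots> = W * ((\<Sum>i\<in>F. f (y i) * f (z i)) + (\<Sum>i\<in>F. f (x i) * f (z i)) + (\<Sum>i\<in>F. f (x i) * f (y i)))"
    by (simp add: sum_distrib_left[symmetric] sum.distrib)
  also have "\<dots> \<le> W * (A * A + A * A + A * A)"
    using p W0 by (intro mult_left_mono) auto
  also have "\<dots> = 9 * 3 ^ n * D * A\<^sup>2 / J k ^ n"
    by (simp add: W_def power2_eq_square)
  finally show ?thesis .
qed

text \<open>If one frequency is large then so is a second one, which gives smallness of the tail.\<close>

lemma triad_weighted_tail:
  assumes tr: "triads k F x y z" and f: "small_l1 A f"
    and far: "\<And>i. i \<in> F \<Longrightarrow> L \<le> \<bar>x i\<bar> \<or> L \<le> \<bar>y i\<bar> \<or> L \<le> \<bar>z i\<bar>" and kL: "\<bar>k\<bar> \<le> L"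
  shows "(\<Sum>i\<in>F. (J (x i) + J (y i) + J (z i)) * (f (x i) * f (y i) * f (z i)))
           \<le> 18 * A ^ 3 / sqrt (1 + real_of_int (L - \<bar>k\<bar>) / 2)"
proof -
  \<comment> \<open>If the largest frequency is at least \<open>L\<close>, the other two add up to
    at least \<open>L - |k|\<close>, so one of them reaches half of that.\<close>
  define R where "R = real_of_int (L - \<bar>k\<bar>) / 2"
  define g where "g = high R f"
  have R0: "0 \<le> R" using kL by (simp add: R_def)
  note f0 = small_l1_nonneg[OF f] and A0 = small_l1_A[OF f]
  have g0: "0 \<le> g l" for l unfolding g_def by (rule small_l1_high_nonneg[OF f])
  have one: "(J p + J q + J r) * (f p * f q * f r) \<le> 3 * A * (g q * f r + f q * g r)"
    if "\<bar>p\<bar> \<le> \<bar>k\<bar> + \<bar>q\<bar> + \<bar>r\<bar>" "\<bar>q\<bar> \<le> \<bar>p\<bar>" "\<bar>r\<bar> \<le> \<bar>p\<bar>" "L \<le> \<bar>p\<bar>" for p q r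
  proof -
    have "(J p + J q + J r) * f p \<le> 3 * J p * f p"
      by (rule mult_right_mono) (use that f0 J_mono[of q p] J_mono[of r p] in auto)
    also have "\<dots> \<le> 3 * A" using small_l1_J[OF f, of p] by simp
    finally have 1: "(J p + J q + J r) * f p * (f q * f r) \<le> 3 * A * (f q * f r)"
      using f0 by (intro mult_right_mono) auto
    have "L - \<bar>k\<bar> \<le> 2 * \<bar>q\<bar> \<or> L - \<bar>k\<bar> \<le> 2 * \<bar>r\<bar>" using that by linarith
    then have "real_of_int (L - \<bar>k\<bar>) \<le> real_of_int (2 * \<bar>q\<bar>) \<or> real_of_int (L - \<bar>k\<bar>) \<le> real_of_int (2 * \<bar>r\<bar>)"
      by (simp only: of_int_le_iff)
    then have "R \<le> \<bar>real_of_int q\<bar> \<or> R \<le> \<bar>real_of_int r\<bar>" by (auto simp: R_def)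
    then have "f q * f r \<le> g q * f r + f q * g r"
      using f0 g0 unfolding g_def high_def by (auto simp: add_increasing add_increasing2)
    then have "3 * A * (f q * f r) \<le> 3 * A * (g q * f r + f q * g r)"
      using A0 by (intro mult_left_mono) auto
    with 1 show ?thesis by (simp add: mult.assoc)
  qed
  define G where "G p q = g p * f q + f p * g q" for p q
  have G0: "0 \<le> G p q" for p q unfolding G_def using f0 g0 by auto
  have term_le: "(J (x i) + J (y i) + J (z i)) * (f (x i) * f (y i) * f (z i))
     \<le> 3 * A * (G (y i) (z i) + G (x i) (z i) + G (x i) (y i))" if "i \<in> F" for i
  proof -
    have k: "\<bar>x i\<bar> \<le> \<bar>k\<bar> + \<bar>y i\<bar> + \<bar>z i\<bar>" "\<bar>y i\<bar> \<le> \<bar>k\<bar> + \<bar>x i\<bar> + \<bar>z i\<bar>" "\<bar>z i\<bar> \<le> \<bar>k\<bar> + \<bar>x i\<bar> + \<bar>y i\<bar>"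
      using tr that by (auto simp: triads_def)
    have nn: "0 \<le> A * G (y i) (z i)" "0 \<le> A * G (x i) (z i)" "0 \<le> A * G (x i) (y i)"
      using A0 G0 by auto
    consider "\<bar>y i\<bar> \<le> \<bar>x i\<bar>" "\<bar>z i\<bar> \<le> \<bar>x i\<bar>" "L \<le> \<bar>x i\<bar>" | "\<bar>x i\<bar> \<le> \<bar>y i\<bar>" "\<bar>z i\<bar> \<le> \<bar>y i\<bar>" "L \<le> \<bar>y i\<bar>"
      | "\<bar>x i\<bar> \<le> \<bar>z i\<bar>" "\<bar>y i\<bar> \<le> \<bar>z i\<bar>" "L \<le> \<bar>z i\<bar>" using far[OF \<open>i \<in> F\<close>] by linarith
    then show ?thesis
    proof cases
      case 1 then show ?thesis using one[of "x i" "y i" "z i"] k nn by (simp add: distrib_left G_def)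
    next
      case 2 then show ?thesis using one[of "y i" "x i" "z i"] k nn by (simp add: algebra_simps G_def)
    next
      case 3 then show ?thesis using one[of "z i" "x i" "y i"] k nn by (simp add: algebra_simps G_def)
    qed
  qed
  have pr: "(\<Sum>i\<in>F. G (p i) (q i)) \<le> A / sqrt (1 + R) * A + A * (A / sqrt (1 + R))"
    if "inj_on (\<lambda>i. (p i, q i)) F" for p q
    unfolding G_def sum.distrib
    using tr that small_l1_sum[OF f] f0 g0 small_l1_high[OF f R0] unfolding triads_def g_def
    by (intro add_mono sum_pair_le) auto
  have "(\<Sum>i\<in>F. (J (x i) + J (y i) + J (z i)) * (f (x i) * f (y i) * f (z i)))
     \<le> (\<Sum>i\<in>F. 3 * A * (G (y i) (z i) + G (x i) (z i) + G (x i) (y i)))"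
    using term_le by (rule sum_mono)
  also have "\<dots> = 3 * A * ((\<Sum>i\<in>F. G (y i) (z i)) + (\<Sum>i\<in>F. G (x i) (z i)) + (\<Sum>i\<in>F. G (x i) (y i)))"
    by (simp add: sum_distrib_left[symmetric] sum.distrib)
  also have "\<dots> \<le> 3 * A * (3 * (A / sqrt (1 + R) * A + A * (A / sqrt (1 + R))))"
    using pr[of y z] pr[of x z] pr[of x y] tr A0 unfolding triads_def by (intro mult_left_mono) auto
  also have "\<dots> = 18 * A ^ 3 / sqrt (1 + R)"
    by (simp add: power3_eq_cube)
  finally show ?thesis by (simp add: R_def)
qed

text \<open>Two half-power tails beyond \<open>|k| / 2\<close> combine to a full power of
  \<open>J k\<close>.\<close>

lemma sqrt_half_J: "A / sqrt (1 + \<bar>real_of_int k\<bar> / 2) * (A / sqrt (1 + \<bar>real_of_int k\<bar> / 2)) \<le> 2 * A\<^sup>2 / J k"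
proof -
  have "A / sqrt (1 + \<bar>real_of_int k\<bar> / 2) * (A / sqrt (1 + \<bar>real_of_int k\<bar> / 2)) = A\<^sup>2 / (1 + \<bar>real_of_int k\<bar> / 2)"
    by (simp add: power2_eq_square)
  also have "\<dots> \<le> A\<^sup>2 / (J k / 2)"
    by (intro divide_left_mono) (auto simp: jap_def)
  finally show ?thesis by (simp add: mult.commute)
qed

text \<open>The factor \<open>b\<close> carries its own decay from \<open>x i\<close> over to
  \<open>k\<close>, and the other two factors are both confined to their tails beyond
  \<open>|k| / 2\<close>, which is worth one more power of \<open>J k\<close>. This compensates for
  the region where the symbol of the normal form does not decay.\<close>

lemma triad_high_sum:
  assumes tr: "triads k F x y z" and f: "small_l1 A f"
    and h: "\<And>i. i \<in> F \<Longrightarrow> \<bar>k\<bar> \<le> 2 * \<bar>x i\<bar> \<and> \<bar>k\<bar> \<le> 2 * \<bar>y i\<bar> \<and> \<bar>k\<bar> \<le> 2 * \<bar>z i\<bar>"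
    and b0: "\<And>l. 0 \<le> b l" and b: "\<And>l. b l * J l ^ m \<le> D"
  shows "(\<Sum>i\<in>F. b (x i) * f (y i) * f (z i)) \<le> D * 2 ^ m * 2 * A\<^sup>2 / J k ^ Suc m"
proof -
  define R where "R = \<bar>real_of_int k\<bar> / 2"
  define g where "g = high R f"
  have R0: "0 \<le> R" by (simp add: R_def)
  have D0: "0 \<le> D" using b[of 0] b0[of 0] by (simp add: jap_def)
  define W where "W = D * 2 ^ m / J k ^ m"
  have W0: "0 \<le> W" unfolding W_def using D0 J_pos[of k] by auto
  have g0: "0 \<le> g l" for l unfolding g_def by (rule small_l1_high_nonneg[OF f])
  have "(\<Sum>i\<in>F. b (x i) * f (y i) * f (z i)) \<le> (\<Sum>i\<in>F. W * (g (y i) * g (z i)))"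
  proof (rule sum_mono)
    fix i assume i: "i \<in> F"
    have "b (x i) \<le> W" unfolding W_def
      by (rule decay_transfer[OF _ _ b D0]) (use h[OF i] in linarith)+
    moreover have "g (y i) = f (y i)" "g (z i) = f (z i)"
      using h[OF i] unfolding g_def high_def R_def by (simp; linarith)+
    ultimately show "b (x i) * f (y i) * f (z i) \<le> W * (g (y i) * g (z i))"
      using small_l1_nonneg[OF f] by (simp add: mult.assoc mult_right_mono)
  qed
  also have "\<dots> = W * (\<Sum>i\<in>F. g (y i) * g (z i))" by (simp add: sum_distrib_left)
  also have "(\<Sum>i\<in>F. g (y i) * g (z i)) \<le> A / sqrt (1 + R) * (A / sqrt (1 + R))"
    using tr g0 small_l1_high[OF f R0] unfolding triads_def g_def by (intro sum_pair_le) auto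
  also have "\<dots> \<le> 2 * A\<^sup>2 / J k" unfolding R_def by (rule sqrt_half_J)
  finally have "(\<Sum>i\<in>F. b (x i) * f (y i) * f (z i)) \<le> W * (2 * A\<^sup>2 / J k)"
    using W0 by (simp add: mult_left_mono)
  then show ?thesis by (simp add: W_def mult_ac)
qed

text \<open>Some frequency is at least \<open>|k| / 3\<close>. If it is that of \<open>b\<close>,
  the decay constant \<open>E\<close> of \<open>b\<close> is used; if not, \<open>b\<close> is
  replaced by its supremum \<open>E'\<close>, and the decay comes from the l1 tail of
  \<open>f\<close>.\<close>

lemma triad_forced_sum:
  assumes tr: "triads k F x y z" and f: "small_l1 A f" and d: "decay n D f"
    and b0: "\<And>l. 0 \<le> b l" and b: "\<And>l. b l * J l ^ n \<le> E" and bE: "\<And>l. b l \<le> E'"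
  shows "(\<Sum>i\<in>F. b (x i) * f (y i) * f (z i)) \<le> (E * A\<^sup>2 + 2 * E' * D * A) * 3 ^ n / J k ^ n"
proof -
  define R where "R = \<bar>real_of_int k\<bar> / 3"
  define g where "g = high R f"
  have R0: "0 \<le> R" by (simp add: R_def)
  note f0 = small_l1_nonneg[OF f] and A0 = small_l1_A[OF f]
  have E0: "0 \<le> E" using b[of 0] b0[of 0] by (simp add: jap_def)
  have E0': "0 \<le> E'" using bE[of 0] b0[of 0] by simp
  have D0: "0 \<le> D" using decay_le[OF d, of 0] f0[of 0] by (simp add: jap_def)
  define W where "W = E * 3 ^ n / J k ^ n"
  have W0: "0 \<le> W" unfolding W_def using E0 J_pos[of k] by auto
  have g0: "0 \<le> g l" for l unfolding g_def by (rule small_l1_high_nonneg[OF f])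
  have "(\<Sum>i\<in>F. b (x i) * f (y i) * f (z i))
     \<le> (\<Sum>i\<in>F. W * (f (y i) * f (z i)) + (E' * (g (y i) * f (z i)) + E' * (f (y i) * g (z i))))"
  proof (rule sum_mono)
    fix i assume i: "i \<in> F"
    have k: "\<bar>k\<bar> \<le> \<bar>x i\<bar> + \<bar>y i\<bar> + \<bar>z i\<bar>" using tr i by (auto simp: triads_def)
    have nn: "0 \<le> W * (f (y i) * f (z i))" "0 \<le> E' * (g (y i) * f (z i))" "0 \<le> E' * (f (y i) * g (z i))"
      using W0 E0' f0 g0 by auto
    consider "\<bar>k\<bar> \<le> 3 * \<bar>x i\<bar>" | "\<bar>k\<bar> \<le> 3 * \<bar>y i\<bar>" | "\<bar>k\<bar> \<le> 3 * \<bar>z i\<bar>" using k by linarith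
    then show "b (x i) * f (y i) * f (z i)
       \<le> W * (f (y i) * f (z i)) + (E' * (g (y i) * f (z i)) + E' * (f (y i) * g (z i)))"
    proof cases
      case 1
      have "b (x i) \<le> W" unfolding W_def
        by (rule decay_transfer[OF _ _ b E0]) (use 1 in linarith)+
      then have "b (x i) * (f (y i) * f (z i)) \<le> W * (f (y i) * f (z i))"
        using f0 by (intro mult_right_mono) auto
      then show ?thesis using nn by (simp add: mult.assoc)
    next
      case 2
      have "g (y i) = f (y i)"
        using 2 unfolding g_def high_def R_def by (simp; linarith)
      moreover have "b (x i) * (f (y i) * f (z i)) \<le> E' * (f (y i) * f (z i))"
        using f0 bE by (intro mult_right_mono) auto
      ultimately show ?thesis using nn by (simp add: mult.assoc)
    next
      case 3
      have "g (z i) = f (z i)"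
        using 3 unfolding g_def high_def R_def by (simp; linarith)
      moreover have "b (x i) * (f (y i) * f (z i)) \<le> E' * (f (y i) * f (z i))"
        using f0 bE by (intro mult_right_mono) auto
      ultimately show ?thesis using nn by (simp add: mult.assoc)
    qed
  qed
  also have "\<dots> = W * (\<Sum>i\<in>F. f (y i) * f (z i)) + (E' * (\<Sum>i\<in>F. g (y i) * f (z i)) + E' * (\<Sum>i\<in>F. f (y i) * g (z i)))"
    by (simp add: sum_distrib_left[symmetric] sum.distrib)
  also have "\<dots> \<le> W * (A * A) + (E' * (D / (1 + R) ^ n * A) + E' * (A * (D / (1 + R) ^ n)))"
    using tr f0 g0 small_l1_sum[OF f] decay_high[OF d R0] W0 E0' unfolding triads_def g_def
    by (intro add_mono mult_left_mono sum_pair_le) auto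
  also have "D / (1 + R) ^ n \<le> D * 3 ^ n / J k ^ n"
  proof -
    have "D / (1 + R) ^ n \<le> D / (J k / 3) ^ n"
      using D0 J_pos[of k] by (intro divide_left_mono power_mono) (auto simp: R_def jap_def)
    then show ?thesis by (simp add: power_divide)
  qed
  finally have "(\<Sum>i\<in>F. b (x i) * f (y i) * f (z i))
     \<le> W * (A * A) + (E' * (D * 3 ^ n / J k ^ n * A) + E' * (A * (D * 3 ^ n / J k ^ n)))"
    using A0 E0' by (simp add: mult_left_mono mult_right_mono)
  also have "\<dots> = (E * A\<^sup>2 + 2 * E' * D * A) * 3 ^ n / J k ^ n"
    by (simp add: W_def power2_eq_square add_divide_distrib algebra_simps)
  finally show ?thesis .
qed

section \<open>Resonances\<close>

text \<open>The conjugated frequency is \<open>p + q - k\<close>, so that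
  \<open>k = p - (p + q - k) + q\<close>. The multiplier is evaluated at \<open>k - q\<close>, the
  frequency carried by \<open>|u|^2\<close>, on which the derivative of the Raman term
  falls.\<close>

definition tri :: "(int \<Rightarrow> complex) \<Rightarrow> int \<Rightarrow> (int \<Rightarrow> complex) \<Rightarrow> int \<times> int \<Rightarrow> complex" where
  "tri m k x = (\<lambda>(p, q). m (k - q) * (x p * cnj (x (p + q - k)) * x q))"

definition box :: "int \<Rightarrow> (int \<times> int) set" where
  "box L = {-L..L} \<times> {-L..L}"

lemma finite_box [simp]: "finite (box L)"
  by (simp add: box_def)

lemma tri_term_le:
  assumes m: "\<And>q. cmod (m q) \<le> K * (J k + \<bar>real_of_int q\<bar>)"
  shows "cmod (tri m k x i) \<le> 2 * K * ((J (fst i) + J (fst i + snd i - k) + J (snd i)) *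
           (cmod (x (fst i)) * cmod (x (fst i + snd i - k)) * cmod (x (snd i))))"
proof -
  obtain p q where i: "i = (p, q)" by force
  define X where "X = cmod (x p) * cmod (x (p + q - k)) * cmod (x q)"
  have X0: "0 \<le> X" by (simp add: X_def)
  have "0 \<le> K * J k" using m[of 0] norm_ge_zero[of "m 0"] by (simp del: norm_ge_zero)
  then have K0: "0 \<le> K" using J_pos[of k] by (simp add: zero_le_mult_iff)
  have "J k + \<bar>real_of_int (k - q)\<bar> \<le> 2 * (J p + J (p + q - k) + J q)"
  proof -
    define r where "r = p + q - k"
    have "\<bar>k\<bar> \<le> \<bar>p\<bar> + \<bar>r\<bar> + \<bar>q\<bar>" "\<bar>k - q\<bar> \<le> \<bar>p\<bar> + \<bar>r\<bar>" by (auto simp: r_def)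
    then have "real_of_int (\<bar>k\<bar> + \<bar>k - q\<bar>) \<le> real_of_int (2 * (\<bar>p\<bar> + \<bar>r\<bar> + \<bar>q\<bar>))"
    proof -
      have "X + Y \<le> 2 * (a + b + c)" if "X \<le> a + b + c" "Y \<le> a + b" "0 \<le> c" for X Y a b c :: int
        using that by (simp add: algebra_simps)
      then show "\<bar>k\<bar> \<le> \<bar>p\<bar> + \<bar>r\<bar> + \<bar>q\<bar> \<Longrightarrow> \<bar>k - q\<bar> \<le> \<bar>p\<bar> + \<bar>r\<bar> \<Longrightarrow> ?thesis"
        unfolding of_int_le_iff by (meson abs_ge_zero)
    qed
    then show ?thesis unfolding r_def[symmetric] jap_def by simp
  qed
  then have "cmod (m (k - q)) \<le> K * (2 * (J p + J (p + q - k) + J q))"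
    using m[of "k - q"] K0 by (meson mult_left_mono order_trans)
  then have "cmod (m (k - q)) * X \<le> K * (2 * (J p + J (p + q - k) + J q)) * X"
    using X0 by (rule mult_right_mono)
  then show ?thesis by (simp add: i tri_def norm_mult X_def algebra_simps)
qed

context
  fixes m :: "int \<Rightarrow> complex" and k :: int and x :: "int \<Rightarrow> complex" and A K :: real
  assumes m: "\<And>q. cmod (m q) \<le> K * (J k + \<bar>real_of_int q\<bar>)"
    and x: "small_l1 A (\<lambda>l. cmod (x l))"
begin

lemma tri_K_nonneg: "0 \<le> K"
proof -
  have "0 \<le> K * J k" using m[of 0] norm_ge_zero[of "m 0"] by (simp del: norm_ge_zero)
  then show ?thesis using J_pos[of k] by (simp add: zero_le_mult_iff)
qed

lemma tri_sum_le:
  assumes d: "\<And>l. cmod (x l) * J l ^ Suc n \<le> D" and F: "finite F"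
  shows "(\<Sum>i\<in>F. cmod (tri m k x i)) \<le> 2 * K * (9 * 3 ^ n * D * A\<^sup>2 / J k ^ n)"
proof -
  have "(\<Sum>i\<in>F. cmod (tri m k x i)) \<le> (\<Sum>i\<in>F. 2 * K * ((J (fst i) + J (fst i + snd i - k) + J (snd i)) *
           (cmod (x (fst i)) * cmod (x (fst i + snd i - k)) * cmod (x (snd i)))))"
    by (intro sum_mono tri_term_le m)
  also have "\<dots> \<le> 2 * K * (9 * 3 ^ n * D * A\<^sup>2 / J k ^ n)"
    unfolding sum_distrib_left[symmetric]
    using tri_K_nonneg by (intro mult_left_mono triad_weighted_sum[OF triads_convolution[OF F] x d]) auto
  finally show ?thesis .
qed

lemma tri_abs_summable: "(\<lambda>i. cmod (tri m k x i)) summable_on S"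
proof -
  have "cmod (x l) * J l ^ Suc 0 \<le> A" for l using small_l1_J[OF x, of l] by (simp add: mult.commute)
  then have "(\<Sum>i\<in>F. cmod (tri m k x i)) \<le> 2 * K * (9 * 3 ^ 0 * A * A\<^sup>2 / J k ^ 0)" if "finite F" for F
    using that by (rule tri_sum_le)
  then have "bdd_above (sum (\<lambda>i. cmod (tri m k x i)) ` {F. F \<subseteq> S \<and> finite F})"
    by (intro bdd_aboveI2) auto
  then show ?thesis by (intro nonneg_bdd_above_summable_on) auto
qed

lemma tri_summable: "tri m k x summable_on S"
  using tri_abs_summable by (rule abs_summable_summable)

lemma tri_infsum_le:
  assumes d: "\<And>l. cmod (x l) * J l ^ Suc n \<le> D"
  shows "cmod (infsum (tri m k x) UNIV) \<le> 2 * K * (9 * 3 ^ n * D * A\<^sup>2 / J k ^ n)"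
  using norm_infsum_bound[OF tri_abs_summable, of UNIV]
    infsum_le_finite_sums[OF tri_abs_summable, of UNIV, OF tri_sum_le[OF d]] by linarith

lemma tri_truncation:
  assumes L: "\<bar>k\<bar> \<le> L"
  shows "cmod (infsum (tri m k x) UNIV - sum (tri m k x) (box L))
           \<le> 2 * K * (18 * A ^ 3 / sqrt (1 + real_of_int (L - \<bar>k\<bar>) / 2))"
proof -
  have "infsum (tri m k x) UNIV - sum (tri m k x) (box L) = infsum (tri m k x) (- box L)"
    using infsum_Diff[OF tri_summable tri_summable, of "box L" UNIV]
    by (simp add: Compl_eq_Diff_UNIV)
  also have "cmod \<dots> \<le> infsum (\<lambda>i. cmod (tri m k x i)) (- box L)"
    by (rule norm_infsum_bound[OF tri_abs_summable])
  also have "\<dots> \<le> 2 * K * (18 * A ^ 3 / sqrt (1 + real_of_int (L - \<bar>k\<bar>) / 2))"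
  proof (rule infsum_le_finite_sums[OF tri_abs_summable])
    fix F assume F: "finite F" "F \<subseteq> - box L"
    have far: "L \<le> \<bar>fst i\<bar> \<or> L \<le> \<bar>fst i + snd i - k\<bar> \<or> L \<le> \<bar>snd i\<bar>" if "i \<in> F" for i
    proof -
      have "i \<notin> box L" using that F by auto
      then show ?thesis by (cases i) (auto simp: box_def)
    qed
    have "(\<Sum>i\<in>F. cmod (tri m k x i)) \<le> (\<Sum>i\<in>F. 2 * K * ((J (fst i) + J (fst i + snd i - k) + J (snd i)) *
             (cmod (x (fst i)) * cmod (x (fst i + snd i - k)) * cmod (x (snd i)))))"
      by (intro sum_mono tri_term_le m)
    also have "\<dots> \<le> 2 * K * (18 * A ^ 3 / sqrt (1 + real_of_int (L - \<bar>k\<bar>) / 2))"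
      unfolding sum_distrib_left[symmetric]
      using tri_K_nonneg
      by (intro mult_left_mono triad_weighted_tail[OF triads_convolution[OF F(1)] x far L]) auto
    finally show "(\<Sum>i\<in>F. cmod (tri m k x i)) \<le> 2 * K * (18 * A ^ 3 / sqrt (1 + real_of_int (L - \<bar>k\<bar>) / 2))" .
  qed
  finally show ?thesis .
qed

end

lemma truncation_tendsto_0:
  "((\<lambda>L. c / sqrt (1 + real_of_int (L - \<bar>k\<bar>) / 2)) \<longlongrightarrow> 0) at_top"
proof (rule real_tendsto_divide_at_top[OF tendsto_const])
  have "filterlim (\<lambda>L. (1 - of_int \<bar>k\<bar> / 2) + (1/2) * real_of_int L) at_top at_top"
    by (intro filterlim_tendsto_add_at_top[OF tendsto_const] filterlim_tendsto_pos_mult_at_top[OF tendsto_const]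
        filterlim_real_of_int_at_top) auto
  then have "filterlim (\<lambda>L. 1 + real_of_int (L - \<bar>k\<bar>) / 2) at_top at_top"
    by (simp add: field_simps)
  then show "filterlim (\<lambda>L. sqrt (1 + real_of_int (L - \<bar>k\<bar>) / 2)) at_top at_top"
    by (rule filterlim_compose[OF sqrt_at_top])
qed

text \<open>The tail bound depends on the coefficients only through \<open>A\<close>, so one box
  serves all times; on it the sum is finite and can be differentiated in time.\<close>

lemma tri_truncation_uniform:
  assumes m: "\<And>q. cmod (m q) \<le> K * (J k + \<bar>real_of_int q\<bar>)"
    and x: "\<And>t. t \<in> I \<Longrightarrow> small_l1 A (\<lambda>l. cmod (a t l))" and e: "0 < e"
  shows "\<exists>L\<ge>\<bar>k\<bar>. \<forall>t\<in>I. cmod (infsum (tri m k (a t)) UNIV - sum (tri m k (a t)) (box L)) \<le> e"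
proof -
  have "((\<lambda>L. (2 * K * 18 * A ^ 3) / sqrt (1 + real_of_int (L - \<bar>k\<bar>) / 2)) \<longlongrightarrow> 0) at_top"
    by (rule truncation_tendsto_0)
  then have "\<forall>\<^sub>F L in at_top. (2 * K * 18 * A ^ 3) / sqrt (1 + real_of_int (L - \<bar>k\<bar>) / 2) < e"
    using e by (rule order_tendstoD)
  then have "\<forall>\<^sub>F L in at_top. (2 * K * 18 * A ^ 3) / sqrt (1 + real_of_int (L - \<bar>k\<bar>) / 2) < e \<and> \<bar>k\<bar> \<le> L"
    by (intro eventually_conj eventually_ge_at_top)
  then obtain L where L: "(2 * K * 18 * A ^ 3) / sqrt (1 + real_of_int (L - \<bar>k\<bar>) / 2) < e" "\<bar>k\<bar> \<le> L"
    by (metis (mono_tags, lifting) eventually_at_top_linorder order_refl)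
  show ?thesis
  proof (intro exI[of _ L] conjI ballI)
    fix t assume "t \<in> I"
    from tri_truncation[OF m x[OF this] L(2)] L(1)
    show "cmod (infsum (tri m k (a t)) UNIV - sum (tri m k (a t)) (box L)) \<le> e"
      by (simp add: mult.assoc)
  qed (use L in auto)
qed

lemma continuous_on_tri:
  assumes "\<And>l. continuous_on I (\<lambda>t. a t l)"
  shows "continuous_on I (\<lambda>t. tri m k (a t) i)"
  unfolding tri_def case_prod_beta by (intro continuous_intros assms)

text \<open>The truncations are continuous in time and converge uniformly.\<close>

lemma continuous_on_tri_infsum:
  assumes m: "\<And>q. cmod (m q) \<le> K * (J k + \<bar>real_of_int q\<bar>)"
    and x: "\<And>t. t \<in> I \<Longrightarrow> small_l1 A (\<lambda>l. cmod (a t l))"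
    and c: "\<And>l. continuous_on I (\<lambda>t. a t l)"
  shows "continuous_on I (\<lambda>t. infsum (tri m k (a t)) UNIV)"
proof -
  have "\<exists>L\<ge>\<bar>k\<bar>. \<forall>t\<in>I. cmod (infsum (tri m k (a t)) UNIV - sum (tri m k (a t)) (box L)) \<le> 1 / real (Suc n)" for n
    by (rule tri_truncation_uniform[OF m x]) auto
  then obtain L where L: "\<And>n t. t \<in> I \<Longrightarrow> cmod (infsum (tri m k (a t)) UNIV - sum (tri m k (a t)) (box (L n))) \<le> 1 / real (Suc n)"
    by metis
  have "uniform_limit I (\<lambda>n t. sum (tri m k (a t)) (box (L n))) (\<lambda>t. infsum (tri m k (a t)) UNIV) sequentially"
  proof (rule uniform_limitI)
    fix e :: real assume "0 < e"
    then obtain n0 where n0: "1 / real (Suc n0) < e" using nat_approx_posE by blast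
    have "\<forall>t\<in>I. dist (sum (tri m k (a t)) (box (L n))) (infsum (tri m k (a t)) UNIV) < e" if "n0 \<le> n" for n
    proof
      fix t assume "t \<in> I"
      have "1 / real (Suc n) \<le> 1 / real (Suc n0)" using that by (intro divide_left_mono) auto
      then show "dist (sum (tri m k (a t)) (box (L n))) (infsum (tri m k (a t)) UNIV) < e"
        using L[OF \<open>t \<in> I\<close>, of n] n0 by (simp add: dist_norm norm_minus_commute)
    qed
    then show "\<forall>\<^sub>F n in sequentially. \<forall>t\<in>I. dist (sum (tri m k (a t)) (box (L n))) (infsum (tri m k (a t)) UNIV) < e"
      by (auto simp: eventually_sequentially)
  qed
  then show ?thesis
    by (rule uniform_limit_theorem[rotated])
       (auto intro!: always_eventually continuous_on_sum continuous_on_tri c)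
qed

section \<open>The dispersion relation, its resonance function and the symbol of the normal
  form\<close>

locale raman =
  fixes \<alpha>1 \<alpha>2 \<gamma>1 \<gamma>2 \<Gamma> :: real
  assumes \<Gamma>_pos: "\<Gamma> > 0" and \<alpha>1_nz: "\<alpha>1 \<noteq> 0" and nonint: "2 * \<alpha>2 / (3 * \<alpha>1) \<notin> \<int>"
begin

text \<open>The linear operator \<open>\<alpha>1 dx^3 + i \<alpha>2 dx^2\<close> acts on the mode
  \<open>k\<close> as multiplication by \<open>- i \<omega> k\<close>.\<close>

definition \<omega> :: "int \<Rightarrow> real" where
  "\<omega> k = \<alpha>1 * real_of_int k ^ 3 + \<alpha>2 * (real_of_int k)\<^sup>2"

text \<open>In the Raman term the derivative of \<open>|u|^2\<close> at frequency \<open>q\<close>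
  turns \<open>- i \<Gamma>\<close> into \<open>- i \<Gamma> * i q = \<Gamma> q\<close>. It is the
  only real contribution and the source of growth and decay. The factor \<open>1 / (2 * pi)\<close>
  stems from two convolutions under the symmetric normalisation of \<open>fourier\<close>.\<close>

definition \<mu> :: "int \<Rightarrow> int \<Rightarrow> complex" where
  "\<mu> k q = (\<i> * \<gamma>1 + \<i> * \<gamma>2 * of_int k + \<Gamma> * of_int q) / (2 * pi)"

text \<open>Phase of the interaction of \<open>p\<close>, \<open>p + q - k\<close>, \<open>q\<close>
  into \<open>k\<close>: once the linear evolution is removed, the cubic term oscillates like
  \<open>exp (i \<Phi> t)\<close>.\<close>

definition \<Phi> :: "int \<Rightarrow> int \<times> int \<Rightarrow> real" where
  "\<Phi> k = (\<lambda>(p, q). \<omega> k - \<omega> p + \<omega> (p + q - k) - \<omega> q)"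

text \<open>The first two factors vanish on the trivial resonances \<open>p = k\<close> and
  \<open>q = k\<close>. The third is
  \<open>3 \<alpha>1 (p + q + 2 \<alpha>2 / (3 \<alpha>1))\<close>, which cannot vanish because
  \<open>p + q\<close> is an integer and the quotient is not.\<close>

lemma \<Phi>_factor:
  "\<Phi> k (p, q) = real_of_int (k - p) * real_of_int (k - q) * (3 * \<alpha>1 * real_of_int (p + q) + 2 * \<alpha>2)"
  unfolding \<Phi>_def \<omega>_def by (simp add: algebra_simps power2_eq_square power3_eq_cube)

text \<open>Not mere nonvanishing but growth in \<open>S\<close> is needed: the distance of the
  quotient to the integers is positive, which settles bounded \<open>S\<close>, and large
  \<open>S\<close> dominates the fixed shift.\<close>

lemma resonance_gap: "\<exists>c>0. \<forall>S::int. c * (1 + \<bar>real_of_int S\<bar>) \<le> \<bar>3 * \<alpha>1 * real_of_int S + 2 * \<alpha>2\<bar>"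
proof -
  define \<kappa> where "\<kappa> = 2 * \<alpha>2 / (3 * \<alpha>1)"
  define d where "d = min (frac \<kappa>) (1 - frac \<kappa>)"
  have "frac \<kappa> \<noteq> 0" using nonint by (simp add: \<kappa>_def frac_eq_0_iff)
  then have d0: "0 < d" using frac_lt_1[of \<kappa>] frac_ge_0[of \<kappa>] by (simp add: d_def)
  have dist: "d \<le> \<bar>real_of_int S + \<kappa>\<bar>" for S :: int
  proof -
    have eq: "real_of_int S + \<kappa> = real_of_int (S + \<lfloor>\<kappa>\<rfloor>) + frac \<kappa>" by (simp add: frac_def)
    show ?thesis
    proof (cases "0 \<le> S + \<lfloor>\<kappa>\<rfloor>")
      case True
      then have "0 \<le> real_of_int (S + \<lfloor>\<kappa>\<rfloor>)" by linarith
      then show ?thesis unfolding eq d_def using frac_ge_0[of \<kappa>] by linarith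
    next
      case False
      then have "real_of_int (S + \<lfloor>\<kappa>\<rfloor>) \<le> -1" by linarith
      then show ?thesis unfolding eq d_def using frac_lt_1[of \<kappa>] by linarith
    qed
  qed
  \<comment> \<open>From \<open>1 + |S| \<le> |S + \<kappa>| + (1 + |\<kappa>|)\<close>, where the
    last bracket is at most \<open>(1 + |\<kappa>|) / d\<close> times
    \<open>|S + \<kappa>|\<close>.\<close>
  define B where "B = 1 + (1 + \<bar>\<kappa>\<bar>) / d"
  have B0: "0 < B" unfolding B_def using d0 by (simp add: add_pos_nonneg)
  have main: "1 + \<bar>real_of_int S\<bar> \<le> B * \<bar>real_of_int S + \<kappa>\<bar>" for S :: int
  proof -
    have "1 + \<bar>\<kappa>\<bar> = (1 + \<bar>\<kappa>\<bar>) / d * d" using d0 by simp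
    also have "\<dots> \<le> (1 + \<bar>\<kappa>\<bar>) / d * \<bar>real_of_int S + \<kappa>\<bar>"
      using dist d0 by (intro mult_left_mono) auto
    finally show ?thesis unfolding B_def by (simp add: distrib_right)
  qed
  show ?thesis
  proof (intro exI[of _ "3 * \<bar>\<alpha>1\<bar> / B"] conjI allI)
    show "0 < 3 * \<bar>\<alpha>1\<bar> / B" using \<alpha>1_nz B0 by simp
    fix S :: int
    have "3 * \<alpha>1 * real_of_int S + 2 * \<alpha>2 = 3 * \<alpha>1 * (real_of_int S + \<kappa>)"
      using \<alpha>1_nz by (simp add: \<kappa>_def distrib_left)
    then have "\<bar>3 * \<alpha>1 * real_of_int S + 2 * \<alpha>2\<bar> = 3 * \<bar>\<alpha>1\<bar> * \<bar>real_of_int S + \<kappa>\<bar>"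
      by (simp add: abs_mult)
    also have "\<dots> \<ge> 3 * \<bar>\<alpha>1\<bar> * ((1 + \<bar>real_of_int S\<bar>) / B)"
      using main[of S] B0 by (intro mult_left_mono) (auto simp: pos_divide_le_eq mult.commute)
    finally show "3 * \<bar>\<alpha>1\<bar> / B * (1 + \<bar>real_of_int S\<bar>) \<le> \<bar>3 * \<alpha>1 * real_of_int S + 2 * \<alpha>2\<bar>" by simp
  qed
qed

lemma \<mu>_le: "cmod (\<mu> k q) \<le> (\<bar>\<gamma>1\<bar> + \<bar>\<gamma>2\<bar> + \<Gamma>) * (J k + \<bar>real_of_int q\<bar>)"
proof -
  have "cmod (\<mu> k q) = cmod (\<i> * \<gamma>1 + \<i> * \<gamma>2 * of_int k + \<Gamma> * of_int q) / (2 * pi)"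
    by (simp add: \<mu>_def norm_divide norm_mult)
  also have "\<dots> \<le> cmod (\<i> * \<gamma>1 + \<i> * \<gamma>2 * of_int k + \<Gamma> * of_int q) / 1"
    using pi_gt3 by (intro divide_left_mono) auto
  also have "\<dots> \<le> \<bar>\<gamma>1\<bar> + \<bar>\<gamma>2\<bar> * \<bar>real_of_int k\<bar> + \<Gamma> * \<bar>real_of_int q\<bar>"
    using norm_triangle_ineq[of "\<i> * \<gamma>1 + \<i> * \<gamma>2 * of_int k" "\<Gamma> * of_int q"]
      norm_triangle_ineq[of "\<i> * \<gamma>1" "\<i> * \<gamma>2 * of_int k"] \<Gamma>_pos
    by (simp add: norm_mult)
  also have "\<dots> \<le> (\<bar>\<gamma>1\<bar> + \<bar>\<gamma>2\<bar> + \<Gamma>) * (J k + \<bar>real_of_int q\<bar>)"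
  proof -
    define X where "X = J k + \<bar>real_of_int q\<bar>"
    have "1 \<le> X" "\<bar>real_of_int k\<bar> \<le> X" "\<bar>real_of_int q\<bar> \<le> X" by (auto simp: X_def jap_def)
    then have "\<bar>\<gamma>1\<bar> * 1 \<le> \<bar>\<gamma>1\<bar> * X" "\<bar>\<gamma>2\<bar> * \<bar>real_of_int k\<bar> \<le> \<bar>\<gamma>2\<bar> * X" "\<Gamma> * \<bar>real_of_int q\<bar> \<le> \<Gamma> * X"
      using \<Gamma>_pos by (intro mult_left_mono; simp)+
    then show ?thesis unfolding X_def[symmetric] by (simp add: distrib_right)
  qed
  finally show ?thesis .
qed

text \<open>The only region in which the symbol is not bounded by a multiple of
  \<open>1 / J k\<close>.\<close>

definition all_high :: "int \<Rightarrow> int \<times> int \<Rightarrow> bool" where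
  "all_high k = (\<lambda>(p, q). \<bar>k\<bar> \<le> 2 * \<bar>p\<bar> \<and> \<bar>k\<bar> \<le> 2 * \<bar>p + q - k\<bar> \<and> \<bar>k\<bar> \<le> 2 * \<bar>q\<bar>)"

text \<open>Two of the three factors are at least \<open>X / 5\<close>. For each choice of the
  second factor on the left, one of those two is different from it and can be used to bound
  \<open>X\<close>.\<close>

lemma triple_product_bound:
  fixes P Q S X :: real
  assumes "1 \<le> P" "1 \<le> Q" "1 \<le> S" "0 \<le> X"
    and "X \<le> 5 * P \<and> X \<le> 5 * Q \<or> X \<le> 5 * P \<and> X \<le> 5 * S \<or> X \<le> 5 * Q \<and> X \<le> 5 * S"
  shows "X * 1 \<le> 5 * (P * Q * S) \<and> X * P \<le> 5 * (P * Q * S) \<and> X * Q \<le> 5 * (P * Q * S) \<and> X * S \<le> 5 * (P * Q * S)"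
proof -
  have PQ: "P \<le> P * Q" "Q \<le> P * Q" and PS: "P \<le> P * S" "S \<le> P * S" and QS: "Q \<le> Q * S" "S \<le> Q * S"
    using assms by (auto simp: mult_le_cancel_left1 mult_le_cancel_right1)
  have nn: "0 \<le> P * Q" using assms by simp
  have T: "P * Q \<le> P * Q * S" "P * S \<le> P * Q * S" "Q * S \<le> P * Q * S"
    using assms mult_right_mono[OF PQ(1), of S] mult_right_mono[OF PQ(2), of S]
      mult_left_mono[OF assms(3) nn] by auto
  have k: "X * Y \<le> 5 * (P * Q * S)" if "X \<le> 5 * Z" "0 \<le> Y" "Z * Y \<le> P * Q * S" for Y Z
    using mult_right_mono[OF that(1,2)] that(3) by linarith
  show ?thesis using assms(5)
  proof (elim disjE conjE)
    assume h: "X \<le> 5 * P" "X \<le> 5 * Q"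
    show ?thesis
      using k[OF h(1), of 1] k[OF h(2), of P] k[OF h(1), of Q] k[OF h(1), of S] T PQ PS QS assms
      by (auto simp: mult.commute)
  next
    assume h: "X \<le> 5 * P" "X \<le> 5 * S"
    show ?thesis
      using k[OF h(1), of 1] k[OF h(2), of P] k[OF h(1), of Q] k[OF h(1), of S] T PQ PS QS assms
      by (auto simp: mult.commute)
  next
    assume h: "X \<le> 5 * Q" "X \<le> 5 * S"
    show ?thesis
      using k[OF h(1), of 1] k[OF h(2), of P] k[OF h(2), of Q] k[OF h(1), of S] T PQ PS QS assms
      by (auto simp: mult.commute)
  qed
qed

text \<open>Writing \<open>P = |k - p|\<close>, \<open>Q = |k - q|\<close>, \<open>S = 1 + |p + q|\<close>, the numerator is controlled by the
  largest of these three since \<open>2k = (k - p) + (k - q) + (p + q)\<close>; unless all interacting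
  frequencies are comparable to \<open>k\<close> or larger, at least two of the three are of size \<open>|k|\<close>.\<close>

lemma symbol_bound_aux:
  assumes "p \<noteq> k" "q \<noteq> k"
  shows "J k + \<bar>real_of_int (k - q)\<bar> \<le> 18 * (1 / J k + of_bool (all_high k (p, q))) *
     (\<bar>real_of_int (k - p)\<bar> * \<bar>real_of_int (k - q)\<bar> * (1 + \<bar>real_of_int (p + q)\<bar>))"
proof -
  define P Q S X where "P = \<bar>real_of_int (k - p)\<bar>" and "Q = \<bar>real_of_int (k - q)\<bar>"
    and "S = 1 + \<bar>real_of_int (p + q)\<bar>" and "X = J k"
  have P1: "1 \<le> P" using assms unfolding P_def by linarith
  have Q1: "1 \<le> Q" using assms unfolding Q_def by linarith
  have S1: "1 \<le> S" by (simp add: S_def)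
  have X1: "1 \<le> X" by (simp add: X_def J_ge_1)
  have "2 * \<bar>real_of_int k\<bar> \<le> P + Q + (S - 1)"
    by (simp add: P_def Q_def S_def)
  then have X: "X + Q \<le> 1 + P / 2 + 3 * Q / 2 + S / 2"
    unfolding X_def jap_def by linarith
  define T where "T = P * Q * S"
  have PQ: "P \<le> P * Q" "Q \<le> P * Q" and PQ1: "1 \<le> P * Q"
    using P1 Q1 mult_mono[of 1 P 1 Q] by (auto simp: mult_le_cancel_left1 mult_le_cancel_right1)
  have "P * Q \<le> T" "S \<le> T"
    using S1 PQ1 P1 Q1 unfolding T_def by (auto simp: mult_le_cancel_left1 mult_le_cancel_right1)
  with PQ PQ1 have T: "1 \<le> T" "P \<le> T" "Q \<le> T" "S \<le> T" by linarith+
  show ?thesis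
  proof (cases "all_high k (p, q)")
    case True
    have "X + Q \<le> 4 * T" using X T by linarith
    also have "4 * T \<le> 18 * (1 / X + 1) * T" using T X1 by (intro mult_right_mono) auto
    finally show ?thesis using True by (simp add: T_def P_def Q_def S_def X_def)
  next
    case False
    have "(\<bar>k\<bar> \<le> 4 * \<bar>k - p\<bar> \<and> \<bar>k\<bar> \<le> 4 * \<bar>k - q\<bar>) \<or> (\<bar>k\<bar> \<le> 4 * \<bar>k - p\<bar> \<and> \<bar>k\<bar> \<le> 4 * \<bar>p + q\<bar>)
       \<or> (\<bar>k\<bar> \<le> 4 * \<bar>k - q\<bar> \<and> \<bar>k\<bar> \<le> 4 * \<bar>p + q\<bar>)"
    proof -
      \<comment> \<open>Each row treats one interacting frequency below \<open>|k| / 2\<close>: the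
        first inequality makes one of the three differences at least \<open>|k| / 2\<close>, the
        second makes the other two add up to at least \<open>|k| / 2\<close>, so that one of them is
        at least \<open>|k| / 4\<close>.\<close>
      have tri: "\<bar>k\<bar> \<le> \<bar>k - p\<bar> + \<bar>p\<bar>" "\<bar>k\<bar> \<le> \<bar>p\<bar> + \<bar>k - q\<bar> + \<bar>p + q\<bar>"
        "\<bar>k\<bar> \<le> \<bar>k - q\<bar> + \<bar>q\<bar>" "\<bar>k\<bar> \<le> \<bar>q\<bar> + \<bar>k - p\<bar> + \<bar>p + q\<bar>"
        "\<bar>k\<bar> \<le> \<bar>p + q\<bar> + \<bar>p + q - k\<bar>" "\<bar>k\<bar> \<le> \<bar>p + q - k\<bar> + \<bar>k - p\<bar> + \<bar>k - q\<bar>"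
        by auto
      define u v w where "u = \<bar>k - p\<bar>" and "v = \<bar>k - q\<bar>" and "w = \<bar>p + q\<bar>"
      define a b c m where "a = \<bar>p\<bar>" and "b = \<bar>q\<bar>" and "c = \<bar>p + q - k\<bar>" and "m = \<bar>k\<bar>"
      note d = u_def[symmetric] v_def[symmetric] w_def[symmetric] a_def[symmetric] b_def[symmetric]
        c_def[symmetric] m_def[symmetric]
      have m0: "0 \<le> m" by (simp add: m_def)
      consider "2 * a < m" | "2 * b < m" | "2 * c < m"
        using False unfolding all_high_def prod.case d by linarith
      then have "(m \<le> 4 * u \<and> m \<le> 4 * v) \<or> (m \<le> 4 * u \<and> m \<le> 4 * w) \<or> (m \<le> 4 * v \<and> m \<le> 4 * w)"
      proof cases
        case 1
        then have "m \<le> 4 * u" "m \<le> 4 * v \<or> m \<le> 4 * w"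
          using m0 tri(1,2) unfolding d by linarith+
        then show ?thesis by blast
      next
        case 2
        then have "m \<le> 4 * v" "m \<le> 4 * u \<or> m \<le> 4 * w"
          using m0 tri(3,4) unfolding d by linarith+
        then show ?thesis by blast
      next
        case 3
        then have "m \<le> 4 * w" "m \<le> 4 * u \<or> m \<le> 4 * v"
          using m0 tri(5,6) unfolding d by linarith+
        then show ?thesis by blast
      qed
      then show ?thesis unfolding d .
    qed
    then have "(real_of_int \<bar>k\<bar> \<le> real_of_int (4 * \<bar>k - p\<bar>) \<and> real_of_int \<bar>k\<bar> \<le> real_of_int (4 * \<bar>k - q\<bar>)) \<or> 
        (real_of_int \<bar>k\<bar> \<le> real_of_int (4 * \<bar>k - p\<bar>) \<and> real_of_int \<bar>k\<bar> \<le> real_of_int (4 * \<bar>p + q\<bar>))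
       \<or> (real_of_int \<bar>k\<bar> \<le> real_of_int (4 * \<bar>k - q\<bar>) \<and> real_of_int \<bar>k\<bar> \<le> real_of_int (4 * \<bar>p + q\<bar>))"
      by (simp only: of_int_le_iff)
    moreover have "real_of_int (4 * \<bar>k - p\<bar>) = 4 * P" "real_of_int (4 * \<bar>k - q\<bar>) = 4 * Q"
        "real_of_int (4 * \<bar>p + q\<bar>) = 4 * (S - 1)" "real_of_int \<bar>k\<bar> = X - 1"
      by (simp_all add: P_def Q_def S_def X_def jap_def)
    ultimately have "X - 1 \<le> 4 * P \<and> X - 1 \<le> 4 * Q \<or> X - 1 \<le> 4 * P \<and> X - 1 \<le> 4 * (S - 1) \<or>
        X - 1 \<le> 4 * Q \<and> X - 1 \<le> 4 * (S - 1)" by metis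
    then have two: "X \<le> 5 * P \<and> X \<le> 5 * Q \<or> X \<le> 5 * P \<and> X \<le> 5 * S \<or> X \<le> 5 * Q \<and> X \<le> 5 * S"
      using P1 Q1 S1 by auto
    have B: "X * 1 \<le> 5 * T" "X * P \<le> 5 * T" "X * Q \<le> 5 * T" "X * S \<le> 5 * T"
      using triple_product_bound[OF P1 Q1 S1 _ two] X1 by (auto simp: T_def)
    have "X * (X + Q) \<le> X * (1 + P / 2 + 3 * Q / 2 + S / 2)"
      using X X1 by (intro mult_left_mono) auto
    also have "\<dots> = X * 1 + X * P / 2 + 3 * (X * Q) / 2 + X * S / 2" by (simp add: algebra_simps)
    \<comment> \<open>The coefficients add up to 5 + 5/2 + 15/2 + 5/2 = 35/2.\<close>
    also have "\<dots> \<le> 18 * T" using B T by linarith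
    finally have "X + Q \<le> 18 * (1 / X) * T" using X1 by (simp add: field_simps)
    then show ?thesis using False by (simp add: T_def P_def Q_def S_def X_def)
  qed
qed

text \<open>Division by \<open>i \<Phi>\<close> is the integration in time of the oscillating
  factor. It is applied on \<open>nonres\<close> only, where the phase does not vanish.\<close>

definition symb :: "int \<Rightarrow> int \<times> int \<Rightarrow> complex" where
  "symb k = (\<lambda>(p, q). \<mu> k (k - q) / (\<i> * \<Phi> k (p, q)))"

definition nonres :: "int \<Rightarrow> int \<Rightarrow> (int \<times> int) set" where
  "nonres k L = {i \<in> box L. fst i \<noteq> k \<and> snd i \<noteq> k}"

lemma finite_nonres [simp]: "finite (nonres k L)"
  by (simp add: nonres_def)

lemma \<Phi>_nz: "i \<in> nonres k L \<Longrightarrow> \<Phi> k i \<noteq> 0"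
proof -
  assume i: "i \<in> nonres k L"
  obtain c where c: "c > 0" "\<And>S::int. c * (1 + \<bar>real_of_int S\<bar>) \<le> \<bar>3 * \<alpha>1 * real_of_int S + 2 * \<alpha>2\<bar>"
    using resonance_gap by blast
  have "0 < c * (1 + \<bar>real_of_int (fst i + snd i)\<bar>)" using c(1) by (intro mult_pos_pos) auto
  with c(2)[of "fst i + snd i"] have "3 * \<alpha>1 * real_of_int (fst i + snd i) + 2 * \<alpha>2 \<noteq> 0" by auto
  then show ?thesis using i \<Phi>_factor[of k "fst i" "snd i"] by (auto simp: nonres_def)
qed

text \<open>The same product \<open>T\<close> bounds the phase from below, by
  \<open>resonance_gap\<close>, and the multiplier from above, by \<open>symbol_bound_aux\<close>,
  so it cancels. The constant is uniform in \<open>k\<close> and in the box.\<close>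

lemma symbol_bound:
  "\<exists>C>0. \<forall>k L. \<forall>i\<in>nonres k L. cmod (symb k i) \<le> C * (1 / J k + of_bool (all_high k i))"
proof -
  obtain c where c: "c > 0" "\<And>S::int. c * (1 + \<bar>real_of_int S\<bar>) \<le> \<bar>3 * \<alpha>1 * real_of_int S + 2 * \<alpha>2\<bar>"
    using resonance_gap by blast
  define K where "K = \<bar>\<gamma>1\<bar> + \<bar>\<gamma>2\<bar> + \<Gamma>"
  have K0: "0 < K" using \<Gamma>_pos by (simp add: K_def add_nonneg_pos)
  show ?thesis
  proof (intro exI[of _ "18 * K / c"] conjI allI ballI)
    show "0 < 18 * K / c" using K0 c by simp
    fix k L i assume i: "i \<in> nonres k L"
    obtain p q where pq: "i = (p, q)" by force
    have nk: "p \<noteq> k" "q \<noteq> k" using i by (auto simp: nonres_def pq)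
    define T where "T = \<bar>real_of_int (k - p)\<bar> * \<bar>real_of_int (k - q)\<bar> * (1 + \<bar>real_of_int (p + q)\<bar>)"
    have T0: "0 < T" unfolding T_def using nk by (intro mult_pos_pos) auto
    have "c * T \<le> \<bar>real_of_int (k - p)\<bar> * \<bar>real_of_int (k - q)\<bar> * \<bar>3 * \<alpha>1 * real_of_int (p + q) + 2 * \<alpha>2\<bar>"
      using mult_left_mono[OF c(2)[of "p + q"], of "\<bar>real_of_int (k - p)\<bar> * \<bar>real_of_int (k - q)\<bar>"]
      by (simp add: T_def mult_ac)
    then have \<Phi>: "c * T \<le> \<bar>\<Phi> k i\<bar>" unfolding pq \<Phi>_factor by (simp add: abs_mult)
    have "0 < c * T" using c T0 by simp
    with \<Phi> have \<Phi>0: "0 < \<bar>\<Phi> k i\<bar>" by linarith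
    have "cmod (symb k i) = cmod (\<mu> k (k - q)) / \<bar>\<Phi> k i\<bar>"
      by (simp add: symb_def pq norm_divide norm_mult)
    also have "\<dots> \<le> cmod (\<mu> k (k - q)) / (c * T)"
      using \<Phi> c T0 \<Phi>0 by (intro divide_left_mono mult_pos_pos) auto
    also have "\<dots> \<le> K * (18 * (1 / J k + of_bool (all_high k i)) * T) / (c * T)"
    proof (intro divide_right_mono)
      have "cmod (\<mu> k (k - q)) \<le> K * (J k + \<bar>real_of_int (k - q)\<bar>)" unfolding K_def by (rule \<mu>_le)
      also have "\<dots> \<le> K * (18 * (1 / J k + of_bool (all_high k i)) * T)"
        unfolding pq T_def using K0 symbol_bound_aux[OF nk] by (intro mult_left_mono) auto
      finally show "cmod (\<mu> k (k - q)) \<le> K * (18 * (1 / J k + of_bool (all_high k i)) * T)" .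
    qed (use c T0 in auto)
    also have "\<dots> = 18 * K / c * (1 / J k + of_bool (all_high k i))" using T0 by simp
    finally show "cmod (symb k i) \<le> 18 * K / c * (1 / J k + of_bool (all_high k i))" .
  qed
qed

end

section \<open>Differential inequalities and weighted sequences\<close>

text \<open>The derivative of \<open>|w|^2\<close> is at most \<open>- 2 c |w|^2 + 2 G |w|\<close>,
  hence at most \<open>- c |w|^2 + G^2 / c\<close> by completing the square; so
  \<open>exp (c (s - a)) * (|w|^2 - (G / c)^2)\<close> does not increase. The square avoids the
  zeros of \<open>w\<close>, where the modulus need not be differentiable, and taking the root at
  the end halves the exponent.\<close>

lemma damped_ode_bound:
  fixes w \<rho> g :: "real \<Rightarrow> complex"
  assumes ab: "a \<le> t" "t \<le> b" and cont: "continuous_on {a..b} w"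
    and der: "\<And>s. a < s \<Longrightarrow> s < b \<Longrightarrow> (w has_vector_derivative (\<rho> s * w s + g s)) (at s)"
    and c: "0 < c" and re: "\<And>s. a < s \<Longrightarrow> s < b \<Longrightarrow> Re (\<rho> s) \<le> - c"
    and G: "\<And>s. a < s \<Longrightarrow> s < b \<Longrightarrow> cmod (g s) \<le> G" and G0: "0 \<le> G"
  shows "cmod (w t) \<le> cmod (w a) * exp (- (c * (t - a) / 2)) + G / c"
proof -
  define f where "f s = exp (c * (s - a)) * ((cmod (w s))\<^sup>2 - (G / c)\<^sup>2)" for s
  have "f t \<le> f a"
  proof (rule DERIV_nonpos_imp_decreasing_open[OF ab(1)])
    show "continuous_on {a..t} f" unfolding f_def
      using ab by (intro continuous_intros continuous_on_subset[OF cont]) auto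
    fix s assume s: "a < s" "s < t"
    define d where "d = 2 * Re (cnj (w s) * (\<rho> s * w s + g s))"
    have sq: "(\<lambda>s. (cmod (w s))\<^sup>2) = (\<lambda>s. (Re (w s))\<^sup>2 + (Im (w s))\<^sup>2)"
      by (simp add: cmod_power2)
    have ws: "(w has_vector_derivative (\<rho> s * w s + g s)) (at s)" using der s ab by auto
    have re': "((\<lambda>s. Re (w s)) has_real_derivative Re (\<rho> s * w s + g s)) (at s)"
      "((\<lambda>s. Im (w s)) has_real_derivative Im (\<rho> s * w s + g s)) (at s)"
      using ws has_vector_derivative_complex_iff by blast+
    define q where "q s = (cmod (w s))\<^sup>2" for s
    have "((\<lambda>s. (cmod (w s))\<^sup>2) has_real_derivative d) (at s)"
      unfolding sq d_def by (rule derivative_eq_intros re' refl | simp)+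
    then have "(f has_real_derivative (exp (c * (s - a)) * (c * ((cmod (w s))\<^sup>2 - (G / c)\<^sup>2) + d))) (at s)"
      unfolding f_def q_def[symmetric] by (auto intro!: derivative_eq_intros simp: algebra_simps)
    moreover have "c * ((cmod (w s))\<^sup>2 - (G / c)\<^sup>2) + d \<le> 0"
    proof -
      have "Re (cnj (w s) * (\<rho> s * w s)) = Re (\<rho> s) * (cmod (w s))\<^sup>2"
        unfolding cmod_power2 by (simp add: power2_eq_square algebra_simps)
      also have "\<dots> \<le> - c * (cmod (w s))\<^sup>2" using re s ab by (intro mult_right_mono) auto
      finally have 1: "Re (cnj (w s) * (\<rho> s * w s)) \<le> - c * (cmod (w s))\<^sup>2" .
      have "Re (cnj (w s) * g s) \<le> cmod (w s) * cmod (g s)"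
        using complex_Re_le_cmod[of "cnj (w s) * g s"] by (simp add: norm_mult)
      also have "\<dots> \<le> cmod (w s) * G" using G s ab by (intro mult_left_mono) auto
      finally have 2: "d \<le> - 2 * c * (cmod (w s))\<^sup>2 + 2 * (cmod (w s) * G)"
        using 1 unfolding d_def by (simp add: distrib_left)
      have "0 \<le> c * (cmod (w s) - G / c)\<^sup>2" using c by simp
      also have "\<dots> = c * (cmod (w s))\<^sup>2 - 2 * (cmod (w s) * G) + c * (G / c)\<^sup>2"
        using c by (simp add: power2_diff algebra_simps)
      finally show ?thesis using 2 by (simp add: algebra_simps)
    qed
    ultimately show "\<exists>y. (f has_real_derivative y) (at s) \<and> y \<le> 0"
      by (auto simp: mult_le_0_iff intro!: exI)
  qed
  then have "exp (c * (t - a)) * ((cmod (w t))\<^sup>2 - (G / c)\<^sup>2) \<le> (cmod (w a))\<^sup>2 - (G / c)\<^sup>2"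
    by (simp add: f_def)
  also have "\<dots> \<le> (cmod (w a))\<^sup>2" by simp
  finally have "(cmod (w t))\<^sup>2 - (G / c)\<^sup>2 \<le> (cmod (w a))\<^sup>2 / exp (c * (t - a))"
    by (simp add: pos_le_divide_eq mult.commute)
  also have "\<dots> = (cmod (w a) * exp (- (c * (t - a) / 2)))\<^sup>2"
  proof -
    have "exp (c * (t - a)) = (exp (c * (t - a) / 2))\<^sup>2"
      using exp_double[of "c * (t - a) / 2"] by simp
    then show ?thesis
      unfolding exp_minus by (simp only: power_mult_distrib divide_inverse power_inverse)
  qed
  finally have "(cmod (w t))\<^sup>2 \<le> (cmod (w a) * exp (- (c * (t - a) / 2)))\<^sup>2 + (G / c)\<^sup>2" by simp
  also have "\<dots> \<le> (cmod (w a) * exp (- (c * (t - a) / 2)) + G / c)\<^sup>2"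
    using c G0 by (simp add: power2_sum)
  finally show ?thesis
    by (rule power2_le_imp_le) (use c G0 in auto)
qed

text \<open>Time reversal turns growth into damping, so that the value at the later time controls
  the earlier ones.\<close>

lemma growing_ode_bound:
  fixes w \<rho> g :: "real \<Rightarrow> complex"
  assumes ab: "a \<le> t" "t \<le> b" and cont: "continuous_on {a..b} w"
    and der: "\<And>s. a < s \<Longrightarrow> s < b \<Longrightarrow> (w has_vector_derivative (\<rho> s * w s + g s)) (at s)"
    and c: "0 < c" and re: "\<And>s. a < s \<Longrightarrow> s < b \<Longrightarrow> c \<le> Re (\<rho> s)"
    and G: "\<And>s. a < s \<Longrightarrow> s < b \<Longrightarrow> cmod (g s) \<le> G" and G0: "0 \<le> G"
  shows "cmod (w t) \<le> cmod (w b) * exp (- (c * (b - t) / 2)) + G / c"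
proof -
  have "cmod (w (- (- t))) \<le> cmod (w (- (- b))) * exp (- (c * (- t - (- b)) / 2)) + G / c"
  proof (rule damped_ode_bound[where b = "- a" and w = "\<lambda>s. w (- s)" and \<rho> = "\<lambda>s. - \<rho> (- s)" and g = "\<lambda>s. - g (- s)"])
    show "continuous_on {- b..- a} (\<lambda>s. w (- s))"
      by (intro continuous_on_compose2[OF cont] continuous_intros) auto
    fix s assume s: "- b < s" "s < - a"
    have "(w has_vector_derivative (\<rho> (- s) * w (- s) + g (- s))) (at (- s))"
      using der[of "- s"] s by auto
    then have "((w \<circ> uminus) has_vector_derivative (- 1) *\<^sub>R (\<rho> (- s) * w (- s) + g (- s))) (at s)"
      by (intro vector_diff_chain_at) (auto intro!: derivative_eq_intros)
    then show "((\<lambda>s. w (- s)) has_vector_derivative (- \<rho> (- s) * w (- s) + - g (- s))) (at s)"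
      by (simp add: o_def)
    show "Re (- \<rho> (- s)) \<le> - c" using re[of "- s"] s by auto
    show "cmod (- g (- s)) \<le> G" using G[of "- s"] s by auto
  qed (use ab c G0 in auto)
  then show ?thesis by (simp add: algebra_simps)
qed

text \<open>Trades the exponential factor earned over a positive time for any desired power of the
  frequency, by \<open>(1 + z / m)^m \<le> exp z\<close>.\<close>

lemma exp_decay_le:
  assumes "0 < y" "0 < x"
  shows "exp (- (y * x)) \<le> (real (Suc m) / y) ^ Suc m / x ^ Suc m"
proof -
  have "(y * x / real (Suc m)) ^ Suc m \<le> (1 + y * x / real (Suc m)) ^ Suc m"
    using assms by (intro power_mono) auto
  also have "\<dots> \<le> exp (y * x)"
    using assms by (intro exp_ge_one_plus_x_over_n_power_n)
      (auto intro: order_trans[of _ 0])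
  finally have "(y * x / real (Suc m)) ^ Suc m \<le> exp (y * x)" .
  then have "1 / exp (y * x) \<le> 1 / (y * x / real (Suc m)) ^ Suc m"
    using assms by (intro divide_left_mono mult_pos_pos zero_less_power divide_pos_pos) auto
  also have "\<dots> = (real (Suc m) / y) ^ Suc m / x ^ Suc m"
    using assms by (simp only: power_divide power_mult_distrib divide_divide_eq_right divide_divide_eq_left mult_1)
  finally show ?thesis by (simp add: exp_minus inverse_eq_divide)
qed

lemma sum_inverse_squares_tail:
  assumes "m \<le> n"
  shows "(\<Sum>i=m..n. 1 / (1 + real i)\<^sup>2) \<le> 2 / (1 + real m) - 1 / (1 + real n)"
  using assms
proof (induction n rule: dec_induct)
  case base
  have "1 / (1 + real m)\<^sup>2 \<le> 1 / (1 + real m)"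
    by (intro divide_left_mono) (auto simp: power2_eq_square)
  then show ?case by simp
next
  case (step n)
  have "1 / (1 + real (Suc n))\<^sup>2 \<le> 1 / ((1 + real n) * (1 + real (Suc n)))"
    by (intro divide_left_mono) (auto simp: power2_eq_square)
  also have "\<dots> = 1 / (1 + real n) - 1 / (1 + real (Suc n))"
    by (simp add: divide_simps)
  finally show ?case using step by simp
qed

lemma sum_J_tail:
  assumes R: "0 \<le> R" and S: "finite S" "\<And>l. l \<in> S \<Longrightarrow> R \<le> \<bar>real_of_int l\<bar>"
  shows "(\<Sum>l\<in>S. 1 / (J l)\<^sup>2) \<le> 4 / (1 + R)"
proof -
  define m where "m = nat \<lceil>R\<rceil>"
  define n where "n = max m (Max (insert 0 ((\<lambda>l. nat \<bar>l\<bar>) ` S)))"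
  have mn: "m \<le> n" by (simp add: n_def)
  have Rm: "R \<le> real m" unfolding m_def using R by linarith
  have sub: "S \<subseteq> int ` {m..n} \<union> (\<lambda>i. - int i) ` {m..n}"
  proof
    fix l assume l: "l \<in> S"
    have "\<lceil>R\<rceil> \<le> \<bar>l\<bar>" using S(2)[OF l] by (metis ceiling_le_iff of_int_abs)
    then have 1: "m \<le> nat \<bar>l\<bar>" unfolding m_def by (rule nat_mono)
    have "nat \<bar>l\<bar> \<le> Max (insert 0 ((\<lambda>l. nat \<bar>l\<bar>) ` S))" using l S(1) by (intro Max_ge) auto
    then have 2: "nat \<bar>l\<bar> \<le> n" by (simp add: n_def)
    show "l \<in> int ` {m..n} \<union> (\<lambda>i. - int i) ` {m..n}"
    proof (cases "0 \<le> l")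
      case True then show ?thesis using 1 2 by (intro UnI1 image_eqI[of _ _ "nat \<bar>l\<bar>"]) auto
    next
      case False then show ?thesis using 1 2 by (intro UnI2 image_eqI[of _ _ "nat \<bar>l\<bar>"]) auto
    qed
  qed
  have "(\<Sum>l\<in>S. 1 / (J l)\<^sup>2) \<le> (\<Sum>l\<in>int ` {m..n} \<union> (\<lambda>i. - int i) ` {m..n}. 1 / (J l)\<^sup>2)"
    using sub by (intro sum_mono2) auto
  also have "\<dots> \<le> (\<Sum>l\<in>int ` {m..n}. 1 / (J l)\<^sup>2) + (\<Sum>l\<in>(\<lambda>i. - int i) ` {m..n}. 1 / (J l)\<^sup>2)"
    by (subst sum_Un) (auto intro: sum_nonneg)
  also have "(\<Sum>l\<in>int ` {m..n}. 1 / (J l)\<^sup>2) = (\<Sum>i=m..n. 1 / (1 + real i)\<^sup>2)"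
    by (subst sum.reindex) (auto simp: jap_def inj_on_def)
  also have "(\<Sum>l\<in>(\<lambda>i. - int i) ` {m..n}. 1 / (J l)\<^sup>2) = (\<Sum>i=m..n. 1 / (1 + real i)\<^sup>2)"
    by (subst sum.reindex) (auto simp: jap_def inj_on_def)
  also have "(\<Sum>i=m..n. 1 / (1 + real i)\<^sup>2) + (\<Sum>i=m..n. 1 / (1 + real i)\<^sup>2) \<le> 4 / (1 + real m)"
  proof -
    have "0 \<le> 1 / (1 + real n)" by simp
    then have "(\<Sum>i=m..n. 1 / (1 + real i)\<^sup>2) \<le> 2 / (1 + real m)"
      using sum_inverse_squares_tail[OF mn] by linarith
    then show ?thesis by simp
  qed
  also have "\<dots> \<le> 4 / (1 + R)" using R Rm by (intro divide_left_mono) auto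
  finally show ?thesis .
qed

text \<open>Of the \<open>n + 2\<close> powers, \<open>n\<close> are turned into
  \<open>(1 + R) ^ n\<close> directly; the remaining two make the sum converge, with a tail
  \<open>4 / (1 + R)\<close> that returns one power.\<close>

lemma decay_of_pointwise:
  assumes f0: "\<And>l. 0 \<le> f l" and f: "\<And>l. f l * J l ^ Suc (Suc n) \<le> D"
  shows "decay (Suc n) (4 * D) f"
  unfolding decay_def
proof (intro conjI allI impI; (elim conjE)?)
  have D0: "0 \<le> D" using f[of 0] f0[of 0] by (simp add: jap_def)
  show "f l * J l ^ Suc (Suc n) \<le> 4 * D" for l using f[of l] D0 by linarith
  fix R :: real and S :: "int set"
  assume R: "0 \<le> R" and S: "finite S" "\<forall>l\<in>S. R \<le> \<bar>real_of_int l\<bar>"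
  have "sum f S * (1 + R) ^ n = (\<Sum>l\<in>S. f l * (1 + R) ^ n)" by (simp add: sum_distrib_right)
  also have "\<dots> \<le> (\<Sum>l\<in>S. D * (1 / (J l)\<^sup>2))"
  proof (rule sum_mono)
    fix l assume "l \<in> S"
    then have "f l * (1 + R) ^ n \<le> f l * J l ^ n"
      using S R f0 by (intro mult_left_mono power_mono) (auto simp: jap_def)
    also have "\<dots> \<le> D / (J l)\<^sup>2"
      using f[of l] by (simp add: pos_le_divide_eq J_pos power2_eq_square mult_ac)
    finally show "f l * (1 + R) ^ n \<le> D * (1 / (J l)\<^sup>2)" by simp
  qed
  also have "\<dots> = D * (\<Sum>l\<in>S. 1 / (J l)\<^sup>2)" by (simp only: sum_distrib_left)
  also have "\<dots> \<le> D * (4 / (1 + R))"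
    using D0 R S by (intro mult_left_mono sum_J_tail) auto
  finally have "sum f S * (1 + R) ^ n * (1 + R) \<le> 4 * D"
    using R by (simp add: pos_le_divide_eq)
  then show "sum f S * (1 + R) ^ Suc n \<le> 4 * D" by (simp add: mult_ac)
qed

text \<open>Cauchy-Schwarz against the weight \<open>1 / J l\<close>, whose squares have tail
  \<open>4 / (1 + R)\<close>; the root of the 4 is the factor 2 that later appears in
  \<open>2 * (1 / \<epsilon>)\<close>.\<close>

lemma small_l1_of_H1:
  assumes f0: "\<And>l. 0 \<le> f l" and M: "0 \<le> M"
    and f: "\<And>S. finite S \<Longrightarrow> (\<Sum>l\<in>S. (J l * f l)\<^sup>2) \<le> M\<^sup>2"
  shows "small_l1 (2 * M) f"
  unfolding small_l1_def
proof (intro conjI allI impI; (elim conjE)?)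
  show "0 \<le> f l" for l by (rule f0)
  have "(J l * f l)\<^sup>2 \<le> M\<^sup>2" for l using f[of "{l}"] by simp
  then have "J l * f l \<le> M" for l using M by (rule power2_le_imp_le)
  then show "J l * f l \<le> 2 * M" for l using M by (smt (verit))
  fix R :: real and S :: "int set"
  assume R: "0 \<le> R" and S: "finite S" "\<forall>l\<in>S. R \<le> \<bar>real_of_int l\<bar>"
  have "sum f S = (\<Sum>l\<in>S. (1 / J l) * (J l * f l))" using J_pos by (simp add: less_imp_neq[symmetric])
  then have "(sum f S)\<^sup>2 \<le> (\<Sum>l\<in>S. (1 / J l)\<^sup>2) * (\<Sum>l\<in>S. (J l * f l)\<^sup>2)"
    by (simp only: Cauchy_Schwarz_ineq_sum)
  also have "\<dots> \<le> 4 / (1 + R) * M\<^sup>2"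
    using sum_J_tail[OF R S(1)] S f[OF S(1)] R
    by (intro mult_mono sum_nonneg) (auto simp: power_one_over)
  also have "\<dots> = (2 * M / sqrt (1 + R))\<^sup>2" using R by (simp add: power_divide power_mult_distrib)
  finally show "sum f S \<le> 2 * M / sqrt (1 + R)"
    by (rule power2_le_imp_le) (use M R in auto)
qed

section \<open>Normal form\<close>

lemma symbol_split:
  assumes fin: "finite F" and p0: "\<And>i. 0 \<le> p i"
    and s: "\<And>i. i \<in> F \<Longrightarrow> s i \<le> C * (1 / J k + of_bool (h i))"
  shows "(\<Sum>i\<in>F. s i * p i) \<le> C * ((1 / J k) * (\<Sum>i\<in>F. p i) + (\<Sum>i\<in>{i\<in>F. h i}. p i))"
proof -
  have "(\<Sum>i\<in>F. s i * p i) \<le> (\<Sum>i\<in>F. C * (1 / J k + of_bool (h i)) * p i)"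
    using s p0 by (intro sum_mono mult_right_mono) auto
  also have "\<dots> = C * ((1 / J k) * (\<Sum>i\<in>F. p i) + (\<Sum>i\<in>{i\<in>F. h i}. p i))"
  proof -
    have "(\<Sum>i\<in>{i\<in>F. h i}. p i) = (\<Sum>i\<in>F. of_bool (h i) * p i)"
      unfolding sum.inter_filter[OF fin] by (intro sum.cong) auto
    then show ?thesis
      by (simp add: sum_distrib_left sum.distrib sum_divide_distrib algebra_simps)
  qed
  finally show ?thesis .
qed

text \<open>Two powers of \<open>J k\<close> are gained over \<open>triad_weighted_sum\<close>. One
  comes from dropping the weight, which is at least \<open>J k\<close>, the other from the symbol.
  Where the symbol does not decay, \<open>triad_high_sum\<close> supplies the same total.\<close>

lemma symbol_weighted_sum:
  assumes tr: "triads k F x y z" and f: "small_l1 A f" and d: "\<And>l. f l * J l ^ Suc n \<le> D"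
    and s: "\<And>i. i \<in> F \<Longrightarrow> s i \<le> C * (1 / J k + of_bool (h i))" and C: "0 \<le> C"
    and h: "\<And>i. i \<in> F \<Longrightarrow> h i \<Longrightarrow> \<bar>k\<bar> \<le> 2 * \<bar>x i\<bar> \<and> \<bar>k\<bar> \<le> 2 * \<bar>y i\<bar> \<and> \<bar>k\<bar> \<le> 2 * \<bar>z i\<bar>"
  shows "(\<Sum>i\<in>F. s i * (f (x i) * f (y i) * f (z i))) \<le> C * (9 * 3 ^ n + 4 * 2 ^ n) * D * A\<^sup>2 / J k ^ Suc (Suc n)"
proof -
  note f0 = small_l1_nonneg[OF f]
  have fin: "finite F" using tr by (simp add: triads_def)
  define p where "p i = f (x i) * f (y i) * f (z i)" for i
  have p0: "0 \<le> p i" for i by (simp add: p_def f0)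
  define H where "H = {i\<in>F. h i}"
  have "(\<Sum>i\<in>F. s i * p i) \<le> C * ((1 / J k) * (\<Sum>i\<in>F. p i) + (\<Sum>i\<in>H. p i))"
    unfolding H_def by (rule symbol_split[OF fin p0 s])
  also have "\<dots> \<le> C * ((1 / J k) * (9 * 3 ^ n * D * A\<^sup>2 / J k ^ Suc n) + D * 2 ^ Suc n * 2 * A\<^sup>2 / J k ^ Suc (Suc n))"
  proof (intro mult_left_mono add_mono C)
    have "J k * (\<Sum>i\<in>F. p i) \<le> (\<Sum>i\<in>F. (J (x i) + J (y i) + J (z i)) * p i)"
      unfolding sum_distrib_left
    proof (intro sum_mono mult_right_mono p0)
      fix i assume "i \<in> F"
      then have "\<bar>k\<bar> \<le> \<bar>x i\<bar> + \<bar>y i\<bar> + \<bar>z i\<bar>" using tr by (auto simp: triads_def)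
      then have "real_of_int \<bar>k\<bar> \<le> real_of_int (\<bar>x i\<bar> + \<bar>y i\<bar> + \<bar>z i\<bar>)" by (simp only: of_int_le_iff)
      then show "J k \<le> J (x i) + J (y i) + J (z i)" by (simp add: jap_def)
    qed
    also have "\<dots> \<le> 9 * 3 ^ n * D * A\<^sup>2 / J k ^ n"
      unfolding p_def by (rule triad_weighted_sum[OF tr f d])
    finally show "(\<Sum>i\<in>F. p i) \<le> 9 * 3 ^ n * D * A\<^sup>2 / J k ^ Suc n"
      using J_pos[of k] by (simp add: field_simps)
    have "triads k H x y z" using tr by (rule triads_subset) (auto simp: H_def)
    then show "(\<Sum>i\<in>H. p i) \<le> D * 2 ^ Suc n * 2 * A\<^sup>2 / J k ^ Suc (Suc n)"
      unfolding p_def by (rule triad_high_sum[OF _ f]) (use h f0 d in \<open>auto simp: H_def\<close>)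
  qed (use J_pos[of k] in auto)
  also have "\<dots> = C * (9 * 3 ^ n + 4 * 2 ^ n) * D * A\<^sup>2 / J k ^ Suc (Suc n)"
    using J_pos[of k] by (simp add: field_simps)
  finally show ?thesis by (simp add: p_def)
qed

text \<open>One power is gained over \<open>triad_forced_sum\<close>: from the symbol where it
  decays, and from \<open>triad_high_sum\<close> elsewhere.\<close>

lemma symbol_forced_sum:
  assumes tr: "triads k F x y z" and f: "small_l1 A f" and d: "decay n D f"
    and b0: "\<And>l. 0 \<le> b l" and b: "\<And>l. b l * J l ^ n \<le> E" and bE: "\<And>l. b l \<le> E'"
    and s: "\<And>i. i \<in> F \<Longrightarrow> s i \<le> C * (1 / J k + of_bool (h i))" and C: "0 \<le> C"
    and h: "\<And>i. i \<in> F \<Longrightarrow> h i \<Longrightarrow> \<bar>k\<bar> \<le> 2 * \<bar>x i\<bar> \<and> \<bar>k\<bar> \<le> 2 * \<bar>y i\<bar> \<and> \<bar>k\<bar> \<le> 2 * \<bar>z i\<bar>"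
  shows "(\<Sum>i\<in>F. s i * (b (x i) * f (y i) * f (z i)))
     \<le> C * ((E * A\<^sup>2 + 2 * E' * D * A) * 3 ^ n + E * 2 ^ n * 2 * A\<^sup>2) / J k ^ Suc n"
proof -
  note f0 = small_l1_nonneg[OF f]
  have fin: "finite F" using tr by (simp add: triads_def)
  define p where "p i = b (x i) * f (y i) * f (z i)" for i
  have p0: "0 \<le> p i" for i by (simp add: p_def f0 b0)
  define H where "H = {i\<in>F. h i}"
  have "(\<Sum>i\<in>F. s i * p i) \<le> C * ((1 / J k) * (\<Sum>i\<in>F. p i) + (\<Sum>i\<in>H. p i))"
    unfolding H_def by (rule symbol_split[OF fin p0 s])
  also have "\<dots> \<le> C * ((1 / J k) * ((E * A\<^sup>2 + 2 * E' * D * A) * 3 ^ n / J k ^ n) + E * 2 ^ n * 2 * A\<^sup>2 / J k ^ Suc n)"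
  proof (intro mult_left_mono add_mono C)
    show "(\<Sum>i\<in>F. p i) \<le> (E * A\<^sup>2 + 2 * E' * D * A) * 3 ^ n / J k ^ n"
      unfolding p_def by (rule triad_forced_sum[OF tr f d b0 b bE])
    have "triads k H x y z" using tr by (rule triads_subset) (auto simp: H_def)
    then show "(\<Sum>i\<in>H. p i) \<le> E * 2 ^ n * 2 * A\<^sup>2 / J k ^ Suc n"
      unfolding p_def by (rule triad_high_sum[OF _ f _ b0 b]) (use h in \<open>auto simp: H_def\<close>)
  qed (use J_pos[of k] in auto)
  also have "\<dots> = C * ((E * A\<^sup>2 + 2 * E' * D * A) * 3 ^ n + E * 2 ^ n * 2 * A\<^sup>2) / J k ^ Suc n"
    using J_pos[of k] by (simp add: field_simps)
  finally show ?thesis by (simp add: p_def)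
qed

section \<open>The mode equation and its resonant part\<close>

context raman
begin

definition nonlin :: "int \<Rightarrow> (int \<Rightarrow> complex) \<Rightarrow> complex" where
  "nonlin k x = infsum (tri (\<mu> k) k x) UNIV"

definition K\<mu> :: real where "K\<mu> = \<bar>\<gamma>1\<bar> + \<bar>\<gamma>2\<bar> + \<Gamma>"

lemma K\<mu>_pos: "0 < K\<mu>"
  using \<Gamma>_pos by (simp add: K\<mu>_def add_nonneg_pos)

lemma \<mu>_le': "cmod (\<mu> k q) \<le> K\<mu> * (J k + \<bar>real_of_int q\<bar>)"
  unfolding K\<mu>_def by (rule \<mu>_le)

text \<open>Speaks of coefficient families rather than functions, so that it also covers the
  reflected coefficients of a backward solution. The constant \<open>A\<close> is uniform in time,
  and derivatives are taken in the open interval only.\<close>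

definition mode_system :: "real \<Rightarrow> real \<Rightarrow> (real \<Rightarrow> int \<Rightarrow> complex) \<Rightarrow> bool" where
  "mode_system T A a \<longleftrightarrow>
     (\<forall>k. continuous_on {0..T} (\<lambda>t. a t k)) \<and>
     (\<forall>t\<in>{0..T}. small_l1 A (\<lambda>l. cmod (a t l))) \<and>
     (\<forall>k. \<forall>t\<in>{0<..<T}. ((\<lambda>t. a t k) has_vector_derivative
        (- (\<i> * \<omega> k) * a t k + nonlin k (a t))) (at t))"

lemma mode_system_subset: "mode_system T A a \<Longrightarrow> T' \<le> T \<Longrightarrow> mode_system T' A a"
  unfolding mode_system_def by (auto intro: continuous_on_subset)

text \<open>The second sum omits \<open>p = k\<close>, so that the resonance \<open>p = q = k\<close> is counted once.\<close>

definition res :: "int \<Rightarrow> int \<Rightarrow> (int \<Rightarrow> complex) \<Rightarrow> complex" where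
  "res k L x = (\<Sum>q\<in>{-L..L}. \<mu> k (k - q) * (cmod (x q))\<^sup>2) + (\<Sum>p\<in>{-L..L}-{k}. \<mu> k 0 * (cmod (x p))\<^sup>2)"

text \<open>What \<open>nonres\<close> omits from the box are the lines \<open>p = k\<close> and
  \<open>q = k\<close>. On the first the conjugated frequency equals \<open>q\<close>, on the second
  it equals \<open>p\<close>, so each term becomes a squared modulus times
  \<open>x k\<close>.\<close>

lemma box_split:
  assumes "\<bar>k\<bar> \<le> L"
  shows "sum (tri (\<mu> k) k x) (box L) = sum (tri (\<mu> k) k x) (nonres k L) + res k L x * x k"
proof -
  let ?I = "{-L..L}"
  have split: "box L = nonres k L \<union> (Pair k ` ?I \<union> (\<lambda>p. (p, k)) ` (?I - {k}))"
    using assms by (auto simp: box_def nonres_def)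
  have "sum (tri (\<mu> k) k x) (box L) =
      sum (tri (\<mu> k) k x) (nonres k L) + sum (tri (\<mu> k) k x) (Pair k ` ?I \<union> (\<lambda>p. (p, k)) ` (?I - {k}))"
    unfolding split by (rule sum.union_disjoint) (auto simp: nonres_def)
  also have "sum (tri (\<mu> k) k x) (Pair k ` ?I \<union> (\<lambda>p. (p, k)) ` (?I - {k})) =
      sum (tri (\<mu> k) k x) (Pair k ` ?I) + sum (tri (\<mu> k) k x) ((\<lambda>p. (p, k)) ` (?I - {k}))"
    by (rule sum.union_disjoint) auto
  also have "sum (tri (\<mu> k) k x) (Pair k ` ?I) = (\<Sum>q\<in>?I. \<mu> k (k - q) * (cmod (x q))\<^sup>2) * x k"
    unfolding sum_distrib_right
    by (subst sum.reindex) (auto simp: inj_on_def tri_def complex_norm_square mult_ac simp del: of_real_power intro!: sum.cong)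
  also have "sum (tri (\<mu> k) k x) ((\<lambda>p. (p, k)) ` (?I - {k})) = (\<Sum>p\<in>?I-{k}. \<mu> k 0 * (cmod (x p))\<^sup>2) * x k"
    unfolding sum_distrib_right
    by (subst sum.reindex) (auto simp: inj_on_def tri_def complex_norm_square mult_ac simp del: of_real_power intro!: sum.cong)
  finally show ?thesis by (simp add: res_def distrib_right)
qed

lemma Re_\<mu>: "Re (\<mu> k q) = \<Gamma> * real_of_int q / (2 * pi)"
proof -
  have "\<mu> k q = (of_real (\<Gamma> * real_of_int q) + \<i> * of_real (\<gamma>1 + \<gamma>2 * real_of_int k)) / of_real (2 * pi)"
    unfolding \<mu>_def by (simp add: distrib_left)
  also have "Re \<dots> = \<Gamma> * real_of_int q / (2 * pi)"
    unfolding Re_divide_of_real by simp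
  finally show ?thesis .
qed

text \<open>The line \<open>q = k\<close> contributes nothing because \<open>\<mu> k 0\<close> is
  purely imaginary.\<close>

lemma Re_res: "Re (res k L x) = \<Gamma> / (2 * pi) * (\<Sum>q\<in>{-L..L}. real_of_int (k - q) * (cmod (x q))\<^sup>2)"
proof -
  have t: "Re (\<mu> k j * complex_of_real ((cmod y)\<^sup>2)) = \<Gamma> / (2 * pi) * (real_of_int j * (cmod y)\<^sup>2)" for j y
    by (simp add: Re_\<mu> del: of_real_power)
  show ?thesis unfolding res_def plus_complex.sel Re_sum t sum_distrib_left[symmetric] by (simp add: Re_\<mu>)
qed

context
  fixes x :: "int \<Rightarrow> complex" and A :: real
  assumes x: "small_l1 A (\<lambda>l. cmod (x l))"
begin

lemma weighted_square_sum:
  assumes "finite S"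
  shows "(\<Sum>q\<in>S. J q * (cmod (x q))\<^sup>2) \<le> A\<^sup>2"
proof -
  have "(\<Sum>q\<in>S. J q * (cmod (x q))\<^sup>2) \<le> (\<Sum>q\<in>S. A * cmod (x q))"
    using small_l1_J[OF x] by (intro sum_mono) (auto simp: power2_eq_square mult.assoc[symmetric] intro!: mult_right_mono)
  also have "\<dots> \<le> A * A"
    unfolding sum_distrib_left[symmetric] using small_l1_sum[OF x assms] small_l1_A[OF x] by (intro mult_left_mono)
  finally show ?thesis by (simp add: power2_eq_square)
qed

text \<open>The sum is \<open>k\<close> times the mass in the box minus the momentum. The zero mode
  bounds the mass below by \<open>e^2\<close>, and the \<open>small_l1\<close> bound keeps the
  momentum within \<open>A^2\<close>, so the sign of \<open>k\<close> decides for large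
  \<open>|k|\<close>.\<close>

lemma square_sum_shift:
  assumes e: "0 \<le> e" "e \<le> cmod (x 0)" and L: "\<bar>k\<bar> \<le> L"
  shows "0 \<le> k \<Longrightarrow> k * e\<^sup>2 - A\<^sup>2 \<le> (\<Sum>q\<in>{-L..L}. real_of_int (k - q) * (cmod (x q))\<^sup>2)"
    and "k \<le> 0 \<Longrightarrow> (\<Sum>q\<in>{-L..L}. real_of_int (k - q) * (cmod (x q))\<^sup>2) \<le> k * e\<^sup>2 + A\<^sup>2"
proof -
  define m where "m = (\<Sum>q\<in>{-L..L}. (cmod (x q))\<^sup>2)"
  define d where "d = (\<Sum>q\<in>{-L..L}. real_of_int q * (cmod (x q))\<^sup>2)"
  have split: "(\<Sum>q\<in>{-L..L}. real_of_int (k - q) * (cmod (x q))\<^sup>2) = k * m - d"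
    by (simp add: m_def d_def sum_distrib_left sum_subtractf algebra_simps)
  have "\<bar>d\<bar> \<le> (\<Sum>q\<in>{-L..L}. \<bar>real_of_int q * (cmod (x q))\<^sup>2\<bar>)" unfolding d_def by (rule sum_abs)
  also have "\<dots> \<le> (\<Sum>q\<in>{-L..L}. J q * (cmod (x q))\<^sup>2)"
    by (intro sum_mono) (auto simp: abs_mult jap_def intro!: mult_right_mono)
  also have "\<dots> \<le> A\<^sup>2" by (rule weighted_square_sum) simp
  finally have d: "\<bar>d\<bar> \<le> A\<^sup>2" .
  have "e\<^sup>2 \<le> (cmod (x 0))\<^sup>2" using e by (intro power_mono) auto
  also have "\<dots> \<le> m" unfolding m_def using L by (intro member_le_sum) auto
  finally have m: "e\<^sup>2 \<le> m" .
  show "k * e\<^sup>2 - A\<^sup>2 \<le> (\<Sum>q\<in>{-L..L}. real_of_int (k - q) * (cmod (x q))\<^sup>2)" if "0 \<le> k"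
  proof -
    have "k * e\<^sup>2 \<le> k * m" using that m by (intro mult_left_mono) auto
    then show ?thesis unfolding split using d by linarith
  qed
  show "(\<Sum>q\<in>{-L..L}. real_of_int (k - q) * (cmod (x q))\<^sup>2) \<le> k * e\<^sup>2 + A\<^sup>2" if "k \<le> 0"
  proof -
    have "k * m \<le> k * e\<^sup>2" using that m by (intro mult_left_mono_neg) auto
    then show ?thesis unfolding split using d by linarith
  qed
qed

lemma res_le: "cmod (res k L x) \<le> 4 * K\<mu> * A\<^sup>2 * J k"
proof -
  have 1: "cmod (\<Sum>q\<in>{-L..L}. \<mu> k (k - q) * (cmod (x q))\<^sup>2) \<le> 3 * K\<mu> * J k * A\<^sup>2"
  proof -
    have "cmod (\<Sum>q\<in>{-L..L}. \<mu> k (k - q) * (cmod (x q))\<^sup>2) \<le> (\<Sum>q\<in>{-L..L}. 3 * K\<mu> * J k * (J q * (cmod (x q))\<^sup>2))"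
    proof (rule sum_norm_le)
      fix q
      have "J k + \<bar>real_of_int (k - q)\<bar> \<le> 2 * J k + J q" by (simp add: jap_def)
      also have "\<dots> \<le> 2 * (J k * J q) + J k * J q"
        using J_ge_1[of k] J_ge_1[of q] J_pos[of k] J_pos[of q]
        by (intro add_mono mult_left_mono) (auto simp: mult_le_cancel_left1 mult_le_cancel_right1)
      finally have "cmod (\<mu> k (k - q)) \<le> K\<mu> * (3 * (J k * J q))"
        using \<mu>_le'[of k "k - q"] K\<mu>_pos by (smt (verit, best) mult_left_mono)
      then have "cmod (\<mu> k (k - q)) * (cmod (x q))\<^sup>2 \<le> K\<mu> * (3 * (J k * J q)) * (cmod (x q))\<^sup>2"
        by (intro mult_right_mono) auto
      then show "cmod (\<mu> k (k - q) * (cmod (x q))\<^sup>2) \<le> 3 * K\<mu> * J k * (J q * (cmod (x q))\<^sup>2)"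
        by (simp add: norm_mult norm_power mult_ac)
    qed
    also have "\<dots> \<le> 3 * K\<mu> * J k * A\<^sup>2"
      unfolding sum_distrib_left[symmetric] using K\<mu>_pos J_pos[of k]
      by (intro mult_left_mono weighted_square_sum) auto
    finally show ?thesis .
  qed
  have 2: "cmod (\<Sum>p\<in>{-L..L}-{k}. \<mu> k 0 * (cmod (x p))\<^sup>2) \<le> K\<mu> * J k * A\<^sup>2"
  proof -
    have "cmod (\<Sum>p\<in>{-L..L}-{k}. \<mu> k 0 * (cmod (x p))\<^sup>2) \<le> (\<Sum>p\<in>{-L..L}-{k}. K\<mu> * J k * (J p * (cmod (x p))\<^sup>2))"
    proof (rule sum_norm_le)
      fix p
      have "cmod (\<mu> k 0) * (cmod (x p))\<^sup>2 \<le> (K\<mu> * J k) * (J p * (cmod (x p))\<^sup>2)"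
        using \<mu>_le'[of k 0] K\<mu>_pos J_pos[of k] J_ge_1[of p] by (intro mult_mono) (auto simp: mult_le_cancel_right1)
      then show "cmod (\<mu> k 0 * (cmod (x p))\<^sup>2) \<le> K\<mu> * J k * (J p * (cmod (x p))\<^sup>2)"
        by (simp add: norm_mult norm_power)
    qed
    also have "\<dots> \<le> K\<mu> * J k * A\<^sup>2"
      unfolding sum_distrib_left[symmetric] using K\<mu>_pos J_pos[of k]
      by (intro mult_left_mono weighted_square_sum) auto
    finally show ?thesis .
  qed
  have "cmod (res k L x) \<le> 3 * K\<mu> * J k * A\<^sup>2 + K\<mu> * J k * A\<^sup>2"
    unfolding res_def using 1 2 by (rule norm_triangle_mono)
  then show ?thesis by (simp add: algebra_simps)
qed

text \<open>The loss from exponent \<open>n + 1\<close> to \<open>n\<close> is the derivative in the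
  nonlinearity.\<close>

lemma nonlin_le:
  assumes "\<And>l. cmod (x l) * J l ^ Suc n \<le> D"
  shows "cmod (nonlin k x) * J k ^ n \<le> 18 * K\<mu> * 3 ^ n * D * A\<^sup>2"
  using tri_infsum_le[OF \<mu>_le' x assms, of k] J_pos[of k]
  unfolding nonlin_def by (simp add: field_simps)

lemma nonlin_le_0: "cmod (nonlin k x) \<le> 18 * K\<mu> * A ^ 3"
  using nonlin_le[of 0 A k] small_l1_J[OF x] by (simp add: mult.commute power2_eq_square power3_eq_cube)

end

section \<open>The correction term and its derivative along the flow\<close>

definition corr :: "int \<Rightarrow> int \<Rightarrow> (int \<Rightarrow> complex) \<Rightarrow> complex" where
  "corr k L x = (\<Sum>(p, q)\<in>nonres k L. symb k (p, q) * (x p * cnj (x (p + q - k)) * x q))"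

text \<open>The differential of \<open>corr k L\<close> at \<open>x\<close> in the direction
  \<open>y\<close>, linear over the reals only because of the conjugated factor.\<close>

definition corr' :: "int \<Rightarrow> int \<Rightarrow> (int \<Rightarrow> complex) \<Rightarrow> (int \<Rightarrow> complex) \<Rightarrow> complex" where
  "corr' k L x y = (\<Sum>(p, q)\<in>nonres k L. symb k (p, q) *
     (y p * cnj (x (p + q - k)) * x q + x p * cnj (y (p + q - k)) * x q + x p * cnj (x (p + q - k)) * y q))"

text \<open>The correction term is designed such that its linear evolution reproduces the nonresonant
  part of the nonlinearity.\<close>

lemma corr_derivative:
  assumes "\<And>k. ((\<lambda>t. a t k) has_vector_derivative (- (\<i> * \<omega> k) * a t k + y k)) (at t)"
  shows "((\<lambda>t. corr k L (a t)) has_vector_derivative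
     (- (\<i> * \<omega> k) * corr k L (a t) + sum (tri (\<mu> k) k (a t)) (nonres k L) + corr' k L (a t) y)) (at t)"
proof -
  have cn: "((\<lambda>t. cnj (a t l)) has_vector_derivative cnj (- (\<i> * \<omega> l) * a t l + y l)) (at t)" for l
    using assms[of l] by (rule has_vector_derivative_cnj)
  have "((\<lambda>t. corr k L (a t)) has_vector_derivative
     (\<Sum>(p, q)\<in>nonres k L. symb k (p, q) *
       ((a t p * cnj (a t (p + q - k))) * (- (\<i> * \<omega> q) * a t q + y q) +
        (a t p * cnj (- (\<i> * \<omega> (p + q - k)) * a t (p + q - k) + y (p + q - k)) +
          (- (\<i> * \<omega> p) * a t p + y p) * cnj (a t (p + q - k))) * a t q))) (at t)"
    unfolding corr_def case_prod_beta
    by (intro has_vector_derivative_sum has_vector_derivative_mult_right has_vector_derivative_mult assms cn)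
  also have "(\<Sum>(p, q)\<in>nonres k L. symb k (p, q) *
       ((a t p * cnj (a t (p + q - k))) * (- (\<i> * \<omega> q) * a t q + y q) +
        (a t p * cnj (- (\<i> * \<omega> (p + q - k)) * a t (p + q - k) + y (p + q - k)) +
          (- (\<i> * \<omega> p) * a t p + y p) * cnj (a t (p + q - k))) * a t q)) =
     - (\<i> * \<omega> k) * corr k L (a t) + sum (tri (\<mu> k) k (a t)) (nonres k L) + corr' k L (a t) y"
    unfolding corr_def corr'_def sum_distrib_left sum.distrib[symmetric]
  proof (rule sum.cong[OF refl], clarify)
    fix p q assume i: "(p, q) \<in> nonres k L"
    define r where "r = p + q - k"
    \<comment> \<open>The multiplier is the symbol times \<open>i \<Phi>\<close>: three of the four
      phases come from the linear parts of the factors, the fourth from splitting off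
      \<open>- i \<omega> k\<close> times the correction.\<close>
    have s: "\<mu> k (k - q) = symb k (p, q) * (\<i> * (\<omega> k - \<omega> p + \<omega> r - \<omega> q))"
    proof -
      have "\<mu> k (k - q) = symb k (p, q) * (\<i> * \<Phi> k (p, q))"
        using \<Phi>_nz[OF i] by (simp add: symb_def)
      then show ?thesis by (simp add: \<Phi>_def r_def)
    qed
    show "symb k (p, q) *
       ((a t p * cnj (a t (p + q - k))) * (- (\<i> * \<omega> q) * a t q + y q) +
        (a t p * cnj (- (\<i> * \<omega> (p + q - k)) * a t (p + q - k) + y (p + q - k)) +
          (- (\<i> * \<omega> p) * a t p + y p) * cnj (a t (p + q - k))) * a t q) =
      - (\<i> * \<omega> k) * (symb k (p, q) * (a t p * cnj (a t (p + q - k)) * a t q)) + tri (\<mu> k) k (a t) (p, q) +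
      symb k (p, q) * (y p * cnj (a t (p + q - k)) * a t q + a t p * cnj (y (p + q - k)) * a t q +
        a t p * cnj (a t (p + q - k)) * y q)"
      unfolding tri_def prod.case s r_def[symmetric] by (simp add: algebra_simps)
  qed
  finally show ?thesis .
qed

end

section \<open>Smoothing\<close>

context raman
begin

definition Csymb :: real where
  "Csymb = (SOME C. 0 < C \<and> (\<forall>k L. \<forall>i\<in>nonres k L. cmod (symb k i) \<le> C * (1 / J k + of_bool (all_high k i))))"

lemma Csymb_pos: "0 < Csymb"
  and symb_le: "i \<in> nonres k L \<Longrightarrow> cmod (symb k i) \<le> Csymb * (1 / J k + of_bool (all_high k i))"
proof -
  have "0 < Csymb \<and> (\<forall>k L. \<forall>i\<in>nonres k L. cmod (symb k i) \<le> Csymb * (1 / J k + of_bool (all_high k i)))"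
    unfolding Csymb_def by (rule someI_ex) (use symbol_bound in blast)
  then show "0 < Csymb" "i \<in> nonres k L \<Longrightarrow> cmod (symb k i) \<le> Csymb * (1 / J k + of_bool (all_high k i))"
    by blast+
qed

lemma triads_nonres: "triads k (nonres k L) fst (\<lambda>i. fst i + snd i - k) snd"
  by (rule triads_convolution) simp

lemma all_highD: "all_high k i \<Longrightarrow> \<bar>k\<bar> \<le> 2 * \<bar>fst i\<bar> \<and> \<bar>k\<bar> \<le> 2 * \<bar>fst i + snd i - k\<bar> \<and> \<bar>k\<bar> \<le> 2 * \<bar>snd i\<bar>"
  by (auto simp: all_high_def case_prod_beta)

lemma corr_le:
  assumes x: "small_l1 A (\<lambda>l. cmod (x l))" and d: "\<And>l. cmod (x l) * J l ^ Suc n \<le> D"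
  shows "cmod (corr k L x) \<le> Csymb * (9 * 3 ^ n + 4 * 2 ^ n) * D * A\<^sup>2 / J k ^ Suc (Suc n)"
proof -
  have "cmod (corr k L x) \<le> (\<Sum>i\<in>nonres k L. cmod (symb k i) *
      (cmod (x (fst i)) * cmod (x (fst i + snd i - k)) * cmod (x (snd i))))"
    unfolding corr_def by (rule sum_norm_le) (auto simp: norm_mult)
  also have "\<dots> \<le> Csymb * (9 * 3 ^ n + 4 * 2 ^ n) * D * A\<^sup>2 / J k ^ Suc (Suc n)"
    by (rule symbol_weighted_sum[OF triads_nonres x d, where h = "all_high k"])
       (use symb_le Csymb_pos all_highD in auto)
  finally show ?thesis .
qed

text \<open>Intended for \<open>y\<close> the nonlinearity, which decays one power less than
  \<open>x\<close>. Permuting the triad brings each of the three positions of \<open>y\<close> to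
  the front.\<close>

lemma corr'_le:
  assumes x: "small_l1 A (\<lambda>l. cmod (x l))" and d: "decay n D (\<lambda>l. cmod (x l))"
    and y: "\<And>l. cmod (y l) * J l ^ n \<le> E" and y': "\<And>l. cmod (y l) \<le> E'"
  shows "cmod (corr' k L x y) \<le>
    3 * (Csymb * ((E * A\<^sup>2 + 2 * E' * D * A) * 3 ^ n + E * 2 ^ n * 2 * A\<^sup>2) / J k ^ Suc n)"
proof -
  let ?F = "nonres k L" and ?r = "\<lambda>i. fst i + snd i - k"
  note B = symbol_forced_sum[where b = "\<lambda>l. cmod (y l)" and h = "all_high k" and s = "\<lambda>i. cmod (symb k i)"
      and C = Csymb and F = ?F and k = k, OF _ x d norm_ge_zero y y' symb_le]
  have b1: "(\<Sum>i\<in>?F. cmod (symb k i) * (cmod (y (fst i)) * cmod (x (?r i)) * cmod (x (snd i))))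
      \<le> Csymb * ((E * A\<^sup>2 + 2 * E' * D * A) * 3 ^ n + E * 2 ^ n * 2 * A\<^sup>2) / J k ^ Suc n"
    by (rule B[OF triads_nonres]) (use Csymb_pos all_highD in auto)
  have b2: "(\<Sum>i\<in>?F. cmod (symb k i) * (cmod (y (?r i)) * cmod (x (fst i)) * cmod (x (snd i))))
      \<le> Csymb * ((E * A\<^sup>2 + 2 * E' * D * A) * 3 ^ n + E * 2 ^ n * 2 * A\<^sup>2) / J k ^ Suc n"
    by (rule B[OF triads_swap12[OF triads_nonres]]) (use Csymb_pos all_highD in auto)
  have b3: "(\<Sum>i\<in>?F. cmod (symb k i) * (cmod (y (snd i)) * cmod (x (fst i)) * cmod (x (?r i))))
      \<le> Csymb * ((E * A\<^sup>2 + 2 * E' * D * A) * 3 ^ n + E * 2 ^ n * 2 * A\<^sup>2) / J k ^ Suc n"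
    by (rule B[OF triads_swap12[OF triads_swap23[OF triads_nonres]]]) (use Csymb_pos all_highD in auto)
  have "cmod (corr' k L x y) \<le> (\<Sum>i\<in>?F. cmod (symb k i) * (cmod (y (fst i)) * cmod (x (?r i)) * cmod (x (snd i))) +
      cmod (symb k i) * (cmod (y (?r i)) * cmod (x (fst i)) * cmod (x (snd i))) +
      cmod (symb k i) * (cmod (y (snd i)) * cmod (x (fst i)) * cmod (x (?r i))))"
    unfolding corr'_def
  proof (rule sum_norm_le)
    fix i assume "i \<in> ?F"
    obtain p q where i: "i = (p, q)" by force
    have "cmod (y p * cnj (x (p + q - k)) * x q + x p * cnj (y (p + q - k)) * x q + x p * cnj (x (p + q - k)) * y q)
       \<le> cmod (y p * cnj (x (p + q - k)) * x q) + cmod (x p * cnj (y (p + q - k)) * x q) + cmod (x p * cnj (x (p + q - k)) * y q)"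
      by (intro norm_triangle_mono order_refl)
    also have "\<dots> = cmod (y p) * cmod (x (p + q - k)) * cmod (x q) + cmod (y (p + q - k)) * cmod (x p) * cmod (x q)
        + cmod (y q) * cmod (x p) * cmod (x (p + q - k))"
      by (simp add: norm_mult mult_ac)
    finally have "cmod (symb k i) * cmod (y p * cnj (x (p + q - k)) * x q + x p * cnj (y (p + q - k)) * x q + x p * cnj (x (p + q - k)) * y q)
       \<le> cmod (symb k i) * (cmod (y p) * cmod (x (p + q - k)) * cmod (x q) + cmod (y (p + q - k)) * cmod (x p) * cmod (x q)
        + cmod (y q) * cmod (x p) * cmod (x (p + q - k)))"
      by (rule mult_left_mono) simp
    then show "cmod (case i of (p, q) \<Rightarrow> symb k (p, q) *
      (y p * cnj (x (p + q - k)) * x q + x p * cnj (y (p + q - k)) * x q + x p * cnj (x (p + q - k)) * y q))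
      \<le> cmod (symb k i) * (cmod (y (fst i)) * cmod (x (?r i)) * cmod (x (snd i))) +
      cmod (symb k i) * (cmod (y (?r i)) * cmod (x (fst i)) * cmod (x (snd i))) +
      cmod (symb k i) * (cmod (y (snd i)) * cmod (x (fst i)) * cmod (x (?r i)))"
      unfolding i prod.case fst_conv snd_conv norm_mult[of "symb k (p, q)"]
      by (simp only: distrib_left[of "cmod (symb k (p, q))"])
  qed
  also have "\<dots> \<le> 3 * (Csymb * ((E * A\<^sup>2 + 2 * E' * D * A) * 3 ^ n + E * 2 ^ n * 2 * A\<^sup>2) / J k ^ Suc n)"
    unfolding sum.distrib using add_mono[OF add_mono[OF b1 b2] b3] by simp
  finally show ?thesis .
qed

lemma continuous_on_corr:
  assumes "\<And>l. continuous_on I (\<lambda>t. a t l)"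
  shows "continuous_on I (\<lambda>t. corr k L (a t))"
  unfolding corr_def case_prod_beta by (intro continuous_intros assms)

text \<open>Below, \<open>w\<close> is \<open>a - corr\<close> at the frequency \<open>k\<close>: its growth rate \<open>\<rho>\<close> is of size \<open>\<bar>k\<bar>\<close> with the sign
  of \<open>k\<close>, and the forcing \<open>g\<close> is one power of \<open>k\<close> smaller than that of the original equation.\<close>

definition corrected_equation :: "nat \<Rightarrow> real \<Rightarrow> real \<Rightarrow> real \<Rightarrow> (real \<Rightarrow> int \<Rightarrow> complex) \<Rightarrow> int \<Rightarrow> bool" where
  "corrected_equation n c G T a k \<longleftrightarrow>
     (\<exists>w \<rho> g. continuous_on {0..T} w \<and> (\<forall>t\<in>{0..T}. cmod (a t k - w t) \<le> G / J k ^ Suc (Suc n)) \<and>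
        (\<forall>t\<in>{0<..<T}. (w has_vector_derivative (\<rho> t * w t + g t)) (at t) \<and>
           cmod (g t) \<le> G / J k ^ Suc n \<and>
           (0 \<le> k \<longrightarrow> c * J k \<le> Re (\<rho> t)) \<and> (k \<le> 0 \<longrightarrow> Re (\<rho> t) \<le> - (c * J k))))"

text \<open>The forcing consists of three pieces of order \<open>J k ^ -(n + 1)\<close>: the
  resonant rate of order \<open>J k\<close> times a correction of order
  \<open>J k ^ -(n + 2)\<close>, the truncation error, and the correction differentiated along the
  nonlinearity. The constants are chosen before \<open>a\<close>, \<open>T\<close> and
  \<open>k\<close>.\<close>

lemma corrected_mode:
  fixes A D e :: real and n :: nat
  assumes A0: "0 \<le> A" and D0: "0 \<le> D" and e: "0 < e"
  shows "\<exists>c>0. \<exists>K0 G. 0 \<le> G \<and> (\<forall>a T k. mode_system T A a \<longrightarrow> (\<forall>t\<in>{0..T}. e \<le> cmod (a t 0)) \<longrightarrow>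
     (\<forall>t\<in>{0..T}. decay n D (\<lambda>l. cmod (a t l))) \<longrightarrow> K0 \<le> \<bar>real_of_int k\<bar> \<longrightarrow>
     corrected_equation n c G T a k)"
proof -
  define Cb where "Cb = Csymb * (9 * 3 ^ n + 4 * 2 ^ n) * D * A\<^sup>2"
  define E where "E = 18 * K\<mu> * 3 ^ n * D * A\<^sup>2"
  define E' where "E' = 18 * K\<mu> * A ^ 3"
  define Cq where "Cq = 3 * (Csymb * ((E * A\<^sup>2 + 2 * E' * D * A) * 3 ^ n + E * 2 ^ n * 2 * A\<^sup>2))"
  define G where "G = 4 * K\<mu> * A\<^sup>2 * Cb + Cq + 1 + Cb"
  define c where "c = \<Gamma> / (2 * pi) * (e\<^sup>2 / 4)"
  \<comment> \<open>Ensures that \<open>A^2\<close> is at most \<open>(|k| - 1) / 2\<close> times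
    \<open>e^2\<close>, whence \<open>|k| e^2 - A^2\<close> is at least
    \<open>e^2 / 2 * J k\<close>; the rate \<open>c\<close> uses half of this.\<close>
  define K0 where "K0 = 1 + 2 * A\<^sup>2 / e\<^sup>2"
  have K\<mu>0: "0 \<le> K\<mu>" and Cs0: "0 \<le> Csymb" using K\<mu>_pos Csymb_pos by auto
  have Cb0: "0 \<le> Cb" unfolding Cb_def using Cs0 D0 by simp
  have E0: "0 \<le> E" "0 \<le> E'" unfolding E_def E'_def using K\<mu>0 D0 A0 by auto
  have Cq0: "0 \<le> Cq" unfolding Cq_def using Cs0 D0 A0 E0 by simp
  have G0: "0 \<le> G" unfolding G_def using K\<mu>0 Cb0 Cq0 by simp
  have c0: "0 < c" unfolding c_def using \<Gamma>_pos e by simp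
  show ?thesis
  proof (rule exI[of _ c], rule conjI[OF c0], rule exI[of _ K0], rule exI[of _ G], rule conjI[OF G0], intro allI impI)
    fix a T k
    assume sys: "mode_system T A a" and low: "\<forall>t\<in>{0..T}. e \<le> cmod (a t 0)"
      and dec: "\<forall>t\<in>{0..T}. decay n D (\<lambda>l. cmod (a t l))" and k: "K0 \<le> \<bar>real_of_int k\<bar>"
    have cont: "continuous_on {0..T} (\<lambda>t. a t l)" for l using sys by (auto simp: mode_system_def)
    have small: "small_l1 A (\<lambda>l. cmod (a t l))" if "t \<in> {0..T}" for t
      using sys that by (auto simp: mode_system_def)
    have pw: "cmod (a t l) * J l ^ Suc n \<le> D" if "t \<in> {0..T}" for t l
      using decay_le dec that by blast
    \<comment> \<open>The box may depend on \<open>a\<close> and \<open>k\<close>: the bounds on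
      \<open>res\<close>, \<open>corr\<close> and \<open>corr'\<close> do not involve
      \<open>L\<close>, and the truncation error is as small as the forcing bound requires.\<close>
    obtain L where L: "\<bar>k\<bar> \<le> L" "\<And>t. t \<in> {0..T} \<Longrightarrow>
        cmod (infsum (tri (\<mu> k) k (a t)) UNIV - sum (tri (\<mu> k) k (a t)) (box L)) \<le> 1 / J k ^ Suc n"
      using tri_truncation_uniform[where e = "1 / J k ^ Suc n" and k = k and I = "{0..T}" and a = a, OF \<mu>_le' small] J_pos[of k] by auto
    define w where "w t = a t k - corr k L (a t)" for t
    define \<rho> where "\<rho> t = - (\<i> * \<omega> k) + res k L (a t)" for t
    define g where "g t = res k L (a t) * corr k L (a t) +
        (nonlin k (a t) - sum (tri (\<mu> k) k (a t)) (box L)) - corr' k L (a t) (\<lambda>l. nonlin l (a t))" for t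
    have cor: "cmod (corr k L (a t)) \<le> Cb / J k ^ Suc (Suc n)" if "t \<in> {0..T}" for t
      unfolding Cb_def using corr_le[OF small[OF that] pw[OF that]] .
    show "corrected_equation n c G T a k"
      unfolding corrected_equation_def
    proof (rule exI[of _ w], rule exI[of _ \<rho>], rule exI[of _ g], intro conjI ballI)
      show "continuous_on {0..T} w" unfolding w_def by (intro continuous_intros cont continuous_on_corr)
      show "cmod (a t k - w t) \<le> G / J k ^ Suc (Suc n)" if "t \<in> {0..T}" for t
      proof -
        have "cmod (a t k - w t) \<le> Cb / J k ^ Suc (Suc n)" using cor[OF that] by (simp add: w_def)
        also have "\<dots> \<le> G / J k ^ Suc (Suc n)"
          unfolding G_def using K\<mu>0 Cb0 Cq0 J_pos[of k] by (intro divide_right_mono) auto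
        finally show ?thesis .
      qed
      fix t assume t: "t \<in> {0<..<T}"
      then have t': "t \<in> {0..T}" by auto
      have der: "((\<lambda>t. a t l) has_vector_derivative (- (\<i> * \<omega> l) * a t l + nonlin l (a t))) (at t)" for l
        using sys t by (auto simp: mode_system_def)
      have "(w has_vector_derivative ((- (\<i> * \<omega> k) * a t k + nonlin k (a t)) -
         (- (\<i> * \<omega> k) * corr k L (a t) + sum (tri (\<mu> k) k (a t)) (nonres k L) + corr' k L (a t) (\<lambda>l. nonlin l (a t))))) (at t)"
        unfolding w_def by (intro has_vector_derivative_diff der corr_derivative)
      also have "(- (\<i> * \<omega> k) * a t k + nonlin k (a t)) -
         (- (\<i> * \<omega> k) * corr k L (a t) + sum (tri (\<mu> k) k (a t)) (nonres k L) + corr' k L (a t) (\<lambda>l. nonlin l (a t)))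
         = \<rho> t * w t + g t"
        unfolding \<rho>_def w_def g_def box_split[OF L(1)] by (simp add: algebra_simps)
      finally show "(w has_vector_derivative (\<rho> t * w t + g t)) (at t)" .
      show "cmod (g t) \<le> G / J k ^ Suc n"
      proof -
        have "cmod (res k L (a t) * corr k L (a t)) \<le> (4 * K\<mu> * A\<^sup>2 * J k) * (Cb / J k ^ Suc (Suc n))"
          unfolding norm_mult using res_le[OF small[OF t']] cor[OF t'] K\<mu>0 J_pos[of k]
          by (intro mult_mono) auto
        also have "\<dots> = 4 * K\<mu> * A\<^sup>2 * Cb / J k ^ Suc n" using J_pos[of k] by simp
        finally have 1: "cmod (res k L (a t) * corr k L (a t)) \<le> 4 * K\<mu> * A\<^sup>2 * Cb / J k ^ Suc n" .
        have 2: "cmod (nonlin k (a t) - sum (tri (\<mu> k) k (a t)) (box L)) \<le> 1 / J k ^ Suc n"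
          using L(2)[OF t'] by (simp add: nonlin_def)
        have 3: "cmod (corr' k L (a t) (\<lambda>l. nonlin l (a t))) \<le> Cq / J k ^ Suc n"
          unfolding Cq_def E_def E'_def
          using corr'_le[where y = "\<lambda>l. nonlin l (a t)", OF small[OF t'] bspec[OF dec t']
              nonlin_le[OF small[OF t'] pw[OF t']] nonlin_le_0[OF small[OF t']], of k L]
          by (simp only: times_divide_eq_right)
        have "cmod (g t) \<le> cmod (res k L (a t) * corr k L (a t)) +
            cmod (nonlin k (a t) - sum (tri (\<mu> k) k (a t)) (box L)) + cmod (corr' k L (a t) (\<lambda>l. nonlin l (a t)))"
          unfolding g_def by (rule order_trans[OF norm_triangle_ineq4 add_right_mono[OF norm_triangle_ineq]])
        also have "\<dots> \<le> 4 * K\<mu> * A\<^sup>2 * Cb / J k ^ Suc n + 1 / J k ^ Suc n + Cq / J k ^ Suc n"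
          by (intro add_mono 1 2 3)
        also have "\<dots> = (4 * K\<mu> * A\<^sup>2 * Cb + 1 + Cq) / J k ^ Suc n" by (simp add: add_divide_distrib)
        also have "\<dots> \<le> G / J k ^ Suc n"
          unfolding G_def using Cb0 J_pos[of k] by (intro divide_right_mono) auto
        finally show ?thesis .
      qed
      have e2: "0 < e\<^sup>2" using e by simp
      have big: "e\<^sup>2 / 4 * J k \<le> \<bar>real_of_int k\<bar> * e\<^sup>2 - A\<^sup>2"
      proof -
        have "A\<^sup>2 = (A\<^sup>2 / e\<^sup>2) * e\<^sup>2" using e2 by simp
        also have "\<dots> \<le> ((\<bar>real_of_int k\<bar> - 1) / 2) * e\<^sup>2"
        proof (rule mult_right_mono)
          show "A\<^sup>2 / e\<^sup>2 \<le> (\<bar>real_of_int k\<bar> - 1) / 2" using k unfolding K0_def by (simp add: field_simps)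
        qed (use e2 in simp)
        finally have "A\<^sup>2 \<le> ((\<bar>real_of_int k\<bar> - 1) / 2) * e\<^sup>2" .
        moreover have "e\<^sup>2 / 4 * J k \<le> e\<^sup>2 / 2 * J k"
          using e2 J_pos[of k] by (intro mult_right_mono) auto
        moreover have "e\<^sup>2 / 2 * J k = \<bar>real_of_int k\<bar> * e\<^sup>2 - ((\<bar>real_of_int k\<bar> - 1) / 2) * e\<^sup>2"
          by (simp add: jap_def field_simps)
        ultimately show ?thesis by linarith
      qed
      note shift = square_sum_shift[OF small[OF t'] less_imp_le[OF e] bspec[OF low t'] L(1)]
      have Re\<rho>: "Re (\<rho> t) = \<Gamma> / (2 * pi) * (\<Sum>q\<in>{-L..L}. real_of_int (k - q) * (cmod (a t q))\<^sup>2)"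
        unfolding \<rho>_def by (simp add: Re_res)
      have \<Gamma>0: "0 \<le> \<Gamma> / (2 * pi)" using \<Gamma>_pos by simp
      have cJ: "c * J k = \<Gamma> / (2 * pi) * (e\<^sup>2 / 4 * J k)" by (simp add: c_def)
      show "0 \<le> k \<longrightarrow> c * J k \<le> Re (\<rho> t)"
      proof
        assume "0 \<le> k"
        with shift(1) big have "e\<^sup>2 / 4 * J k \<le> (\<Sum>q\<in>{-L..L}. real_of_int (k - q) * (cmod (a t q))\<^sup>2)" by simp
        then show "c * J k \<le> Re (\<rho> t)" unfolding Re\<rho> cJ using \<Gamma>0 by (rule mult_left_mono)
      qed
      show "k \<le> 0 \<longrightarrow> Re (\<rho> t) \<le> - (c * J k)"
      proof
        assume "k \<le> 0"
        with shift(2) big have "(\<Sum>q\<in>{-L..L}. real_of_int (k - q) * (cmod (a t q))\<^sup>2) \<le> - (e\<^sup>2 / 4 * J k)" by simp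
        then have "Re (\<rho> t) \<le> \<Gamma> / (2 * pi) * (- (e\<^sup>2 / 4 * J k))" unfolding Re\<rho> using \<Gamma>0 by (rule mult_left_mono)
        then show "Re (\<rho> t) \<le> - (c * J k)" unfolding cJ by simp
      qed
    qed
  qed
qed

text \<open>Forcing of order \<open>J k ^ -(n + 1)\<close> over a rate of order \<open>J k\<close>
  yields the new power. Time is given up for the sake of the growing modes alone: at the final time
  only a crude bound on \<open>w\<close> is known, and the exponential earned over
  \<open>T - T'\<close> must make up for all powers of \<open>J k\<close>.\<close>

lemma smoothing_step:
  fixes A D e T T' :: real and n :: nat
  assumes A0: "0 \<le> A" and D0: "0 \<le> D" and e: "0 < e" and T: "0 < T'" "T' < T"
  shows "\<exists>D'\<ge>0. \<forall>a. mode_system T A a \<longrightarrow> (\<forall>t\<in>{0..T}. e \<le> cmod (a t 0)) \<longrightarrow> (\<forall>k<0. a 0 k = 0) \<longrightarrow>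
     (\<forall>t\<in>{0..T}. decay n D (\<lambda>l. cmod (a t l))) \<longrightarrow> (\<forall>t\<in>{0..T'}. decay (Suc n) D' (\<lambda>l. cmod (a t l)))"
proof -
  from corrected_mode[OF A0 D0 e, of n] obtain c K0 G where c: "0 < c" and G: "0 \<le> G" and
    H: "\<forall>a T k. mode_system T A a \<longrightarrow> (\<forall>t\<in>{0..T}. e \<le> cmod (a t 0)) \<longrightarrow>
     (\<forall>t\<in>{0..T}. decay n D (\<lambda>l. cmod (a t l))) \<longrightarrow> K0 \<le> \<bar>real_of_int k\<bar> \<longrightarrow>
     corrected_equation n c G T a k"
    by (elim exE conjE) (rule that)
  define m where "m = Suc (Suc n)"
  \<comment> \<open>The exponent per unit of \<open>J k\<close> that is available at every time up
    to \<open>T'\<close>.\<close>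
  define y where "y = c * (T - T') / 2"
  have y0: "0 < y" unfolding y_def using c T by simp
  define P where "P = (real m / y) ^ m"
  have P0: "0 \<le> P" unfolding P_def using y0 by simp
  \<comment> \<open>The first summand serves the frequencies below \<open>K0\<close>, the second the
    final value of a growing mode, the last the forcing; the copies of \<open>G\<close> account for
    the correction at time 0 and for the return from \<open>w\<close> to \<open>a\<close>.\<close>
  define D1 where "D1 = A * (1 + \<bar>K0\<bar>) ^ m + (A + G) * P + G + 2 * G + G / c"
  have D10: "0 \<le> D1" unfolding D1_def using A0 G P0 c by simp
  show ?thesis
  proof (rule exI[of _ "4 * D1"], intro conjI allI impI ballI)
    show "0 \<le> 4 * D1" using D10 by simp
    fix a t
    assume sys: "mode_system T A a" and low: "\<forall>t\<in>{0..T}. e \<le> cmod (a t 0)" and neg: "\<forall>k<0. a 0 k = 0"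
      and dec: "\<forall>t\<in>{0..T}. decay n D (\<lambda>l. cmod (a t l))" and t: "t \<in> {0..T'}"
    have tT: "0 \<le> t" "t \<le> T" "t \<in> {0..T}" using t T by auto
    have small: "small_l1 A (\<lambda>l. cmod (a t l))" if "t \<in> {0..T}" for t
      using sys that by (auto simp: mode_system_def)
    show "decay (Suc n) (4 * D1) (\<lambda>l. cmod (a t l))"
    proof (rule decay_of_pointwise)
      fix k
      have Jm: "1 \<le> J k ^ m" using J_ge_1 by (rule one_le_power)
      have Jm0: "0 < J k ^ m" using J_pos by simp
      have "cmod (a t k) * J k ^ m \<le> D1"
      proof (cases "K0 \<le> \<bar>real_of_int k\<bar>")
        case False
        have "cmod (a t k) * J k ^ m \<le> A * (1 + \<bar>K0\<bar>) ^ m"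
          using False small_l1_le[OF small[OF tT(3)], of k] J_pos[of k] A0
          by (intro mult_mono power_mono) (auto simp: jap_def)
        then show ?thesis unfolding D1_def using A0 G P0 c by (smt (verit) divide_nonneg_pos mult_nonneg_nonneg)
      next
        case True
        note ex = H[THEN spec, THEN spec, THEN spec, THEN mp, OF sys, THEN mp, OF low, THEN mp, OF dec, THEN mp, OF True]
        from ex[unfolded corrected_equation_def] obtain w \<rho> g where w1: "continuous_on {0..T} w"
          and w2: "\<forall>t\<in>{0..T}. cmod (a t k - w t) \<le> G / J k ^ Suc (Suc n)"
          and w3: "\<forall>t\<in>{0<..<T}. (w has_vector_derivative (\<rho> t * w t + g t)) (at t) \<and>
           cmod (g t) \<le> G / J k ^ Suc n \<and>
           (0 \<le> k \<longrightarrow> c * J k \<le> Re (\<rho> t)) \<and> (k \<le> 0 \<longrightarrow> Re (\<rho> t) \<le> - (c * J k))"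
          by (elim exE conjE) (rule that)
        have w: "continuous_on {0..T} w" "\<And>t. t \<in> {0..T} \<Longrightarrow> cmod (a t k - w t) \<le> G / J k ^ m"
          "\<And>t. 0 < t \<Longrightarrow> t < T \<Longrightarrow> (w has_vector_derivative (\<rho> t * w t + g t)) (at t)"
          "\<And>t. 0 < t \<Longrightarrow> t < T \<Longrightarrow> cmod (g t) \<le> G / J k ^ Suc n"
          "\<And>t. 0 \<le> k \<Longrightarrow> 0 < t \<Longrightarrow> t < T \<Longrightarrow> c * J k \<le> Re (\<rho> t)"
          "\<And>t. k \<le> 0 \<Longrightarrow> 0 < t \<Longrightarrow> t < T \<Longrightarrow> Re (\<rho> t) \<le> - (c * J k)"
          using w1 w2 w3 by (simp_all add: m_def)
        have cJ: "0 < c * J k" using c J_pos by simp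
        have Gn: "0 \<le> G / J k ^ Suc n" using G J_pos[of k] by simp
        have GcJ: "G / J k ^ Suc n / (c * J k) = G / c / J k ^ m" by (simp add: m_def)
        have wt: "cmod (w t) \<le> ((A + G) * P + G + G / c) / J k ^ m"
        proof (cases "0 \<le> k")
          case True
          have "cmod (w t) \<le> cmod (w T) * exp (- (c * J k * (T - t) / 2)) + G / J k ^ Suc n / (c * J k)"
            by (rule growing_ode_bound[OF tT(1,2) w(1,3) cJ w(5)[OF True] w(4) Gn])
          also have "\<dots> \<le> (A + G) * (P / J k ^ m) + G / c / J k ^ m"
          proof (intro add_mono mult_mono)
            have TT: "T \<in> {0..T}" using T by auto
            have "cmod (w T) \<le> cmod (a T k) + cmod (a T k - w T)"
              by (metis norm_minus_commute norm_triangle_sub)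
            also have "\<dots> \<le> A + G / J k ^ m"
              using small_l1_le[OF small[OF TT], of k] w(2)[OF TT] by simp
            also have "G / J k ^ m \<le> G" using G Jm by (simp add: pos_divide_le_eq mult_le_cancel_left1 Jm0)
            finally show "cmod (w T) \<le> A + G" by simp
            have "y * J k \<le> c * J k * (T - t) / 2"
              unfolding y_def using c J_pos[of k] t by simp
            then have "exp (- (c * J k * (T - t) / 2)) \<le> exp (- (y * J k))" by simp
            also have "\<dots> \<le> P / J k ^ m" unfolding P_def m_def by (rule exp_decay_le[OF y0 J_pos])
            finally show "exp (- (c * J k * (T - t) / 2)) \<le> P / J k ^ m" .
            show "G / J k ^ Suc n / (c * J k) \<le> G / c / J k ^ m" by (simp only: GcJ)
          qed (use A0 G in auto)
          also have "\<dots> = ((A + G) * P + G / c) / J k ^ m" by (simp add: add_divide_distrib)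
          also have "\<dots> \<le> ((A + G) * P + G + G / c) / J k ^ m"
            using Jm0 G by (intro divide_right_mono) auto
          finally show ?thesis .
        next
          case False
          have "cmod (w t) \<le> cmod (w 0) * exp (- (c * J k * (t - 0) / 2)) + G / J k ^ Suc n / (c * J k)"
            by (rule damped_ode_bound[OF tT(1,2) w(1,3) cJ w(6) w(4) Gn]) (use False in auto)
          also have "\<dots> \<le> (G / J k ^ m) * 1 + G / c / J k ^ m"
          proof (intro add_mono mult_mono)
            \<comment> \<open>The corrected unknown need not vanish initially, but it reduces to the
              correction, which is already of the desired order.\<close>
            have "a 0 k = 0" using neg False by auto
            then show "cmod (w 0) \<le> G / J k ^ m" using w(2)[of 0] T by simp
            show "exp (- (c * J k * (t - 0) / 2)) \<le> 1" using tT cJ by simp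
            show "G / J k ^ Suc n / (c * J k) \<le> G / c / J k ^ m" by (simp only: GcJ)
          qed (use G Jm0 in auto)
          also have "\<dots> = (G + G / c) / J k ^ m" by (simp add: add_divide_distrib)
          also have "\<dots> \<le> ((A + G) * P + G + G / c) / J k ^ m"
            using Jm0 A0 G P0 by (intro divide_right_mono) auto
          finally show ?thesis .
        qed
        have "cmod (a t k) \<le> cmod (w t) + cmod (a t k - w t)"
          by (metis norm_triangle_sub)
        also have "\<dots> \<le> ((A + G) * P + G + G / c) / J k ^ m + G / J k ^ m"
          using wt w(2)[OF tT(3)] by simp
        also have "\<dots> = ((A + G) * P + G + G / c + G) / J k ^ m" by (simp add: add_divide_distrib)
        finally have "cmod (a t k) * J k ^ m \<le> (A + G) * P + G + G / c + G"
          using Jm0 by (simp add: pos_le_divide_eq)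
        also have "\<dots> \<le> D1" unfolding D1_def using A0 G by simp
        finally show ?thesis .
      qed
      then show "cmod (a t k) * J k ^ Suc (Suc n) \<le> D1" by (simp add: m_def)
    qed simp
  qed
qed

text \<open>Only the right end of the interval is given up, so time 0 with its vanishing negative
  modes remains available in every step. The constant is found before \<open>a\<close> is
  given.\<close>

lemma smoothing:
  assumes A0: "0 \<le> A" and e: "0 < e"
  shows "0 < T \<Longrightarrow> \<exists>D\<ge>0. \<forall>a. mode_system T A a \<longrightarrow> (\<forall>t\<in>{0..T}. e \<le> cmod (a t 0)) \<longrightarrow> (\<forall>k<0. a 0 k = 0) \<longrightarrow>
     (\<forall>t\<in>{0..T / 2 ^ n}. decay n D (\<lambda>l. cmod (a t l)))"
proof (induction n)
  case 0
  have "decay 0 A f" if "small_l1 A f" for f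
    unfolding decay_def using small_l1_J[OF that] small_l1_sum[OF that] by (auto simp: mult.commute)
  then show ?case
    by (intro exI[of _ A]) (auto simp: A0 mode_system_def)
next
  case (Suc n)
  from Suc.IH[OF Suc.prems] obtain D where D0: "0 \<le> D" and D: "\<forall>a. mode_system T A a \<longrightarrow> (\<forall>t\<in>{0..T}. e \<le> cmod (a t 0)) \<longrightarrow> (\<forall>k<0. a 0 k = 0) \<longrightarrow>
     (\<forall>t\<in>{0..T / 2 ^ n}. decay n D (\<lambda>l. cmod (a t l)))"
    by (elim exE conjE) (rule that)
  note T0 = Suc.prems
  have le: "T / 2 ^ n \<le> T" using T0 by (simp add: pos_divide_le_eq mult_le_cancel_left1)
  have lt: "0 < T / 2 ^ Suc n" "T / 2 ^ Suc n < T / 2 ^ n" using T0 by (auto simp: field_simps)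
  from smoothing_step[OF A0 D0 e lt, of n] obtain D' where D'0: "0 \<le> D'"
    and D': "\<forall>a. mode_system (T / 2 ^ n) A a \<longrightarrow> (\<forall>t\<in>{0..T / 2 ^ n}. e \<le> cmod (a t 0)) \<longrightarrow> (\<forall>k<0. a 0 k = 0) \<longrightarrow>
     (\<forall>t\<in>{0..T / 2 ^ n}. decay n D (\<lambda>l. cmod (a t l))) \<longrightarrow> (\<forall>t\<in>{0..T / 2 ^ Suc n}. decay (Suc n) D' (\<lambda>l. cmod (a t l)))"
    by (elim exE conjE) (rule that)
  show ?case
  proof (rule exI[of _ D'], intro conjI allI impI D'0)
    fix a assume a: "mode_system T A a" "\<forall>t\<in>{0..T}. e \<le> cmod (a t 0)" "\<forall>k<0. a 0 k = 0"
    show "\<forall>t\<in>{0..T / 2 ^ Suc n}. decay (Suc n) D' (\<lambda>l. cmod (a t l))"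
    proof -
      have "\<forall>t\<in>{0..T / 2 ^ n}. e \<le> cmod (a t 0)" using a(2) le by auto
      note D'[THEN spec, THEN mp, OF mode_system_subset[OF a(1) le], THEN mp, OF this, THEN mp, OF a(3), THEN mp]
      then show ?thesis using D[THEN spec, THEN mp, OF a(1), THEN mp, OF a(2), THEN mp, OF a(3)] by blast
    qed
  qed
qed

text \<open>Since \<open>\<omega> 0 = 0\<close>, only the nonlinearity moves the mean, at a speed
  bounded in terms of \<open>A\<close>. This keeps the growth rate away from zero for a short time
  although the mean need not be conserved.\<close>

lemma zero_mode_persists:
  assumes sys: "mode_system T A a" and t: "t \<in> {0..T}"
  shows "cmod (a 0 0) - 18 * K\<mu> * A ^ 3 * t \<le> cmod (a t 0)"
proof (cases "t = 0")
  case False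
  with t have t0: "0 < t" "t \<le> T" by auto
  have "cmod (a t 0 - a 0 0) \<le> 18 * K\<mu> * A ^ 3 * t - 18 * K\<mu> * A ^ 3 * 0"
  proof (rule differentiable_bound_general[OF t0(1)])
    show "continuous_on {0..t} (\<lambda>t. a t 0)"
      using sys t0 by (auto simp: mode_system_def intro: continuous_on_subset)
    show "continuous_on {0..t} (\<lambda>t. 18 * K\<mu> * A ^ 3 * t)" by (intro continuous_intros)
    fix s assume s: "0 < s" "s < t"
    have "((\<lambda>t. a t 0) has_vector_derivative (- (\<i> * \<omega> 0) * a s 0 + nonlin 0 (a s))) (at s)"
      using sys s t0 by (auto simp: mode_system_def)
    then show "((\<lambda>t. a t 0) has_vector_derivative nonlin 0 (a s)) (at s)" by (simp add: \<omega>_def)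
    show "((\<lambda>t. 18 * K\<mu> * A ^ 3 * t) has_vector_derivative 18 * K\<mu> * A ^ 3) (at s)"
      by (auto intro!: derivative_eq_intros simp flip: has_real_derivative_iff_has_vector_derivative)
    show "cmod (nonlin 0 (a s)) \<le> 18 * K\<mu> * A ^ 3"
      using sys s t0 by (intro nonlin_le_0) (auto simp: mode_system_def)
  qed
  then show ?thesis using norm_triangle_ineq2[of "a 0 0" "a t 0"] by (simp add: norm_minus_commute)
qed simp

theorem initial_decay:
  fixes A e T :: real
  assumes A: "0 < A" and e: "0 < e" and T: "0 < T"
  shows "\<exists>D. \<forall>a. mode_system T A a \<longrightarrow> e \<le> cmod (a 0 0) \<longrightarrow> (\<forall>k<0. a 0 k = 0) \<longrightarrow>
     (\<forall>k. cmod (a 0 k) * J k ^ n \<le> D)"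
proof -
  \<comment> \<open>Up to this time the drift of the mean is at most \<open>e / 2\<close>.\<close>
  define T1 where "T1 = min T (e / 2 / (18 * K\<mu> * A ^ 3))"
  have KA: "0 < 18 * K\<mu> * A ^ 3" using K\<mu>_pos A by simp
  have T1: "0 < T1" "T1 \<le> T" unfolding T1_def using T e KA by auto
  from smoothing[OF less_imp_le[OF A] half_gt_zero[OF e] T1(1), of n]
  obtain D where D: "\<forall>a. mode_system T1 A a \<longrightarrow> (\<forall>t\<in>{0..T1}. e / 2 \<le> cmod (a t 0)) \<longrightarrow> (\<forall>k<0. a 0 k = 0) \<longrightarrow>
     (\<forall>t\<in>{0..T1 / 2 ^ n}. decay n D (\<lambda>l. cmod (a t l)))"
    by (elim exE conjE) (rule that)
  show ?thesis
  proof (rule exI[of _ D], intro allI impI)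
    fix a k assume a: "mode_system T A a" "e \<le> cmod (a 0 0)" "\<forall>k<0. a 0 k = 0"
    note sys = mode_system_subset[OF a(1) T1(2)]
    have low: "\<forall>t\<in>{0..T1}. e / 2 \<le> cmod (a t 0)"
    proof
      fix t assume that: "t \<in> {0..T1}"
      have "18 * K\<mu> * A ^ 3 * t \<le> 18 * K\<mu> * A ^ 3 * (e / 2 / (18 * K\<mu> * A ^ 3))"
        using that KA by (intro mult_left_mono) (auto simp: T1_def)
      also have "\<dots> = e / 2" using KA by (metis less_irrefl nonzero_mult_div_cancel_left times_divide_eq_right)
      finally show "e / 2 \<le> cmod (a t 0)" using zero_mode_persists[OF sys that] a(2) by linarith
    qed
    have "decay n D (\<lambda>l. cmod (a 0 l))"
      using D[THEN spec, THEN mp, OF sys, THEN mp, OF low, THEN mp, OF a(3)] T1 by auto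
    then have d: "cmod (a 0 k) * J k ^ Suc n \<le> D" by (rule decay_le)
    have "cmod (a 0 k) * J k ^ n \<le> cmod (a 0 k) * J k ^ Suc n"
      using J_ge_1 by (intro mult_left_mono power_increasing) auto
    with d show "cmod (a 0 k) * J k ^ n \<le> D" by linarith
  qed
qed

end

section \<open>Uniqueness of Fourier coefficients\<close>

abbreviation circ :: "real measure" where "circ \<equiv> lebesgue_on {0..2*pi}"

definition emode :: "int \<Rightarrow> real \<Rightarrow> complex" where
  "emode k x = exp (\<i> * of_int k * complex_of_real x)"

lemma emode_0 [simp]: "emode 0 x = 1" by (simp add: emode_def)
lemma emode_add: "emode (k + l) x = emode k x * emode l x"
  by (simp add: emode_def exp_add[symmetric] algebra_simps)
lemma emode_minus: "exp (- (\<i> * of_int k * complex_of_real x)) = emode (- k) x"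
  by (simp add: emode_def)
lemma norm_emode [simp]: "cmod (emode k x) = 1"
  by (simp add: emode_def)
lemma cnj_emode: "cnj (emode k x) = emode (- k) x"
  by (simp add: emode_def exp_cnj)
lemma continuous_on_emode [continuous_intros]: "continuous_on S (emode k)"
  unfolding emode_def by (intro continuous_intros)
lemma emode_eq_power: "emode (int n) x = cis x ^ n"
  by (simp add: emode_def cis_conv_exp exp_of_nat_mult[symmetric] mult_ac)
lemma periodic_emode: "emode k (x + 2 * pi) = emode k x"
proof -
  have "exp (\<i> * of_int k * complex_of_real (x + 2 * pi)) =
      exp (\<i> * of_int k * complex_of_real x) * exp (2 * of_real pi * \<i> * of_int k)"
    by (simp add: exp_add[symmetric] algebra_simps)
  also have "exp (2 * of_real pi * \<i> * of_int k) = (1::complex)"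
    using exp_integer_2pi[of "of_int k"] by (simp add: mult_ac)
  finally show ?thesis by (simp add: emode_def)
qed

lemma integrable_circ_mult_bounded:
  fixes G h :: "real \<Rightarrow> complex"
  assumes "integrable circ h" "G \<in> borel_measurable circ" "\<And>x. x \<in> {0..2*pi} \<Longrightarrow> cmod (G x) \<le> B"
  shows "integrable circ (\<lambda>x. G x * h x)"
proof (rule Bochner_Integration.integrable_bound[where f = "\<lambda>x. B * cmod (h x)"])
  show "integrable circ (\<lambda>x. B * cmod (h x))" using assms(1) by simp
  show "(\<lambda>x. G x * h x) \<in> borel_measurable circ" using assms by measurable
  show "AE x in circ. cmod (G x * h x) \<le> norm (B * cmod (h x))"
  proof (rule AE_I2)
    fix x assume "x \<in> space circ"
    then have x: "cmod (G x) \<le> B" using assms(3) by simp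
    then have "0 \<le> B" by (meson norm_ge_zero order_trans)
    with x show "cmod (G x * h x) \<le> norm (B * cmod (h x))" by (simp add: norm_mult mult_right_mono)
  qed
qed

lemma integrable_circ_mult_continuous:
  fixes G h :: "real \<Rightarrow> complex"
  assumes "integrable circ h" "continuous_on {0..2*pi} G"
  shows "integrable circ (\<lambda>x. G x * h x)"
proof -
  have "compact (G ` {0..2*pi})" using assms(2) by (rule compact_continuous_image) simp
  then obtain B where "\<And>x. x \<in> {0..2*pi} \<Longrightarrow> cmod (G x) \<le> B"
    by (metis bounded_iff compact_imp_bounded imageI)
  moreover have "G \<in> borel_measurable circ"
    using assms(2) by (intro continuous_imp_measurable_on_sets_lebesgue) auto
  ultimately show ?thesis using assms(1) by (intro integrable_circ_mult_bounded)
qed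

lemma integrable_circ_emode: "integrable circ h \<Longrightarrow> integrable circ (\<lambda>x. emode k x * h x)"
  by (erule integrable_circ_mult_continuous) (intro continuous_intros)

lemma integrable_circ_continuous: "continuous_on {0..2*pi} G \<Longrightarrow> integrable circ (G :: real \<Rightarrow> complex)"
  using integrable_circ_mult_continuous[of "\<lambda>_. 1" G] by (simp add: integrable_const_ivl)

text \<open>Base case for polynomials on the circle: a real linear function is a combination of
  cosine and sine, hence of the characters 1 and -1.\<close>

lemma real_linear_on_circle:
  assumes "bounded_linear (f :: complex \<Rightarrow> real)"
  shows "\<exists>c d. \<forall>x. complex_of_real (f (cis x)) = c * emode 1 x + d * emode (-1) x"
proof -
  interpret bounded_linear f by fact
  define a b where "a = f 1" and "b = f \<i>"
  have "f (cis x) = cos x * a + sin x * b" for x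
  proof -
    have "cis x = cos x *\<^sub>R 1 + sin x *\<^sub>R \<i>" by (simp add: complex_eq_iff)
    then show ?thesis by (simp add: add scaleR a_def b_def)
  qed
  moreover have "emode 1 x = cis x" "emode (-1) x = cis (- x)" for x
    using emode_eq_power[of 1 x] cnj_emode[of 1 x] by (auto simp: cis_cnj)
  ultimately have "complex_of_real (f (cis x)) = ((a - \<i> * b) / 2) * emode 1 x + ((a + \<i> * b) / 2) * emode (-1) x" for x
    by (simp add: complex_eq_iff field_simps)
  then show ?thesis by blast
qed

section \<open>Orthogonality to all characters\<close>

context
  fixes h :: "real \<Rightarrow> complex"
  assumes h: "integrable circ h" and orth: "\<And>k. integral\<^sup>L circ (\<lambda>x. emode k x * h x) = 0"
begin

text \<open>The condition is imposed for every \<open>k\<close> and not just \<open>k = 0\<close>,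
  so that the set is stable under multiplication by characters; this carries the induction over
  polynomials.\<close>

definition annih :: "(real \<Rightarrow> complex) set" where
  "annih = {G. continuous_on UNIV G \<and> (\<forall>k. integral\<^sup>L circ (\<lambda>x. emode k x * (G x * h x)) = 0)}"

lemma annih_integrable: "G \<in> annih \<Longrightarrow> integrable circ (\<lambda>x. emode k x * (G x * h x))"
  unfolding annih_def
  by (intro integrable_circ_emode integrable_circ_mult_continuous h) (auto intro: continuous_on_subset)

lemma annih_real_polynomial:
  fixes p :: "complex \<Rightarrow> real"
  assumes "real_polynomial_function p" "G \<in> annih"
  shows "(\<lambda>x. complex_of_real (p (cis x)) * G x) \<in> annih"
  using assms
proof (induction arbitrary: G rule: real_polynomial_function.induct)
  case (linear f)
  then obtain c d where cd: "\<And>x. complex_of_real (f (cis x)) = c * emode 1 x + d * emode (-1) x"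
    using real_linear_on_circle by metis
  note I = annih_integrable[OF linear(2)]
  have "integral\<^sup>L circ (\<lambda>x. emode k x * (complex_of_real (f (cis x)) * G x * h x)) = 0" for k
  proof -
    have "(\<lambda>x. emode k x * (complex_of_real (f (cis x)) * G x * h x)) =
        (\<lambda>x. c * (emode (k + 1) x * (G x * h x)) + d * (emode (k + - 1) x * (G x * h x)))"
      unfolding cd emode_add by (simp add: algebra_simps)
    then show ?thesis using linear(2) I by (simp add: annih_def del: add_uminus_conv_diff)
  qed
  moreover have "continuous_on UNIV (\<lambda>x. complex_of_real (f (cis x)) * G x)"
    unfolding cd using linear(2) by (auto simp: annih_def intro!: continuous_intros)
  ultimately show ?case by (simp add: annih_def)
next
  case (const c)
  have "continuous_on UNIV G" and z: "\<And>k. integral\<^sup>L circ (\<lambda>x. emode k x * (G x * h x)) = 0"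
    using const by (auto simp: annih_def)
  moreover have "(\<lambda>x. emode k x * (complex_of_real c * G x * h x)) = (\<lambda>x. complex_of_real c * (emode k x * (G x * h x)))" for k
    by (simp add: mult_ac)
  ultimately show ?case by (auto simp: annih_def intro!: continuous_intros)
next
  case (add f g)
  note fg = add.IH(1)[OF add.prems] add.IH(2)[OF add.prems]
  have "(\<lambda>x. emode k x * (complex_of_real (f (cis x) + g (cis x)) * G x * h x)) =
      (\<lambda>x. emode k x * ((complex_of_real (f (cis x)) * G x) * h x) + emode k x * ((complex_of_real (g (cis x)) * G x) * h x))" for k
    by (simp add: algebra_simps)
  moreover have "continuous_on UNIV (\<lambda>x. complex_of_real (f (cis x)) * G x + complex_of_real (g (cis x)) * G x)"
    using fg by (intro continuous_on_add) (auto simp: annih_def)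
  ultimately show ?case
    using annih_integrable[OF fg(1)] annih_integrable[OF fg(2)] fg by (simp add: annih_def distrib_right)
next
  case (mult f g)
  \<comment> \<open>As \<open>G\<close> is arbitrary, the hypothesis for \<open>f\<close> applies to
    the function \<open>g\<close> times \<open>G\<close>, which is already known to be in
    \<open>annih\<close>.\<close>
  from mult.IH(1)[OF mult.IH(2)[OF mult.prems]]
  show ?case by (simp add: mult.assoc)
qed

text \<open>Uniform approximation by polynomials on the circle. Passing through \<open>cis x\<close>
  builds the periodicity into the test functions.\<close>

lemma orthogonal_to_continuous:
  fixes \<phi> :: "complex \<Rightarrow> real"
  assumes \<phi>: "continuous_on (sphere 0 1) \<phi>"
  shows "integral\<^sup>L circ (\<lambda>x. complex_of_real (\<phi> (cis x)) * h x) = 0"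
proof -
  have one: "(\<lambda>_. 1) \<in> annih" using orth by (simp add: annih_def)
  have cis_sphere: "cis x \<in> sphere 0 1" for x by simp
  have cont: "continuous_on S (\<lambda>x. \<phi> (cis x))" for S :: "real set"
    by (rule continuous_on_compose2[OF \<phi>]) (auto intro!: continuous_intros)
  define N where "N = integral\<^sup>L circ (\<lambda>x. cmod (h x))"
  have "cmod (integral\<^sup>L circ (\<lambda>x. complex_of_real (\<phi> (cis x)) * h x)) \<le> e * N" if "0 < e" for e
  proof -
    note e0 = that
    obtain p where p: "real_polynomial_function p" "\<And>z. z \<in> sphere 0 1 \<Longrightarrow> \<bar>\<phi> z - p z\<bar> < e"
      using Stone_Weierstrass_real_polynomial_function[OF compact_sphere \<phi> e0] by metis
    have pann: "(\<lambda>x. complex_of_real (p (cis x)) * 1) \<in> annih"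
      by (rule annih_real_polynomial[OF p(1) one])
    then have p0: "integral\<^sup>L circ (\<lambda>x. complex_of_real (p (cis x)) * h x) = 0"
      unfolding annih_def by (auto dest!: spec[of _ 0])
    have Ip: "integrable circ (\<lambda>x. complex_of_real (p (cis x)) * h x)"
      using annih_integrable[OF pann, of 0] by simp
    have I\<phi>: "integrable circ (\<lambda>x. complex_of_real (\<phi> (cis x)) * h x)"
      by (intro integrable_circ_mult_continuous h continuous_intros cont)
    have "integral\<^sup>L circ (\<lambda>x. complex_of_real (\<phi> (cis x)) * h x) =
        integral\<^sup>L circ (\<lambda>x. complex_of_real (\<phi> (cis x)) * h x - complex_of_real (p (cis x)) * h x)"
      using Ip I\<phi> p0 by simp
    also have "cmod \<dots> \<le> integral\<^sup>L circ (\<lambda>x. cmod (complex_of_real (\<phi> (cis x)) * h x - complex_of_real (p (cis x)) * h x))"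
      by (rule integral_norm_bound)
    also have "\<dots> \<le> integral\<^sup>L circ (\<lambda>x. e * cmod (h x))"
    proof (rule integral_mono)
      show "integrable circ (\<lambda>x. cmod (complex_of_real (\<phi> (cis x)) * h x - complex_of_real (p (cis x)) * h x))"
        using Ip I\<phi> by simp
      show "integrable circ (\<lambda>x. e * cmod (h x))" using h by simp
      fix x
      have "complex_of_real (\<phi> (cis x)) * h x - complex_of_real (p (cis x)) * h x = complex_of_real (\<phi> (cis x) - p (cis x)) * h x"
        by (simp add: left_diff_distrib)
      also have "cmod \<dots> \<le> e * cmod (h x)"
        unfolding norm_mult norm_of_real using p(2)[OF cis_sphere, of x] by (intro mult_right_mono) auto
      finally show "cmod (complex_of_real (\<phi> (cis x)) * h x - complex_of_real (p (cis x)) * h x) \<le> e * cmod (h x)" .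
    qed
    also have "\<dots> = e * N" by (simp add: N_def)
    finally show ?thesis .
  qed
  then have le: "cmod (integral\<^sup>L circ (\<lambda>x. complex_of_real (\<phi> (cis x)) * h x)) \<le> 0 + e" if "0 < e" for e
  proof -
    have N0: "0 \<le> N" unfolding N_def by simp
    have "cmod (integral\<^sup>L circ (\<lambda>x. complex_of_real (\<phi> (cis x)) * h x)) \<le> e / (N + 1) * N"
      by (rule \<open>\<And>e. 0 < e \<Longrightarrow> _\<close>) (use that N0 in auto)
    also have "\<dots> \<le> e" using that N0 by (simp add: field_simps)
    finally show ?thesis by simp
  qed
  show ?thesis using field_le_epsilon[OF le] by simp
qed

lemma cis_inj_inner:
  assumes "x \<in> {0<..<2*pi}" "y \<in> {0..2*pi}" "cis x = cis y"
  shows "x = y"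
proof -
  have "cos x = cos y" "sin x = sin y" using assms(3) by (auto simp: complex_eq_iff)
  then obtain n :: int where n: "x = y + 2 * pi * n" by (metis sin_cos_eq_iff)
  have "\<bar>x - y\<bar> < 2 * pi" using assms(1,2) by auto
  then have "2 * pi * \<bar>real_of_int n\<bar> < 2 * pi * 1" using n by (simp add: abs_mult)
  then have "\<bar>real_of_int n\<bar> < 1" using pi_gt_zero by (simp only: mult_less_cancel_left_pos)
  then have "n = 0" by linarith
  then show ?thesis using n by simp
qed

text \<open>The indicator of \<open>K\<close> is, off the endpoints, the limit of continuous
  functions of the distance of \<open>cis x\<close> to the image of \<open>K\<close>, so dominated
  convergence applies.\<close>

lemma integral_compact_zero:
  assumes K: "compact K" "K \<subseteq> {0..2*pi}"
  shows "integral\<^sup>L circ (\<lambda>x. indicator K x * h x) = 0"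
proof (cases "K = {}")
  case False
  define C where "C = cis ` K"
  have "compact C" unfolding C_def using K(1) by (intro compact_continuous_image continuous_intros)
  then have C: "closed C" "C \<noteq> {}" using False by (auto simp: C_def compact_imp_closed)
  define \<phi> where "\<phi> n z = max 0 (1 - real n * infdist z C)" for n z
  have \<phi>c: "continuous_on S (\<phi> n)" for S n unfolding \<phi>_def by (intro continuous_intros)
  have "(\<lambda>n. integral\<^sup>L circ (\<lambda>x. complex_of_real (\<phi> n (cis x)) * h x)) \<longlonglongrightarrow> integral\<^sup>L circ (\<lambda>x. indicator K x * h x)"
  proof (rule integral_dominated_convergence[where w = "\<lambda>x. cmod (h x)"])
    show "integrable circ (\<lambda>x. cmod (h x))" using h by simp
    have "K \<in> sets circ" using K by (auto simp: sets_restrict_space compact_imp_closed intro!: image_eqI[of _ _ K])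
    then show "(\<lambda>x. indicator K x * h x) \<in> borel_measurable circ"
      using h by (intro borel_measurable_times borel_measurable_indicator) auto
    show "(\<lambda>x. complex_of_real (\<phi> n (cis x)) * h x) \<in> borel_measurable circ" for n
      by (rule borel_measurable_integrable, intro integrable_circ_mult_continuous h continuous_intros
          continuous_on_compose2[OF \<phi>c[of UNIV]]) auto
    have bound: "\<bar>\<phi> n z\<bar> \<le> 1" for n z unfolding \<phi>_def using infdist_nonneg[of z C] by auto
    show "AE x in circ. cmod (complex_of_real (\<phi> n (cis x)) * h x) \<le> cmod (h x)" for n
      using bound by (intro AE_I2) (simp add: norm_mult mult_left_le_one_le)
    \<comment> \<open>\<open>cis\<close> identifies the two endpoints, so if \<open>K\<close>
      contains just one of them the limit at the other is wrong; this happens on a null set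
      only.\<close>
    have "negligible {0, 2*pi}" by simp
    then have "{0, 2*pi} \<in> null_sets lebesgue" by (simp add: negligible_iff_null_sets)
    then have "AE x in lebesgue. x \<notin> {0, 2*pi}" by (rule AE_not_in)
    then have "AE x in lebesgue. x \<in> {0..2*pi} \<longrightarrow> x \<notin> {0, 2*pi}" by eventually_elim blast
    then have ae: "AE x in circ. x \<notin> {0, 2*pi}"
      by (subst AE_restrict_space_iff) simp_all
    show "AE x in circ. (\<lambda>n. complex_of_real (\<phi> n (cis x)) * h x) \<longlonglongrightarrow> indicator K x * h x"
      using ae AE_space
    proof eventually_elim
      fix x assume "x \<notin> {0, 2*pi}" "x \<in> space circ"
      then have x: "x \<in> {0<..<2*pi}" by auto
      have iff: "cis x \<in> C \<longleftrightarrow> x \<in> K" unfolding C_def using cis_inj_inner[OF x] K(2) by auto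
      have "(\<lambda>n. \<phi> n (cis x)) \<longlonglongrightarrow> indicator K x"
      proof (cases "x \<in> K")
        case True
        then have "cis x \<in> C" using iff by simp
        then have "\<phi> n (cis x) = 1" for n by (simp add: \<phi>_def)
        then show ?thesis using True by simp
      next
        case False
        then have "infdist (cis x) C \<noteq> 0" using iff in_closed_iff_infdist_zero[OF C] by simp
        then have d: "0 < infdist (cis x) C" using infdist_nonneg[of "cis x" C] by simp
        obtain N :: nat where N: "1 / infdist (cis x) C < N" using reals_Archimedean2 by blast
        have "\<phi> n (cis x) = 0" if "N \<le> n" for n
        proof -
          have "1 / infdist (cis x) C < n" using N that by linarith
          then show ?thesis using d by (simp add: \<phi>_def pos_divide_less_eq)
        qed
        then have "\<forall>\<^sub>F n in sequentially. \<phi> n (cis x) = indicator K x"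
          using False by (auto simp: eventually_sequentially)
        then show ?thesis by (rule tendsto_eventually)
      qed
      then have "(\<lambda>n. complex_of_real (\<phi> n (cis x)) * h x) \<longlonglongrightarrow> complex_of_real (indicator K x) * h x"
        by (intro tendsto_intros)
      moreover have "complex_of_real (indicator K x) = indicator K x" by (simp add: indicator_def)
      ultimately show "(\<lambda>n. complex_of_real (\<phi> n (cis x)) * h x) \<longlonglongrightarrow> indicator K x * h x"
        by (simp only:)
    qed
  qed
  moreover have "integral\<^sup>L circ (\<lambda>x. complex_of_real (\<phi> n (cis x)) * h x) = 0" for n
    by (rule orthogonal_to_continuous) (rule \<phi>c)
  ultimately show ?thesis by (simp add: LIMSEQ_const_iff)
qed simp

end

text \<open>By inner regularity the set where \<open>f\<close> is positive is, up to measure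
  \<open>e\<close>, a compact set; a vanishing integral of a positive function makes that compact
  set null.\<close>

lemma AE_nonpos_of_compact_integrals:
  fixes f :: "real \<Rightarrow> real"
  assumes f: "integrable circ f"
    and z: "\<And>K. compact K \<Longrightarrow> K \<subseteq> {0..2*pi} \<Longrightarrow> integral\<^sup>L circ (\<lambda>x. indicator K x * f x) = 0"
  shows "AE x in circ. f x \<le> 0"
proof -
  define S where "S = {x \<in> {0..2*pi}. 0 < f x}"
  have [measurable]: "f \<in> borel_measurable circ" using f by auto
  have "{x \<in> space circ. 0 < f x} \<in> sets circ" by measurable
  then have Sc: "S \<in> sets circ" by (simp add: S_def)
  then have S: "S \<in> sets lebesgue" by (auto simp: sets_restrict_space)
  have "emeasure lebesgue S \<le> e" if e: "0 < e" for e :: real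
  proof -
    obtain T where T: "closed T" "T \<subseteq> S" "S - T \<in> lmeasurable" "emeasure lebesgue (S - T) < ennreal e"
      using sets_lebesgue_inner_closed[OF S e] by metis
    have TS: "T \<subseteq> {0..2*pi}" using T(2) by (auto simp: S_def)
    then have cT: "compact T" using T(1) by (meson bounded_closed_interval bounded_subset compact_eq_bounded_closed)
    have Tc: "T \<in> sets circ" using TS T(1) by (auto simp: sets_restrict_space intro!: image_eqI[of _ _ T])
    have int: "integrable circ (\<lambda>x. indicator T x * f x)"
      using integrable_mult_indicator[OF Tc f] by simp
    have "AE x in circ. 0 \<le> indicator T x * f x"
      using T(2) by (intro AE_I2) (auto simp: indicator_def S_def)
    then have "AE x in circ. indicator T x * f x = 0"
      using z[OF cT TS] integral_nonneg_eq_0_iff_AE[OF int] by blast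
    then have "AE x in circ. x \<notin> T"
      by eventually_elim (use T(2) in \<open>auto simp: indicator_def S_def split: if_splits\<close>)
    then have "T \<in> null_sets circ" using Tc by (subst AE_iff_null_sets)
    then have "T \<in> null_sets lebesgue" using null_sets_restrict_space[of "{0..2*pi}" lebesgue] by auto
    then have "emeasure lebesgue S = emeasure lebesgue (S - T)"
      using S by (simp add: emeasure_Diff_null_set)
    then show ?thesis using T(4) by simp
  qed
  then have "emeasure lebesgue S \<le> 0 + ennreal e" if "0 < e" for e using that by simp
  then have "emeasure lebesgue S \<le> 0" by (rule ennreal_le_epsilon)
  then have "S \<in> null_sets lebesgue" using S by auto
  then have "S \<in> null_sets circ" using Sc by (auto simp: null_sets_restrict_space S_def)
  then have "AE x in circ. x \<notin> S" by (rule AE_not_in)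
  then show ?thesis using AE_space by eventually_elim (auto simp: S_def)
qed

text \<open>By Stone-Weierstrass, \<open>h\<close> is orthogonal to all continuous functions on the circle and hence to the indicators
  of compact sets.\<close>

lemma fourier_uniqueness:
  assumes h: "integrable circ h" and orth: "\<And>k. integral\<^sup>L circ (\<lambda>x. emode k x * h x) = 0"
  shows "AE x in circ. h x = 0"
proof -
  have IK: "integrable circ (\<lambda>x. indicator K x * h x)" if "compact K" "K \<subseteq> {0..2*pi}" for K
  proof -
    have "K \<in> sets circ" using that by (auto simp: sets_restrict_space compact_imp_closed intro!: image_eqI[of _ _ K])
    moreover have "(\<lambda>x. indicator K x *\<^sub>R h x) = (\<lambda>x. indicator K x * h x)"
      by (auto simp: indicator_def)
    ultimately show ?thesis using integrable_mult_indicator[of K circ h] h by metis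
  qed
  have R: "integral\<^sup>L circ (\<lambda>x. indicator K x * Re (h x)) = 0" "integral\<^sup>L circ (\<lambda>x. indicator K x * Im (h x)) = 0"
    if "compact K" "K \<subseteq> {0..2*pi}" for K
  proof -
    have eqs: "(\<lambda>x. indicator K x * Re (h x)) = (\<lambda>x. Re (indicator K x * h x))"
      "(\<lambda>x. indicator K x * Im (h x)) = (\<lambda>x. Im (indicator K x * h x))"
      by (auto simp: indicator_def)
    show "integral\<^sup>L circ (\<lambda>x. indicator K x * Re (h x)) = 0" "integral\<^sup>L circ (\<lambda>x. indicator K x * Im (h x)) = 0"
      unfolding eqs integral_Re[OF IK[OF that]] integral_Im[OF IK[OF that]] integral_compact_zero[OF h orth that]
      by simp_all
  qed
  have "AE x in circ. Re (h x) \<le> 0" "AE x in circ. - Re (h x) \<le> 0"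
    "AE x in circ. Im (h x) \<le> 0" "AE x in circ. - Im (h x) \<le> 0"
    using h R by (intro AE_nonpos_of_compact_integrals; simp)+
  then show ?thesis by eventually_elim (auto simp: complex_eq_iff)
qed

section \<open>Fourier coefficients of products\<close>

lemma fourier_emode: "fourier f k = complex_of_real (1 / sqrt (2 * pi)) * integral\<^sup>L circ (\<lambda>x. emode (- k) x * f x)"
  by (simp add: fourier_def torus_integral_def emode_minus)

lemma torus_integral_emode: "torus_integral (\<lambda>x. f x * emode (- k) x) = complex_of_real (sqrt (2 * pi)) * fourier f k"
proof -
  have "complex_of_real (sqrt (2 * pi)) * complex_of_real (1 / sqrt (2 * pi)) = 1"
    using pi_gt_zero by (simp flip: of_real_mult)
  then show ?thesis
    unfolding fourier_emode mult.assoc[symmetric] by (simp add: torus_integral_def mult.commute)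
qed

lemma integral_emode: "integral\<^sup>L circ (emode k) = (if k = 0 then 2 * pi else 0)"
proof (cases "k = 0")
  case True
  then have "integral\<^sup>L circ (emode k) = integral\<^sup>L circ (\<lambda>_. 1)" by (intro Bochner_Integration.integral_cong) auto
  also have "\<dots> = 2 * pi" by (simp add: measure_restrict_space scaleR_conv_of_real)
  finally show ?thesis using True by simp
next
  case False
  have "(emode k has_integral (emode k (2 * pi) / (\<i> * k) - emode k 0 / (\<i> * k))) {0..2*pi}"
  proof (rule fundamental_theorem_of_calculus)
    fix x :: real
    have "((\<lambda>x. emode k (of_real x) / (\<i> * k)) has_vector_derivative emode k x) (at x within {0..2*pi})"
      unfolding emode_def using False
      by (auto intro!: derivative_eq_intros has_vector_derivative_real_field simp: field_simps)
    then show "((\<lambda>x. emode k x / (\<i> * k)) has_vector_derivative emode k x) (at x within {0..2*pi})" by simp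
  qed simp
  then have "integral {0..2*pi} (emode k) = 0"
    using periodic_emode[of k 0] by (simp add: integral_unique)
  then show ?thesis
    using False lebesgue_integral_eq_integral[OF integrable_circ_continuous[OF continuous_on_emode], of k] by simp
qed

lemma integral_circ_bound:
  assumes "\<And>x. x \<in> {0..2*pi} \<Longrightarrow> cmod (g x) \<le> B * v x" "integrable circ g" "integrable circ v"
  shows "cmod (integral\<^sup>L circ g) \<le> B * integral\<^sup>L circ v"
proof -
  have "cmod (integral\<^sup>L circ g) \<le> integral\<^sup>L circ (\<lambda>x. cmod (g x))" by (rule integral_norm_bound)
  also have "\<dots> \<le> integral\<^sup>L circ (\<lambda>x. B * v x)"
    using assms by (intro integral_mono) auto
  finally show ?thesis by simp
qed

lemma finite_sums_imp_summable:
  fixes f :: "'a \<Rightarrow> 'b :: banach"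
  assumes "\<And>S. finite S \<Longrightarrow> (\<Sum>l\<in>S. norm (f l)) \<le> C"
  shows "(\<lambda>l. norm (f l)) summable_on UNIV" "f summable_on UNIV"
proof -
  have "bdd_above (sum (\<lambda>l. norm (f l)) ` {F. F \<subseteq> UNIV \<and> finite F})"
    using assms by (intro bdd_aboveI2) auto
  then show "(\<lambda>l. norm (f l)) summable_on UNIV" by (intro nonneg_bdd_above_summable_on) auto
  then show "f summable_on UNIV" by (rule abs_summable_summable)
qed

text \<open>The symmetric intervals eventually contain every finite set.\<close>

lemma symmetric_partial_sums:
  fixes f :: "int \<Rightarrow> 'b :: banach"
  assumes "f summable_on UNIV"
  shows "(\<lambda>n. sum f {-int n..int n}) \<longlonglongrightarrow> infsum f UNIV"
proof -
  have "(sum f \<longlongrightarrow> infsum f UNIV) (finite_subsets_at_top UNIV)"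
    using has_sum_infsum[OF assms] by (simp only: has_sum_def)
  moreover have "filterlim (\<lambda>n. {-int n..int n}) (finite_subsets_at_top UNIV) sequentially"
    unfolding filterlim_finite_subsets_at_top
  proof (intro allI impI, elim conjE)
    fix X :: "int set" assume X: "finite X"
    define N where "N = nat (Max (insert 0 (abs ` X)))"
    have N: "\<bar>x\<bar> \<le> int N" if "x \<in> X" for x
      unfolding N_def using X that by (auto intro!: Max_ge)
    have "X \<subseteq> {- int n..int n}" if "N \<le> n" for n
    proof
      fix x assume "x \<in> X"
      from N[OF this] that show "x \<in> {- int n..int n}" by auto
    qed
    then show "\<forall>\<^sub>F n in sequentially. finite {-int n..int n} \<and> X \<subseteq> {-int n..int n} \<and> {-int n..int n} \<subseteq> UNIV"
      by (auto simp: eventually_sequentially)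
  qed
  ultimately show ?thesis by (rule filterlim_compose)
qed

lemma in_Hs_integrable:
  assumes "in_Hs s f"
  shows "integrable circ f" "integrable circ (\<lambda>x. complex_of_real ((cmod (f x))\<^sup>2))"
proof -
  have f: "f \<in> borel_measurable circ" "integrable circ (\<lambda>x. (cmod (f x))\<^sup>2)" using assms by (auto simp: in_Hs_def)
  show "integrable circ (\<lambda>x. complex_of_real ((cmod (f x))\<^sup>2))" using f(2) by (rule integrable_of_real)
  have "integrable circ (\<lambda>x. 1 + (cmod (f x))\<^sup>2)"
    using f(2) by (intro Bochner_Integration.integrable_add) simp_all
  then show "integrable circ f"
  proof (rule Bochner_Integration.integrable_bound)
    show "AE x in circ. cmod (f x) \<le> norm (1 + (cmod (f x))\<^sup>2)"
    proof (rule AE_I2)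
      fix x
      have "0 \<le> (cmod (f x) - 1)\<^sup>2" by simp
      then have "2 * cmod (f x) \<le> 1 + (cmod (f x))\<^sup>2" by (simp add: power2_diff)
      then have "cmod (f x) \<le> 1 + (cmod (f x))\<^sup>2" using norm_ge_zero[of "f x"] by linarith
      then show "cmod (f x) \<le> norm (1 + (cmod (f x))\<^sup>2)" by simp
    qed
  qed (rule f)
qed

lemma hs_coeffs_finite_sum:
  assumes "hs_coeffs s a" "finite S"
  shows "(\<Sum>k\<in>S. (J k powr s * cmod (a k))\<^sup>2) \<le> (hs_norm s a)\<^sup>2"
proof -
  have "0 \<le> (\<Sum>\<^sub>\<infinity>k. (J k powr s * cmod (a k))\<^sup>2)" by (intro infsum_nonneg) simp
  then have "(hs_norm s a)\<^sup>2 = (\<Sum>\<^sub>\<infinity>k. (J k powr s * cmod (a k))\<^sup>2)" by (simp add: hs_norm_def)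
  then show ?thesis
    using finite_sum_le_infsum[of "\<lambda>k. (J k powr s * cmod (a k))\<^sup>2" UNIV S] assms
    by (simp add: hs_coeffs_def)
qed

lemma hs_norm_nonneg: "0 \<le> hs_norm s a"
  by (simp add: hs_norm_def infsum_nonneg)

lemma hs_coeffs_small_l1:
  assumes "hs_coeffs s a" "1 \<le> s" "hs_norm s a \<le> M"
  shows "small_l1 (2 * M) (\<lambda>k. cmod (a k))"
proof (rule small_l1_of_H1)
  show M: "0 \<le> M" using assms(3) hs_norm_nonneg by (rule order_trans[rotated])
  fix S :: "int set" assume S: "finite S"
  have "(\<Sum>k\<in>S. (J k * cmod (a k))\<^sup>2) \<le> (\<Sum>k\<in>S. (J k powr s * cmod (a k))\<^sup>2)"
  proof (intro sum_mono power_mono mult_right_mono)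
    fix k
    have "J k powr 1 \<le> J k powr s" using assms(2) J_ge_1 by (intro powr_mono) auto
    then show "J k \<le> J k powr s" using J_pos[of k] by simp
  qed (use J_pos in \<open>auto intro!: mult_nonneg_nonneg simp: less_imp_le\<close>)
  also have "\<dots> \<le> (hs_norm s a)\<^sup>2" by (rule hs_coeffs_finite_sum[OF assms(1) S])
  also have "\<dots> \<le> M\<^sup>2" using assms(3) hs_norm_nonneg by (rule power_mono)
  finally show "(\<Sum>k\<in>S. (J k * cmod (a k))\<^sup>2) \<le> M\<^sup>2" .
qed simp

abbreviation (input) "c0 \<equiv> complex_of_real (1 / sqrt (2 * pi))"

lemma c0_sq: "c0 * c0 = 1 / (2 * pi)"
proof -
  have "c0 * c0 = complex_of_real (1 / sqrt (2 * pi) * (1 / sqrt (2 * pi)))"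
    by (simp only: of_real_mult)
  also have "1 / sqrt (2 * pi) * (1 / sqrt (2 * pi)) = 1 / (2 * pi)"
    by simp
  finally show ?thesis by simp
qed

lemma norm_c0_le: "cmod c0 \<le> 1"
proof -
  have "1 \<le> sqrt (2 * pi)" using pi_gt3 by simp
  then show ?thesis by (simp add: norm_divide)
qed

section \<open>Functions with absolutely summable Fourier coefficients\<close>

context
  fixes f :: "real \<Rightarrow> complex" and A :: real
  assumes f: "integrable circ f" and small: "small_l1 A (\<lambda>k. cmod (fourier f k))"
begin

definition partial_fourier :: "nat \<Rightarrow> real \<Rightarrow> complex" where
  "partial_fourier n x = (\<Sum>l=-int n..int n. c0 * fourier f l * emode l x)"

definition fourier_sum :: "real \<Rightarrow> complex" where
  "fourier_sum x = (\<Sum>\<^sub>\<infinity>l. c0 * fourier f l * emode l x)"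

lemma fourier_terms_sum_le:
  "(\<Sum>l\<in>S. cmod (c0 * fourier f l * emode l x)) \<le> (\<Sum>l\<in>S. cmod (fourier f l))"
proof (rule sum_mono)
  fix l
  have "cmod c0 * cmod (fourier f l) \<le> cmod (fourier f l)"
    by (rule mult_left_le_one_le[OF norm_ge_zero norm_ge_zero norm_c0_le])
  then show "cmod (c0 * fourier f l * emode l x) \<le> cmod (fourier f l)"
    unfolding norm_mult norm_emode mult_1_right .
qed

lemma fourier_terms_summable:
  "(\<lambda>l. cmod (c0 * fourier f l * emode l x)) summable_on S" "(\<lambda>l. c0 * fourier f l * emode l x) summable_on S"
proof -
  have "(\<Sum>l\<in>S. cmod (c0 * fourier f l * emode l x)) \<le> A" if "finite S" for S
    using fourier_terms_sum_le small_l1_sum[OF small that] by (rule order_trans)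
  note bound = this
  have "(\<lambda>l. cmod (c0 * fourier f l * emode l x)) summable_on UNIV"
    by (rule finite_sums_imp_summable(1)[where C = A]) (rule bound)
  then show "(\<lambda>l. cmod (c0 * fourier f l * emode l x)) summable_on S"
    by (rule summable_on_subset_banach) simp
  then show "(\<lambda>l. c0 * fourier f l * emode l x) summable_on S"
    by (rule abs_summable_summable)
qed

lemma fourier_sum_error: "cmod (fourier_sum x - partial_fourier n x) \<le> A / sqrt (1 + real n)"
proof -
  have "fourier_sum x - partial_fourier n x = (\<Sum>\<^sub>\<infinity>l\<in>- {-int n..int n}. c0 * fourier f l * emode l x)"
    unfolding fourier_sum_def partial_fourier_def Compl_eq_Diff_UNIV
    using infsum_Diff[OF fourier_terms_summable(2) fourier_terms_summable(2), of "{-int n..int n}" UNIV x]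
    by (simp only: subset_UNIV infsum_finite finite_atLeastAtMost_int)
  also have "cmod \<dots> \<le> (\<Sum>\<^sub>\<infinity>l\<in>- {-int n..int n}. cmod (c0 * fourier f l * emode l x))"
    by (rule norm_infsum_bound[OF fourier_terms_summable(1)])
  also have "\<dots> \<le> A / sqrt (1 + real n)"
  proof (rule infsum_le_finite_sums[OF fourier_terms_summable(1)])
    fix S :: "int set" assume S: "finite S" "S \<subseteq> - {-int n..int n}"
    have "real n \<le> \<bar>real_of_int l\<bar>" if "l \<in> S" for l
    proof -
      have "l \<notin> {-int n..int n}" using S that by auto
      then have "int n \<le> \<bar>l\<bar>" by auto
      then show ?thesis by linarith
    qed
    then have "(\<Sum>l\<in>S. cmod (fourier f l)) \<le> A / sqrt (1 + real n)"
      using small S(1) by (simp add: small_l1_def)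
    then show "(\<Sum>l\<in>S. cmod (c0 * fourier f l * emode l x)) \<le> A / sqrt (1 + real n)"
      using fourier_terms_sum_le[of x S] by linarith
  qed
  finally show ?thesis .
qed

lemma error_tendsto_0: "(\<lambda>n. A / sqrt (1 + real n) * B) \<longlonglongrightarrow> 0"
proof -
  have "filterlim (\<lambda>n. sqrt (1 + real n)) at_top sequentially"
    by (intro filterlim_compose[OF sqrt_at_top] filterlim_tendsto_add_at_top[OF tendsto_const] filterlim_real_sequentially)
  then have "(\<lambda>n. A / sqrt (1 + real n)) \<longlonglongrightarrow> 0"
    by (rule real_tendsto_divide_at_top[OF tendsto_const])
  then show ?thesis by (rule tendsto_mult_left_zero)
qed

lemma continuous_on_partial_fourier: "continuous_on S (partial_fourier n)"
  unfolding partial_fourier_def by (intro continuous_intros)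

lemma continuous_on_fourier_sum: "continuous_on S fourier_sum"
proof (rule uniform_limit_theorem)
  show "uniform_limit S partial_fourier fourier_sum sequentially"
  proof (rule uniform_limitI)
    fix e :: real assume "0 < e"
    then have "\<forall>\<^sub>F n in sequentially. A / sqrt (1 + real n) * 1 < e"
      by (rule order_tendstoD(2)[OF error_tendsto_0])
    then show "\<forall>\<^sub>F n in sequentially. \<forall>x\<in>S. dist (partial_fourier n x) (fourier_sum x) < e"
    proof eventually_elim
      case (elim n)
      then show ?case using fourier_sum_error[of _ n] 
        by (auto simp: dist_norm norm_minus_commute intro: le_less_trans)
    qed
  qed
qed (auto intro!: always_eventually continuous_on_partial_fourier)

text \<open>Uniform convergence of the partial sums lets the series pass through the integral
  although \<open>w\<close> is merely integrable.\<close>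

lemma integral_fourier_sum_mult:
  assumes w: "integrable circ w"
  shows "(\<lambda>n. \<Sum>l=-int n..int n. fourier f l * (c0 * integral\<^sup>L circ (\<lambda>x. emode (- (k - l)) x * w x)))
     \<longlonglongrightarrow> integral\<^sup>L circ (\<lambda>x. emode (- k) x * (fourier_sum x * w x))"
proof -
  have I: "integrable circ (\<lambda>x. emode (- k) x * (G x * w x))" if "continuous_on {0..2*pi} G" for G
    using that w by (intro integrable_circ_emode integrable_circ_mult_continuous)
  have "integral\<^sup>L circ (\<lambda>x. emode (- k) x * (partial_fourier n x * w x)) =
     (\<Sum>l=-int n..int n. fourier f l * (c0 * integral\<^sup>L circ (\<lambda>x. emode (- (k - l)) x * w x)))" for n
  proof -
    have "(\<lambda>x. emode (- k) x * (partial_fourier n x * w x)) =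
       (\<lambda>x. \<Sum>l=-int n..int n. fourier f l * c0 * (emode (- (k - l)) x * w x))"
    proof
      fix x
      have "emode (- k) x * (c0 * fourier f l * emode l x * w x) = fourier f l * c0 * (emode (- (k - l)) x * w x)" for l
        using emode_add[of "- k" l x] by simp
      then show "emode (- k) x * (partial_fourier n x * w x) =
          (\<Sum>l=-int n..int n. fourier f l * c0 * (emode (- (k - l)) x * w x))"
        unfolding partial_fourier_def sum_distrib_left sum_distrib_right by (intro sum.cong) auto
    qed
    moreover have "integral\<^sup>L circ (\<lambda>x. \<Sum>l=-int n..int n. fourier f l * c0 * (emode (- (k - l)) x * w x)) =
       (\<Sum>l=-int n..int n. fourier f l * c0 * integral\<^sup>L circ (\<lambda>x. emode (- (k - l)) x * w x))"
      by (subst Bochner_Integration.integral_sum) (auto intro!: integrable_mult_right integrable_circ_emode w)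
    ultimately show ?thesis by (simp add: mult.assoc)
  qed
  moreover have "(\<lambda>n. integral\<^sup>L circ (\<lambda>x. emode (- k) x * (partial_fourier n x * w x)))
     \<longlonglongrightarrow> integral\<^sup>L circ (\<lambda>x. emode (- k) x * (fourier_sum x * w x))"
  proof (rule LIM_zero_cancel, rule Lim_null_comparison[OF _ error_tendsto_0], rule always_eventually, rule allI)
    fix n
    have "integral\<^sup>L circ (\<lambda>x. emode (- k) x * (partial_fourier n x * w x)) - integral\<^sup>L circ (\<lambda>x. emode (- k) x * (fourier_sum x * w x))
       = integral\<^sup>L circ (\<lambda>x. emode (- k) x * (partial_fourier n x * w x) - emode (- k) x * (fourier_sum x * w x))"
      using I[OF continuous_on_partial_fourier] I[OF continuous_on_fourier_sum] by simp
    also have "cmod \<dots> \<le> A / sqrt (1 + real n) * integral\<^sup>L circ (\<lambda>x. cmod (w x))"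
    proof (rule integral_circ_bound)
      fix x
      have "emode (- k) x * (partial_fourier n x * w x) - emode (- k) x * (fourier_sum x * w x)
         = - (emode (- k) x * ((fourier_sum x - partial_fourier n x) * w x))" by (simp add: algebra_simps)
      also have "cmod \<dots> = cmod (fourier_sum x - partial_fourier n x) * cmod (w x)" by (simp add: norm_mult)
      also have "\<dots> \<le> A / sqrt (1 + real n) * cmod (w x)"
        by (intro mult_right_mono fourier_sum_error) simp
      finally show "cmod (emode (- k) x * (partial_fourier n x * w x) - emode (- k) x * (fourier_sum x * w x))
         \<le> A / sqrt (1 + real n) * cmod (w x)" .
    qed (use I[OF continuous_on_partial_fourier] I[OF continuous_on_fourier_sum] w in auto)
    finally show "cmod (integral\<^sup>L circ (\<lambda>x. emode (- k) x * (partial_fourier n x * w x)) -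
        integral\<^sup>L circ (\<lambda>x. emode (- k) x * (fourier_sum x * w x))) \<le> A / sqrt (1 + real n) * integral\<^sup>L circ (\<lambda>x. cmod (w x))" .
  qed
  ultimately show ?thesis by simp
qed

text \<open>The series has the same coefficients as \<open>f\<close>: against a character its
  partial sums reduce to a single term once \<open>n\<close> exceeds \<open>|k|\<close>. Uniqueness
  does the rest.\<close>

lemma AE_fourier_sum: "AE x in circ. f x = fourier_sum x"
proof -
  have Ig: "integrable circ fourier_sum" by (intro integrable_circ_continuous continuous_on_fourier_sum)
  have "integral\<^sup>L circ (\<lambda>x. emode (- k) x * fourier_sum x) = integral\<^sup>L circ (\<lambda>x. emode (- k) x * f x)" for k
  proof -
    have "(\<Sum>l=-int n..int n. fourier f l * (c0 * integral\<^sup>L circ (\<lambda>x. emode (- (k - l)) x * 1)))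
       = integral\<^sup>L circ (\<lambda>x. emode (- k) x * f x)" if "nat \<bar>k\<bar> \<le> n" for n
    proof -
      have "(\<Sum>l=-int n..int n. fourier f l * (c0 * integral\<^sup>L circ (\<lambda>x. emode (- (k - l)) x * 1)))
         = (\<Sum>l=-int n..int n. if l = k then fourier f k * (c0 * (2 * pi)) else 0)"
        by (intro sum.cong) (auto simp: integral_emode)
      also have "\<dots> = fourier f k * (c0 * (2 * pi))" using that by (subst sum.delta) auto
      also have "\<dots> = (c0 * c0) * (2 * pi) * integral\<^sup>L circ (\<lambda>x. emode (- k) x * f x)"
        unfolding fourier_emode by (simp only: mult_ac)
      also have "\<dots> = integral\<^sup>L circ (\<lambda>x. emode (- k) x * f x)"
        unfolding c0_sq by simp
      finally show ?thesis .
    qed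
    then have "(\<lambda>n. \<Sum>l=-int n..int n. fourier f l * (c0 * integral\<^sup>L circ (\<lambda>x. emode (- (k - l)) x * 1)))
       \<longlonglongrightarrow> integral\<^sup>L circ (\<lambda>x. emode (- k) x * f x)"
      by (intro tendsto_eventually) (auto simp: eventually_sequentially)
    moreover have "integrable circ (\<lambda>_. 1 :: complex)" by simp
    from integral_fourier_sum_mult[OF this, of k]
    have "(\<lambda>n. \<Sum>l=-int n..int n. fourier f l * (c0 * integral\<^sup>L circ (\<lambda>x. emode (- (k - l)) x * 1)))
       \<longlonglongrightarrow> integral\<^sup>L circ (\<lambda>x. emode (- k) x * fourier_sum x)" by simp
    ultimately show ?thesis by (rule LIMSEQ_unique[rotated])
  qed
  note coeff = this
  have "integral\<^sup>L circ (\<lambda>x. emode k x * (f x - fourier_sum x)) = 0" for k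
    unfolding right_diff_distrib
    using integrable_circ_emode[OF f, of k] integrable_circ_emode[OF Ig, of k] coeff[of "- k"] by simp
  then have "AE x in circ. f x - fourier_sum x = 0"
    using fourier_uniqueness[of "\<lambda>x. f x - fourier_sum x"] Bochner_Integration.integrable_diff[OF f Ig] by blast
  then show ?thesis by eventually_elim simp
qed

lemma fourier_le: "cmod (fourier w k) \<le> integral\<^sup>L circ (\<lambda>x. cmod (w x))" if "integrable circ w" for w
proof -
  have "cmod (integral\<^sup>L circ (\<lambda>x. emode (- k) x * w x)) \<le> 1 * integral\<^sup>L circ (\<lambda>x. cmod (w x))"
    using that by (intro integral_circ_bound integrable_circ_emode) (auto simp: norm_mult)
  then have le: "cmod (integral\<^sup>L circ (\<lambda>x. emode (- k) x * w x)) \<le> integral\<^sup>L circ (\<lambda>x. cmod (w x))" by simp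
  have "cmod c0 * cmod (integral\<^sup>L circ (\<lambda>x. emode (- k) x * w x)) \<le> cmod (integral\<^sup>L circ (\<lambda>x. emode (- k) x * w x))"
    using norm_c0_le by (intro mult_left_le_one_le norm_ge_zero)
  then show ?thesis
    unfolding fourier_emode norm_mult using le by (rule order_trans)
qed

text \<open>Summable coefficients are asked of \<open>f\<close> only, so \<open>w\<close> may be the
  conjugate of \<open>f\<close> or its squared modulus.\<close>

lemma fourier_mult:
  assumes w: "integrable circ w"
  shows "(\<lambda>l. fourier f l * fourier w (k - l)) summable_on UNIV"
    and "fourier (\<lambda>x. f x * w x) k = c0 * (\<Sum>\<^sub>\<infinity>l. fourier f l * fourier w (k - l))"
proof -
  define N where "N = integral\<^sup>L circ (\<lambda>x. cmod (w x))"
  have N0: "0 \<le> N" by (simp add: N_def)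
  have "(\<Sum>l\<in>S. cmod (fourier f l * fourier w (k - l))) \<le> A * N" if "finite S" for S
  proof -
    have "(\<Sum>l\<in>S. cmod (fourier f l * fourier w (k - l))) \<le> (\<Sum>l\<in>S. cmod (fourier f l) * N)"
      unfolding norm_mult N_def by (intro sum_mono mult_left_mono fourier_le w) auto
    also have "\<dots> \<le> A * N"
      unfolding sum_distrib_right[symmetric] using small_l1_sum[OF small that] N0 by (rule mult_right_mono)
    finally show ?thesis .
  qed
  then show S: "(\<lambda>l. fourier f l * fourier w (k - l)) summable_on UNIV" by (rule finite_sums_imp_summable)
  have "(\<lambda>n. \<Sum>l=-int n..int n. fourier f l * fourier w (k - l))
     \<longlonglongrightarrow> integral\<^sup>L circ (\<lambda>x. emode (- k) x * (fourier_sum x * w x))"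
    using integral_fourier_sum_mult[OF w, of k] by (simp only: fourier_emode)
  then have "integral\<^sup>L circ (\<lambda>x. emode (- k) x * (fourier_sum x * w x)) = (\<Sum>\<^sub>\<infinity>l. fourier f l * fourier w (k - l))"
    using symmetric_partial_sums[OF S] by (rule LIMSEQ_unique)
  moreover have "integral\<^sup>L circ (\<lambda>x. emode (- k) x * (fourier_sum x * w x)) = integral\<^sup>L circ (\<lambda>x. emode (- k) x * (f x * w x))"
  proof (rule integral_cong_AE)
    show "AE x in circ. emode (- k) x * (fourier_sum x * w x) = emode (- k) x * (f x * w x)"
      using AE_fourier_sum by eventually_elim simp
    have "emode (- k) \<in> borel_measurable circ" "fourier_sum \<in> borel_measurable circ"
      by (intro borel_measurable_integrable integrable_circ_continuous continuous_on_emode continuous_on_fourier_sum)+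
    then show "(\<lambda>x. emode (- k) x * (fourier_sum x * w x)) \<in> borel_measurable circ"
      "(\<lambda>x. emode (- k) x * (f x * w x)) \<in> borel_measurable circ" using f w by measurable
  qed
  ultimately show "fourier (\<lambda>x. f x * w x) k = c0 * (\<Sum>\<^sub>\<infinity>l. fourier f l * fourier w (k - l))"
    by (simp only: fourier_emode[of "\<lambda>x. f x * w x"])
qed

lemma fourier_cnj: "fourier (\<lambda>x. cnj (f x)) k = cnj (fourier f (- k))"
proof -
  have "integral\<^sup>L circ (\<lambda>x. emode (- k) x * cnj (f x)) = cnj (integral\<^sup>L circ (\<lambda>x. emode k x * f x))"
  proof -
    have "(\<lambda>x. emode (- k) x * cnj (f x)) = (\<lambda>x. cnj (emode k x * f x))" by (simp add: cnj_emode)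
    show ?thesis unfolding \<open>(\<lambda>x. emode (- k) x * cnj (f x)) = (\<lambda>x. cnj (emode k x * f x))\<close>
      by (rule Bochner_Integration.integral_cnj)
  qed
  then show ?thesis by (simp add: fourier_emode)
qed

lemma fourier_square:
  "fourier (\<lambda>x. complex_of_real ((cmod (f x))\<^sup>2)) j = c0 * (\<Sum>\<^sub>\<infinity>l. fourier f l * cnj (fourier f (l - j)))"
proof -
  have cf: "integrable circ (\<lambda>x. cnj (f x))" using f by simp
  have "(\<lambda>x. complex_of_real ((cmod (f x))\<^sup>2)) = (\<lambda>x. f x * cnj (f x))"
    by (simp add: complex_norm_square del: of_real_power)
  then show ?thesis using fourier_mult(2)[OF cf, of j] by (simp add: fourier_cnj)
qed

text \<open>Absolute summability of \<open>tri\<close> permits summing over \<open>p\<close> first,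
  and that inner sum is a coefficient of \<open>|f|^2\<close>.\<close>

lemma tri_iterated:
  assumes m: "\<And>q. cmod (m q) \<le> K * (J k + \<bar>real_of_int q\<bar>)"
  shows "(\<Sum>\<^sub>\<infinity>q. m (k - q) * fourier (\<lambda>x. complex_of_real ((cmod (f x))\<^sup>2)) (k - q) * fourier f q)
     = c0 * infsum (tri m k (fourier f)) UNIV"
proof -
  let ?a = "fourier f"
  have S: "(\<lambda>(p, q). m (k - q) * (?a p * cnj (?a (p + q - k)) * ?a q)) summable_on UNIV \<times> UNIV"
    using tri_summable[OF m small] by (simp add: tri_def)
  have "infsum (tri m k ?a) UNIV = infsum (\<lambda>(p, q). m (k - q) * (?a p * cnj (?a (p + q - k)) * ?a q)) (UNIV \<times> UNIV)"
    by (simp add: tri_def)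
  also have "\<dots> = (\<Sum>\<^sub>\<infinity>p. \<Sum>\<^sub>\<infinity>q. m (k - q) * (?a p * cnj (?a (p + q - k)) * ?a q))"
    using infsum_Sigma'_banach[OF S] by simp
  also have "\<dots> = (\<Sum>\<^sub>\<infinity>q. \<Sum>\<^sub>\<infinity>p. m (k - q) * (?a p * cnj (?a (p + q - k)) * ?a q))"
    by (rule infsum_swap_banach[OF S])
  finally have eq: "infsum (tri m k ?a) UNIV = (\<Sum>\<^sub>\<infinity>q. \<Sum>\<^sub>\<infinity>p. m (k - q) * (?a p * cnj (?a (p + q - k)) * ?a q))" .
  have "m (k - q) * fourier (\<lambda>x. complex_of_real ((cmod (f x))\<^sup>2)) (k - q) * ?a q
     = c0 * (\<Sum>\<^sub>\<infinity>p. m (k - q) * (?a p * cnj (?a (p + q - k)) * ?a q))" for q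
  proof -
    have "(\<Sum>\<^sub>\<infinity>p. m (k - q) * (?a p * cnj (?a (p + q - k)) * ?a q))
       = (\<Sum>\<^sub>\<infinity>p. (m (k - q) * ?a q) * (?a p * cnj (?a (p - (k - q)))))"
      by (intro infsum_cong) (simp add: algebra_simps)
    also have "\<dots> = (m (k - q) * ?a q) * (\<Sum>\<^sub>\<infinity>p. ?a p * cnj (?a (p - (k - q))))"
      by (rule infsum_cmult_right')
    finally show ?thesis unfolding fourier_square by (simp add: mult_ac)
  qed
  then have "(\<Sum>\<^sub>\<infinity>q. m (k - q) * fourier (\<lambda>x. complex_of_real ((cmod (f x))\<^sup>2)) (k - q) * ?a q)
     = (\<Sum>\<^sub>\<infinity>q. c0 * (\<Sum>\<^sub>\<infinity>p. m (k - q) * (?a p * cnj (?a (p + q - k)) * ?a q)))"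
    by (intro infsum_cong)
  also have "\<dots> = c0 * (\<Sum>\<^sub>\<infinity>q. \<Sum>\<^sub>\<infinity>p. m (k - q) * (?a p * cnj (?a (p + q - k)) * ?a q))"
    by (rule infsum_cmult_right')
  finally show ?thesis unfolding eq .
qed

lemma fourier_cubic:
  assumes "integrable circ (\<lambda>x. complex_of_real ((cmod (f x))\<^sup>2))"
  shows "fourier (\<lambda>x. complex_of_real ((cmod (f x))\<^sup>2) * f x) k = infsum (tri (\<lambda>_. 1) k (fourier f)) UNIV / (2 * pi)"
proof -
  let ?c = "fourier (\<lambda>x. complex_of_real ((cmod (f x))\<^sup>2))"
  have one: "cmod 1 \<le> 1 * (J k + \<bar>real_of_int q\<bar>)" for q
    by (simp add: jap_def)
  have "(\<lambda>x. complex_of_real ((cmod (f x))\<^sup>2) * f x) = (\<lambda>x. f x * complex_of_real ((cmod (f x))\<^sup>2))"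
    by (rule ext, rule mult.commute)
  then have "fourier (\<lambda>x. complex_of_real ((cmod (f x))\<^sup>2) * f x) k = fourier (\<lambda>x. f x * complex_of_real ((cmod (f x))\<^sup>2)) k"
    by (rule arg_cong)
  also have "\<dots> = c0 * (\<Sum>\<^sub>\<infinity>q. fourier f q * ?c (k - q))"
    by (rule fourier_mult(2)[OF assms])
  also have "(\<Sum>\<^sub>\<infinity>q. fourier f q * ?c (k - q)) = (\<Sum>\<^sub>\<infinity>q. 1 * ?c (k - q) * fourier f q)"
    by (intro infsum_cong) (simp only: mult_1_left mult.commute[of "fourier f _"])
  also have "\<dots> = c0 * infsum (tri (\<lambda>_. 1) k (fourier f)) UNIV"
    by (rule tri_iterated[where m = "\<lambda>_. 1", OF one])
  also have "c0 * (c0 * infsum (tri (\<lambda>_. 1) k (fourier f)) UNIV) = infsum (tri (\<lambda>_. 1) k (fourier f)) UNIV / (2 * pi)"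
    unfolding mult.assoc[symmetric] c0_sq by simp
  finally show ?thesis .
qed

text \<open>Because the pairing is bilinear with index \<open>- j\<close>, testing with the
  character \<open>- k\<close> produces \<open>fourier f (k - j)\<close>; the substitution
  \<open>j = k - q\<close> gives the cubic sum with multiplier \<open>k - q\<close>.\<close>

lemma pairing_tri:
  "hs_pairing (dist_deriv (fourier (\<lambda>x. complex_of_real ((cmod (f x))\<^sup>2)))) (fourier (\<lambda>x. f x * (X * emode (- k) x)))
    = X * (\<i> * c0 * infsum (tri of_int k (fourier f)) UNIV)"
proof -
  let ?c = "fourier (\<lambda>x. complex_of_real ((cmod (f x))\<^sup>2))"
  have "fourier (\<lambda>x. f x * (X * emode (- k) x)) (- j) = X * fourier f (k - j)" for j
  proof -
    have "emode (- (- j)) x * (f x * (X * emode (- k) x)) = X * (emode (- (k - j)) x * f x)" for x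
    proof -
      have "emode (- (k - j)) x = emode j x * emode (- k) x"
        unfolding emode_add[symmetric] by simp
      then show ?thesis by simp
    qed
    then have "integral\<^sup>L circ (\<lambda>x. emode (- (- j)) x * (f x * (X * emode (- k) x))) =
        X * integral\<^sup>L circ (\<lambda>x. emode (- (k - j)) x * f x)"
      by (simp only: integral_mult_right_zero)
    then show ?thesis unfolding fourier_emode by simp
  qed
  then have "hs_pairing (dist_deriv ?c) (fourier (\<lambda>x. f x * (X * emode (- k) x)))
     = (\<Sum>\<^sub>\<infinity>j. (X * \<i>) * (of_int j * ?c j * fourier f (k - j)))"
    unfolding hs_pairing_def dist_deriv_def by (simp add: mult_ac)
  also have "\<dots> = (X * \<i>) * (\<Sum>\<^sub>\<infinity>j. of_int j * ?c j * fourier f (k - j))"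
    by (rule infsum_cmult_right')
  also have "(\<Sum>\<^sub>\<infinity>j. of_int j * ?c j * fourier f (k - j)) = (\<Sum>\<^sub>\<infinity>q. of_int (k - q) * ?c (k - q) * fourier f q)"
  proof -
    have "bij (\<lambda>q. k - q)" by (rule o_bij[of "\<lambda>q. k - q"]) auto
    then have r: "range (\<lambda>q. k - q) = UNIV" "inj (\<lambda>q. k - q)" by (auto simp: bij_def)
    have "(\<Sum>\<^sub>\<infinity>j\<in>range (\<lambda>q. k - q). of_int j * ?c j * fourier f (k - j)) = (\<Sum>\<^sub>\<infinity>q. of_int (k - q) * ?c (k - q) * fourier f q)"
      by (subst infsum_reindex[OF r(2)]) (simp add: o_def)
    then show ?thesis by (simp only: r)
  qed
  also have "\<dots> = c0 * infsum (tri of_int k (fourier f)) UNIV"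
    by (rule tri_iterated[where K = 1]) (use J_pos[of k] in \<open>auto simp: less_imp_le\<close>)
  finally show ?thesis by (simp add: mult_ac)
qed

end

section \<open>Testing an evolution equation in time\<close>

text \<open>The derivative of \<open>p(1/y) exp (-1/y)\<close> is
  \<open>(1/y)^2 (p - p')(1/y) exp (-1/y)\<close>.\<close>

fun bump_poly :: "nat \<Rightarrow> real poly" where
  "bump_poly 0 = 1"
| "bump_poly (Suc m) = [:0, 0, 1:] * (bump_poly m - pderiv (bump_poly m))"

text \<open>The \<open>m\<close>-th derivative of \<open>exp (- 1 / y)\<close>, extended by 0 to the negative axis.\<close>

definition bump :: "nat \<Rightarrow> real \<Rightarrow> real" where
  "bump m y = (if 0 < y then poly (bump_poly m) (1 / y) * exp (- (1 / y)) else 0)"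

lemma poly_exp_tendsto_0: "((\<lambda>s. poly p s * exp (- s)) \<longlongrightarrow> (0::real)) at_top"
proof -
  have "((\<lambda>s. \<Sum>i\<le>degree p. coeff p i * (s ^ i / exp s)) \<longlongrightarrow> (\<Sum>i\<le>degree p. coeff p i * 0)) at_top"
    by (intro tendsto_intros tendsto_power_div_exp_0)
  moreover have "poly p s * exp (- s) = (\<Sum>i\<le>degree p. coeff p i * (s ^ i / exp s))" for s
    unfolding poly_altdef by (simp add: sum_distrib_right exp_minus divide_inverse mult.assoc)
  ultimately show ?thesis by simp
qed

lemma bump_poly_right_tendsto_0: "((\<lambda>h. poly p (1 / h) * exp (- (1 / h))) \<longlongrightarrow> (0::real)) (at_right 0)"
proof -
  have "filterlim (\<lambda>h. 1 / h :: real) at_top (at_right 0)"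
    using filterlim_inverse_at_top_right by (simp add: inverse_eq_divide)
  from filterlim_compose[OF poly_exp_tendsto_0 this] show ?thesis .
qed

lemma bump_derivative: "(bump m has_real_derivative bump (Suc m) y) (at y)"
proof -
  consider "0 < y" | "y < 0" | "y = 0" by linarith
  then show ?thesis
  proof cases
    case 1
    let ?p = "bump_poly m"
    have "((\<lambda>y. poly ?p (1 / y) * exp (- (1 / y))) has_real_derivative
       (poly (pderiv ?p) (1 / y) * (- (1 / y\<^sup>2))) * exp (- (1 / y)) + exp (- (1 / y)) * (1 / y\<^sup>2) * poly ?p (1 / y)) (at y)"
    proof (rule DERIV_mult)
      have inv: "((\<lambda>y. 1 / y) has_real_derivative - (1 / y\<^sup>2)) (at y)"
        using 1 by (auto intro!: derivative_eq_intros simp: power2_eq_square)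
      show "((\<lambda>y. poly ?p (1 / y)) has_real_derivative poly (pderiv ?p) (1 / y) * (- (1 / y\<^sup>2))) (at y)"
        by (rule DERIV_chain2[OF poly_DERIV inv])
      show "((\<lambda>y. exp (- (1 / y))) has_real_derivative exp (- (1 / y)) * (1 / y\<^sup>2)) (at y)"
        using DERIV_chain2[OF DERIV_exp DERIV_minus[OF inv]] by simp
    qed
    moreover have "(poly (pderiv ?p) (1 / y) * (- (1 / y\<^sup>2))) * exp (- (1 / y)) + exp (- (1 / y)) * (1 / y\<^sup>2) * poly ?p (1 / y)
        = bump (Suc m) y"
      using 1 by (simp add: bump_def power2_eq_square field_simps)
    ultimately have "((\<lambda>y. poly ?p (1 / y) * exp (- (1 / y))) has_real_derivative bump (Suc m) y) (at y)" by simp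
    then show ?thesis
      by (rule has_field_derivative_transform_within_open[of _ _ _ "{0<..}"]) (use 1 in \<open>auto simp: bump_def\<close>)
  next
    case 2
    have "((\<lambda>_. 0) has_real_derivative 0) (at y)" by simp
    then have "(bump m has_real_derivative 0) (at y)"
      by (rule has_field_derivative_transform_within_open[of _ _ _ "{..<0}"]) (use 2 in \<open>auto simp: bump_def\<close>)
    then show ?thesis using 2 by (simp add: bump_def)
  next
    case 3
    have "((\<lambda>h. (bump m (0 + h) - bump m 0) / h) \<longlongrightarrow> 0) (at_left 0)"
      by (rule tendsto_eventually) (auto simp: bump_def eventually_at_filter)
    moreover have "((\<lambda>h. (bump m (0 + h) - bump m 0) / h) \<longlongrightarrow> 0) (at_right 0)"
    proof (rule Lim_transform_eventually)
      \<comment> \<open>\<open>pCons 0\<close> multiplies the polynomial by \<open>1 / h\<close>,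
        which absorbs the denominator of the difference quotient.\<close>
      show "((\<lambda>h. poly (pCons 0 (bump_poly m)) (1 / h) * exp (- (1 / h))) \<longlongrightarrow> 0) (at_right 0)"
        by (rule bump_poly_right_tendsto_0)
      show "\<forall>\<^sub>F h in at_right 0. poly (pCons 0 (bump_poly m)) (1 / h) * exp (- (1 / h)) = (bump m (0 + h) - bump m 0) / h"
        by (auto simp: bump_def eventually_at_filter)
    qed
    ultimately have "((\<lambda>h. (bump m (0 + h) - bump m 0) / h) \<longlongrightarrow> 0) (at 0)"
      by (simp add: filterlim_split_at)
    then show ?thesis using 3 by (simp add: DERIV_def bump_def)
  qed
qed

lemma continuous_on_bump: "continuous_on S (bump m)"
  by (meson DERIV_continuous_on bump_derivative has_field_derivative_at_within)

lemma bump_0_bounds: "0 \<le> bump 0 y" "bump 0 y \<le> 1"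
  by (auto simp: bump_def)

lemma bump_1_nonneg: "0 \<le> bump 1 y"
  by (auto simp: bump_def)

lemma bump_nonpos: "y \<le> 0 \<Longrightarrow> bump m y = 0"
  by (simp add: bump_def)

lemma bump_tendsto_1: "0 < d \<Longrightarrow> (\<lambda>n. bump 0 (real n * d)) \<longlonglongrightarrow> 1"
proof -
  assume d: "0 < d"
  have "(\<lambda>n. exp (- (1 / d * (1 / real n)))) \<longlonglongrightarrow> exp (- (1 / d * 0))"
    by (intro tendsto_intros lim_1_over_n)
  moreover have "\<forall>\<^sub>F n in sequentially. exp (- (1 / d * (1 / real n))) = bump 0 (real n * d)"
    using eventually_gt_at_top[of 0] by eventually_elim (use d in \<open>simp add: bump_def mult.commute\<close>)
  ultimately show ?thesis by (simp add: Lim_transform_eventually)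
qed

text \<open>As \<open>n\<close> tends to infinity, the cutoffs \<open>bump 0 (n (c - t))\<close> tend to the indicator of \<open>t < c\<close>, and \<open>spike n c\<close>,
  which is minus their time derivative, to the Dirac mass at \<open>c\<close>.\<close>

definition spike :: "nat \<Rightarrow> real \<Rightarrow> real \<Rightarrow> real" where
  "spike n c t = real n * bump 1 (real n * (c - t))"

lemma continuous_on_spike: "continuous_on S (spike n c)"
  unfolding spike_def by (intro continuous_intros continuous_on_compose2[OF continuous_on_bump[of UNIV]]) auto

lemma continuous_on_cutoff: "continuous_on S (\<lambda>t. bump m (real n * (c - t)))"
  by (intro continuous_intros continuous_on_compose2[OF continuous_on_bump[of UNIV]]) auto

lemma spike_nonneg: "0 \<le> spike n c t"
  unfolding spike_def using bump_1_nonneg by simp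

lemma cutoff_derivative: "((\<lambda>t. bump m (real n * (c - t))) has_real_derivative (- (real n * bump (Suc m) (real n * (c - t))))) (at t)"
proof -
  have "((\<lambda>t. real n * (c - t)) has_real_derivative - real n) (at t)"
    by (auto intro!: derivative_eq_intros)
  from DERIV_chain2[OF bump_derivative this] show ?thesis by (simp add: mult.commute)
qed

lemma spike_integral: "a \<le> b \<Longrightarrow> integral {a..b} (spike n c) = bump 0 (real n * (c - a)) - bump 0 (real n * (c - b))"
proof -
  assume ab: "a \<le> b"
  have "(spike n c has_integral (- bump 0 (real n * (c - b)) - - bump 0 (real n * (c - a)))) {a..b}"
  proof (rule fundamental_theorem_of_calculus[OF ab])
    fix t
    have "((\<lambda>t. - bump 0 (real n * (c - t))) has_real_derivative spike n c t) (at t)"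
      using DERIV_minus[OF cutoff_derivative[of 0 n c t]] by (simp add: spike_def)
    then show "((\<lambda>t. - bump 0 (real n * (c - t))) has_vector_derivative spike n c t) (at t within {a..b})"
      by (simp add: has_real_derivative_iff_has_vector_derivative has_vector_derivative_at_within)
  qed
  then show ?thesis by (simp add: integral_unique)
qed

text \<open>The mass of the spike on \<open>{0..c}\<close> tends to 1, while its mass on
  \<open>{0..c - d}\<close> is a difference of two quantities tending to 1. So
  \<open>g - g c\<close> matters only near \<open>c\<close>, where it is small.\<close>

lemma spike_concentrates:
  fixes g :: "real \<Rightarrow> complex"
  assumes c: "0 < c" and g: "continuous_on {0..c} g"
  shows "(\<lambda>n. integral {0..c} (\<lambda>t. spike n c t * g t)) \<longlonglongrightarrow> g c"
proof -
  have int: "(\<lambda>t. spike n c t * h t) integrable_on {a..b}" if "continuous_on {0..c} h" "0 \<le> a" "b \<le> c"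
    for n a b and h :: "real \<Rightarrow> complex"
    using that by (intro integrable_continuous_real continuous_intros continuous_on_spike) (auto elim: continuous_on_subset)
  have ints: "spike n c integrable_on {a..b}" for n a b
    by (intro integrable_continuous_real continuous_on_spike)
  obtain B where B: "\<And>t. t \<in> {0..c} \<Longrightarrow> cmod (g t) \<le> B"
    using compact_continuous_image[OF g] by (metis bounded_iff compact_Icc compact_imp_bounded imageI)
  have B0: "0 \<le> B" using B[of 0] c by (meson atLeastAtMost_iff less_imp_le norm_ge_zero order_refl order_trans)
  define h where "h t = g t - g c" for t
  have hc: "continuous_on {0..c} h" unfolding h_def by (intro continuous_intros g)
  have bound: "cmod (integral {0..c} (\<lambda>t. spike n c t * h t)) \<le>
      2 * B * (bump 0 (real n * c) - bump 0 (real n * d)) + e"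
    if d: "0 < d" "d \<le> c" and e: "\<And>t. t \<in> {c - d..c} \<Longrightarrow> cmod (h t) \<le> e" for n d e
  proof -
    have e0: "0 \<le> e" using e[of c] d by (auto simp: h_def)
    have "integral {0..c} (\<lambda>t. spike n c t * h t) =
        integral {0..c - d} (\<lambda>t. spike n c t * h t) + integral {c - d..c} (\<lambda>t. spike n c t * h t)"
      using d by (intro Henstock_Kurzweil_Integration.integral_combine[symmetric] int hc) auto
    moreover have "cmod (integral {0..c - d} (\<lambda>t. spike n c t * h t)) \<le> integral {0..c - d} (\<lambda>t. 2 * B * spike n c t)"
    proof (rule integral_norm_bound_integral)
      show "(\<lambda>t. spike n c t * h t) integrable_on {0..c - d}" using d by (intro int hc) auto
      show "(\<lambda>t. 2 * B * spike n c t) integrable_on {0..c - d}" using integrable_cmul[OF ints, of "2 * B"] by simp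
      fix t assume "t \<in> {0..c - d}"
      then have "cmod (h t) \<le> B + B" unfolding h_def using B[of t] B[of c] c d by (intro norm_triangle_le_diff) auto
      then have "spike n c t * cmod (h t) \<le> spike n c t * (2 * B)" using spike_nonneg by (intro mult_left_mono) auto
      then show "cmod (spike n c t * h t) \<le> 2 * B * spike n c t"
        using spike_nonneg[of n c t] by (simp add: norm_mult mult.commute)
    qed
    moreover have "integral {0..c - d} (\<lambda>t. 2 * B * spike n c t) = 2 * B * (bump 0 (real n * c) - bump 0 (real n * d))"
      using d spike_integral[of 0 "c - d" n c] by simp
    moreover have "cmod (integral {c - d..c} (\<lambda>t. spike n c t * h t)) \<le> integral {c - d..c} (\<lambda>t. e * spike n c t)"
    proof (rule integral_norm_bound_integral)
      show "(\<lambda>t. spike n c t * h t) integrable_on {c - d..c}" using d by (intro int hc) auto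
      show "(\<lambda>t. e * spike n c t) integrable_on {c - d..c}" using integrable_cmul[OF ints, of e] by simp
      fix t assume "t \<in> {c - d..c}"
      then have "spike n c t * cmod (h t) \<le> spike n c t * e" using spike_nonneg e by (intro mult_left_mono) auto
      then show "cmod (spike n c t * h t) \<le> e * spike n c t"
        using spike_nonneg[of n c t] by (simp add: norm_mult mult.commute)
    qed
    moreover have "integral {c - d..c} (\<lambda>t. e * spike n c t) \<le> e"
      using d e0 spike_integral[of "c - d" c n c] bump_0_bounds[of "real n * d"] by (simp add: bump_nonpos mult_left_le)
    ultimately show ?thesis by (smt (verit) norm_triangle_ineq)
  qed
  have "(\<lambda>n. integral {0..c} (\<lambda>t. spike n c t * h t)) \<longlonglongrightarrow> 0"
  proof (rule LIMSEQ_I)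
    fix r :: real assume r: "0 < r"
    have "(h \<longlongrightarrow> h c) (at c within {0..c})" using hc c by (simp add: continuous_on)
    then have "\<forall>\<^sub>F t in at c within {0..c}. dist (h t) (h c) < r / 2" using r by (intro tendstoD) auto
    then obtain d0 where d0: "0 < d0" "\<And>t. t \<in> {0..c} \<Longrightarrow> t \<noteq> c \<Longrightarrow> dist t c < d0 \<Longrightarrow> cmod (h t) < r / 2"
      unfolding eventually_at by (auto simp: h_def)
    define d where "d = min c (d0 / 2)"
    have d: "0 < d" "d \<le> c" "d < d0" using c d0 by (auto simp: d_def)
    have e: "cmod (h t) \<le> r / 2" if "t \<in> {c - d..c}" for t
    proof (cases "t = c")
      case False
      then show ?thesis using d0(2)[of t] that d by (auto simp: dist_real_def)
    qed (use r in \<open>simp add: h_def\<close>)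
    have "(\<lambda>n. 2 * B * (bump 0 (real n * c) - bump 0 (real n * d)) + r / 2) \<longlonglongrightarrow> 2 * B * (1 - 1) + r / 2"
      by (intro tendsto_intros bump_tendsto_1 c d)
    then have "\<forall>\<^sub>F n in sequentially. 2 * B * (bump 0 (real n * c) - bump 0 (real n * d)) + r / 2 < r"
      by (rule order_tendstoD) (use r in auto)
    then have "\<forall>\<^sub>F n in sequentially. cmod (integral {0..c} (\<lambda>t. spike n c t * h t) - 0) < r"
      by eventually_elim (use bound[OF d(1,2) e] in \<open>auto intro: le_less_trans\<close>)
    then show "\<exists>no. \<forall>n\<ge>no. cmod (integral {0..c} (\<lambda>t. spike n c t * h t) - 0) < r"
      by (simp add: eventually_sequentially)
  qed
  moreover have "(\<lambda>n. bump 0 (real n * c) * g c) \<longlonglongrightarrow> 1 * g c"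
  proof -
    have "(\<lambda>n. complex_of_real (bump 0 (real n * c)) * g c) \<longlonglongrightarrow> complex_of_real 1 * g c"
      by (intro tendsto_intros bump_tendsto_1 c)
    then show ?thesis by simp
  qed
  ultimately have "(\<lambda>n. integral {0..c} (\<lambda>t. spike n c t * h t) + bump 0 (real n * c) * g c) \<longlonglongrightarrow> 0 + 1 * g c"
    by (rule tendsto_add)
  moreover have "integral {0..c} (\<lambda>t. spike n c t * h t) + bump 0 (real n * c) * g c = integral {0..c} (\<lambda>t. spike n c t * g t)" for n
  proof -
    have "integral {0..c} (\<lambda>t. complex_of_real (spike n c t)) = complex_of_real (integral {0..c} (spike n c))"
      using integral_linear[OF ints bounded_linear_of_real, of 0 c n] by (simp add: o_def)
    also have "integral {0..c} (spike n c) = bump 0 (real n * c)"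
      using spike_integral[of 0 c n c] c by (simp add: bump_nonpos)
    finally have "bump 0 (real n * c) * g c = integral {0..c} (\<lambda>t. complex_of_real (spike n c t) * g c)" by simp
    moreover have "integral {0..c} (\<lambda>t. spike n c t * h t + spike n c t * g c) =
        integral {0..c} (\<lambda>t. spike n c t * h t) + integral {0..c} (\<lambda>t. spike n c t * g c)"
      by (rule Henstock_Kurzweil_Integration.integral_add) (intro int hc continuous_intros; simp)+
    moreover have "(\<lambda>t. spike n c t * h t + spike n c t * g c) = (\<lambda>t. spike n c t * g t)"
      by (simp add: h_def algebra_simps)
    ultimately show ?thesis by simp
  qed
  ultimately show ?thesis by simp
qed

text \<open>Sharpening the cutoff turns the weak identity into the equation integrated from 0 to
  \<open>c\<close>, with the weak initial value \<open>z\<close> as constant.\<close>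

lemma weak_ode_integrated:
  fixes g F :: "real \<Rightarrow> complex" and z :: complex
  assumes c: "0 < c" and g: "continuous_on {0..c} g" and F: "continuous_on {0..c} F"
    and weak: "\<And>n. integral {0..c} (\<lambda>t. spike n c t * g t) - bump 0 (real n * c) * z =
       integral {0..c} (\<lambda>t. bump 0 (real n * (c - t)) * F t)"
  shows "g c = z + integral {0..c} F"
proof -
  have lim1: "(\<lambda>n. integral {0..c} (\<lambda>t. spike n c t * g t) - bump 0 (real n * c) * z) \<longlonglongrightarrow> g c - complex_of_real 1 * z"
    by (intro tendsto_intros spike_concentrates bump_tendsto_1 c g)
  have lim2: "(\<lambda>n. integral {0..c} (\<lambda>t. bump 0 (real n * (c - t)) * F t)) \<longlonglongrightarrow> integral {0..c} (\<lambda>t. if t = c then 0 else F t)"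
  proof (rule dominated_convergence(2))
    show "(\<lambda>t. bump 0 (real n * (c - t)) * F t) integrable_on {0..c}" for n
      by (intro integrable_continuous_real continuous_intros continuous_on_cutoff F)
    show "(\<lambda>t. cmod (F t)) integrable_on {0..c}"
      by (intro integrable_continuous_real continuous_intros F)
    show "cmod (bump 0 (real n * (c - t)) * F t) \<le> cmod (F t)" for n t
      using bump_0_bounds[of "real n * (c - t)"] by (simp add: norm_mult mult_left_le_one_le)
    \<comment> \<open>At \<open>t = c\<close> every cutoff vanishes, so the limit there is 0 instead
      of \<open>F c\<close>.\<close>
    show "(\<lambda>n. bump 0 (real n * (c - t)) * F t) \<longlonglongrightarrow> (if t = c then 0 else F t)" if "t \<in> {0..c}" for t
    proof (cases "t = c")
      case False
      then have "0 < c - t" using that by auto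
      then have "(\<lambda>n. complex_of_real (bump 0 (real n * (c - t))) * F t) \<longlonglongrightarrow> complex_of_real 1 * F t"
        by (intro tendsto_intros bump_tendsto_1)
      then show ?thesis using False by simp
    qed (simp add: bump_nonpos)
  qed
  have "integral {0..c} (\<lambda>t. if t = c then 0 else F t) = integral {0..c} F"
    by (rule Henstock_Kurzweil_Integration.integral_spike[of "{c}"]) auto
  with LIMSEQ_unique[OF lim1[unfolded weak] lim2] have "g c - z = integral {0..c} F" by simp
  then show ?thesis by (simp add: algebra_simps)
qed

section \<open>Time integrals in both time directions\<close>

lemma lebesgue_integral_half_open:
  fixes H :: "real \<Rightarrow> complex"
  assumes H: "continuous_on {a..b} H" and I: "I \<in> sets lebesgue" "I \<subseteq> {a..b}" "{a..b} - I \<subseteq> {a, b}"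
  shows "(LINT t|lebesgue_on I. H t) = integral {a..b} H"
proof -
  have "set_integrable lebesgue {a..b} H" using H by (rule absolutely_integrable_continuous_real)
  then have "set_integrable lebesgue I H" by (rule set_integrable_subset) (use I in auto)
  then have "integrable (lebesgue_on I) H" using I(1) by (simp add: integrable_restrict_space set_integrable_def)
  then have "(LINT t|lebesgue_on I. H t) = integral I H" using I(1) by (rule lebesgue_integral_eq_integral)
  also have "\<dots> = integral {a..b} H"
  proof (rule integral_spike_set)
    show "negligible {x \<in> I - {a..b}. H x \<noteq> 0}"
      by (rule negligible_subset[of "{}"]) (use I(2) in auto)
    show "negligible {x \<in> {a..b} - I. H x \<noteq> 0}"
      by (rule negligible_subset[of "{a, b}"]) (use I(3) in auto)
  qed
  finally show ?thesis .
qed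

text \<open>With \<open>\<sigma>\<close> equal to 1 or -1 both directions are handled at once: every
  time is written \<open>\<sigma> * t\<close> with \<open>t\<close> running forwards from 0.\<close>

definition time_interval :: "real \<Rightarrow> real \<Rightarrow> real set" where
  "time_interval \<sigma> \<tau> = (\<lambda>t. \<sigma> * t) ` {0..<\<tau>}"

lemma time_interval_forward: "time_interval 1 \<tau> = {0..<\<tau>}"
  by (simp add: time_interval_def)

lemma time_interval_backward: "time_interval (- 1) \<tau> = {-\<tau><..0}"
proof -
  have "x \<in> (\<lambda>t. - 1 * t) ` {0..<\<tau>}" if "x \<in> {-\<tau><..0}" for x
    using that by (intro image_eqI[of _ _ "- x"]) auto
  then show ?thesis by (auto simp: time_interval_def)
qed

lemma lebesgue_integral_time:
  fixes H :: "real \<Rightarrow> complex"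
  assumes \<sigma>: "\<sigma> = 1 \<or> \<sigma> = - 1" and H: "continuous_on {0..\<tau>} (\<lambda>t. H (\<sigma> * t))"
  shows "(LINT t|lebesgue_on (time_interval \<sigma> \<tau>). H t) = integral {0..\<tau>} (\<lambda>t. H (\<sigma> * t))"
  using \<sigma>
proof
  assume [simp]: "\<sigma> = 1"
  show ?thesis using H by (simp add: time_interval_forward) (rule lebesgue_integral_half_open; auto)
next
  assume \<sigma>m: "\<sigma> = - 1"
  have "continuous_on {-\<tau>..0} (\<lambda>t. H (\<sigma> * (- t)))"
    by (rule continuous_on_compose2[OF H]) (auto intro!: continuous_intros)
  then have "continuous_on {-\<tau>..0} H" by (simp add: \<sigma>m)
  then have "(LINT t|lebesgue_on {-\<tau><..0}. H t) = integral {-\<tau>..0} H"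
    by (rule lebesgue_integral_half_open) auto
  also have "\<dots> = integral {0..\<tau>} (\<lambda>t. H (- t))"
    using Henstock_Kurzweil_Integration.integral_reflect_real[of 0 "- \<tau>" H] by simp
  finally show ?thesis by (simp only: \<sigma>m time_interval_backward) simp
qed

section \<open>The equation for the Fourier modes\<close>

lemma emode_has_vector_derivative: "(emode k has_vector_derivative \<i> * of_int k * emode k x) (at x within S)"
proof -
  have "((\<lambda>x. emode k (of_real x)) has_vector_derivative \<i> * of_int k * emode k x) (at x within S)"
    unfolding emode_def
    by (auto intro!: derivative_eq_intros has_vector_derivative_real_field)
  then show ?thesis by simp
qed

text \<open>The time factor vanishes from \<open>\<sigma> * t = c\<close> on, which gives compact
  support in the half-open interval without vanishing at time 0. The character \<open>- k\<close>
  extracts the \<open>k\<close>-th coefficient.\<close>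

definition mode_test :: "real \<Rightarrow> nat \<Rightarrow> real \<Rightarrow> int \<Rightarrow> real \<Rightarrow> real \<Rightarrow> complex" where
  "mode_test \<sigma> n c k t x = complex_of_real (bump 0 (real n * (c - \<sigma> * t))) * emode (- k) x"

lemma cutoff_time_derivative:
  "((\<lambda>t. bump m (real n * (c - \<sigma> * t))) has_real_derivative (- (real n * \<sigma>) * bump (Suc m) (real n * (c - \<sigma> * t)))) (at t)"
proof -
  have "((\<lambda>t. real n * (c - \<sigma> * t)) has_real_derivative - (real n * \<sigma>)) (at t)"
    by (auto intro!: derivative_eq_intros)
  from DERIV_chain2[OF bump_derivative this] show ?thesis by (simp add: mult.commute)
qed

lemma smooth2_mode_test: "smooth2 (mode_test \<sigma> n c k)"
proof -
  define D :: "nat \<Rightarrow> nat \<Rightarrow> real \<Rightarrow> real \<Rightarrow> complex" where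
    "D m j t x = complex_of_real ((- (real n * \<sigma>)) ^ m * bump m (real n * (c - \<sigma> * t))) *
        ((\<i> * of_int (- k)) ^ j * emode (- k) x)" for m j t x
  show ?thesis unfolding smooth2_def
  proof (intro exI[of _ D] conjI allI)
    show "D 0 0 = mode_test \<sigma> n c k" by (auto simp: D_def mode_test_def fun_eq_iff)
    fix m j
    show "continuous_on UNIV (\<lambda>(t, x). D m j t x)"
      unfolding D_def case_prod_beta
      by (intro continuous_intros continuous_on_compose2[OF continuous_on_bump[of UNIV]]
          continuous_on_compose2[OF continuous_on_emode[of UNIV]]) auto
    fix t x
    show "((\<lambda>t'. D m j t' x) has_vector_derivative D (Suc m) j t x) (at t)"
    proof -
      have "((\<lambda>t. (- (real n * \<sigma>)) ^ m * bump m (real n * (c - \<sigma> * t))) has_real_derivative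
          (- (real n * \<sigma>)) ^ m * (- (real n * \<sigma>) * bump (Suc m) (real n * (c - \<sigma> * t)))) (at t)"
        by (rule DERIV_cmult[OF cutoff_time_derivative])
      also have "(- (real n * \<sigma>)) ^ m * (- (real n * \<sigma>) * bump (Suc m) (real n * (c - \<sigma> * t))) =
          (- (real n * \<sigma>)) ^ Suc m * bump (Suc m) (real n * (c - \<sigma> * t))" by simp
      finally show ?thesis
        unfolding D_def by (intro has_vector_derivative_mult_left has_vector_derivative_of_real)
    qed
    have "(emode (- k) has_vector_derivative \<i> * of_int (- k) * emode (- k) x) (at x)"
      by (rule emode_has_vector_derivative)
    then have "((\<lambda>x. (\<i> * of_int (- k)) ^ j * emode (- k) x) has_vector_derivative
        (\<i> * of_int (- k)) ^ j * (\<i> * of_int (- k) * emode (- k) x)) (at x)"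
      by (rule has_vector_derivative_mult_right)
    also have "(\<i> * of_int (- k)) ^ j * (\<i> * of_int (- k) * emode (- k) x) = (\<i> * of_int (- k)) ^ Suc j * emode (- k) x"
      by simp
    finally show "(D m j t has_vector_derivative D m (Suc j) t x) (at x)"
      unfolding D_def[abs_def] by (rule has_vector_derivative_mult_right)
  qed
qed

lemma dt_mode_test:
  "dt (mode_test \<sigma> n c k) t x = complex_of_real (- (\<sigma> * spike n c (\<sigma> * t))) * emode (- k) x"
proof -
  have "((\<lambda>t'. mode_test \<sigma> n c k t' x) has_vector_derivative
      complex_of_real (- (real n * \<sigma>) * bump (Suc 0) (real n * (c - \<sigma> * t))) * emode (- k) x) (at t)"
    unfolding mode_test_def
    by (rule has_vector_derivative_mult_left[OF has_vector_derivative_of_real[OF cutoff_time_derivative]])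
  from vector_derivative_at[OF this] show ?thesis
    unfolding dt_def by (simp add: spike_def mult_ac)
qed

text \<open>The free factor \<open>C\<close> makes the rule iterable.\<close>

lemma dx_mode_test:
  "dx (\<lambda>t x. C * mode_test \<sigma> n c k t x) = (\<lambda>t x. (C * - (\<i> * of_int k)) * mode_test \<sigma> n c k t x)"
proof (intro ext)
  fix t x
  have "(emode (- k) has_vector_derivative \<i> * of_int (- k) * emode (- k) x) (at x)"
    by (rule emode_has_vector_derivative)
  from has_vector_derivative_mult_right[OF this, of "C * complex_of_real (bump 0 (real n * (c - \<sigma> * t)))"]
  have "((\<lambda>x. C * mode_test \<sigma> n c k t x) has_vector_derivative (C * - (\<i> * of_int k)) * mode_test \<sigma> n c k t x) (at x)"
    by (simp add: mode_test_def mult_ac)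
  then show "dx (\<lambda>t x. C * mode_test \<sigma> n c k t x) t x = (C * - (\<i> * of_int k)) * mode_test \<sigma> n c k t x"
    unfolding dx_def by (rule vector_derivative_at)
qed

lemma dx_pow_mode_test:
  "(dx ^^ j) (mode_test \<sigma> n c k) = (\<lambda>t x. (- (\<i> * of_int k)) ^ j * mode_test \<sigma> n c k t x)"
proof (induction j)
  case (Suc j)
  show ?case by (simp only: funpow.simps o_apply Suc.IH dx_mode_test power_Suc2)
qed simp

lemma test_function_mode_test:
  assumes \<sigma>: "\<sigma> = 1 \<or> \<sigma> = - 1" and c: "0 < c" "c < \<tau>"
  shows "test_function (time_interval \<sigma> \<tau>) (mode_test \<sigma> n c k)"
  unfolding test_function_def
proof (intro conjI allI)
  show "smooth2 (mode_test \<sigma> n c k)" by (rule smooth2_mode_test)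
  show "periodic (mode_test \<sigma> n c k t)" for t
    unfolding periodic_def mode_test_def by (simp only: periodic_emode) simp
  show "\<exists>K. compact K \<and> K \<subseteq> time_interval \<sigma> \<tau> \<and> (\<forall>t\<in>time_interval \<sigma> \<tau> - K. \<forall>x. mode_test \<sigma> n c k t x = 0)"
  proof (intro exI[of _ "(\<lambda>t. \<sigma> * t) ` {0..c}"] conjI ballI allI)
    show "compact ((\<lambda>t. \<sigma> * t) ` {0..c})"
      by (intro compact_continuous_image continuous_intros) simp
    show "(\<lambda>t. \<sigma> * t) ` {0..c} \<subseteq> time_interval \<sigma> \<tau>"
      unfolding time_interval_def using c by (intro image_mono) auto
    fix t x assume "t \<in> time_interval \<sigma> \<tau> - (\<lambda>t. \<sigma> * t) ` {0..c}"
    then obtain r where "t = \<sigma> * r" "r \<in> {0..<\<tau>}" "r \<notin> {0..c}" unfolding time_interval_def by blast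
    then have r: "t = \<sigma> * r" "0 \<le> r" "\<not> r \<le> c" by auto
    have "\<sigma> * t = r" using \<sigma> r(1) by auto
    then have "real n * (c - \<sigma> * t) \<le> 0" using r(3) by (simp add: mult_nonneg_nonpos)
    then show "mode_test \<sigma> n c k t x = 0" by (simp add: mode_test_def bump_nonpos)
  qed
qed

lemma torus_integral_cmult: "torus_integral (\<lambda>x. C * f x) = C * torus_integral f"
  by (simp add: torus_integral_def)

lemma torus_integral_mode_test:
  "torus_integral (\<lambda>x. f x * (C * emode (- k) x)) = C * (complex_of_real (sqrt (2 * pi)) * fourier f k)"
proof -
  have "(\<lambda>x. f x * (C * emode (- k) x)) = (\<lambda>x. C * (f x * emode (- k) x))" by (simp add: mult_ac)
  then show ?thesis by (simp only: torus_integral_cmult torus_integral_emode)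
qed

text \<open>\<open>f\<close> agrees almost everywhere with a continuous function. Applied to
  \<open>w = |f|^2\<close>, this makes the cubic term integrable.\<close>

lemma integrable_mult_fourier:
  assumes f: "integrable circ f" and small: "small_l1 A (\<lambda>k. cmod (fourier f k))" and w: "integrable circ w"
  shows "integrable circ (\<lambda>x. w x * f x)"
proof -
  have I: "integrable circ (\<lambda>x. fourier_sum f x * w x)"
    by (rule integrable_circ_mult_continuous[OF w continuous_on_fourier_sum[OF f small]])
  have ae: "AE x in circ. fourier_sum f x * w x = w x * f x"
    using AE_fourier_sum[OF f small] by eventually_elim (simp add: mult.commute)
  have "(\<lambda>x. w x * f x) \<in> borel_measurable circ" using f w by measurable
  then show ?thesis using integrable_cong_AE[OF borel_measurable_integrable[OF I] _ ae] I by simp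
qed

lemma fourier_diff:
  assumes "integrable circ f" "integrable circ g"
  shows "fourier (\<lambda>x. f x - g x) k = fourier f k - fourier g k"
proof -
  have "integral\<^sup>L circ (\<lambda>x. emode (- k) x * (f x - g x)) =
      integral\<^sup>L circ (\<lambda>x. emode (- k) x * f x) - integral\<^sup>L circ (\<lambda>x. emode (- k) x * g x)"
    unfolding right_diff_distrib using assms by (intro Bochner_Integration.integral_diff integrable_circ_emode)
  then show ?thesis by (simp add: fourier_emode right_diff_distrib)
qed

section \<open>From the weak identity to the integrated mode equation\<close>

context raman
begin

text \<open>The weak identity delivers the two kinds of terms separately: for the first the
  multiplier does not depend on the summation indices, for the Raman term it is the frequency of
  \<open>|u|^2\<close>.\<close>

lemma nonlin_split:
  assumes x: "small_l1 A (\<lambda>l. cmod (x l))"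
  shows "nonlin k x = (\<i> * \<gamma>1 + \<i> * \<gamma>2 * of_int k) / (2 * pi) * infsum (tri (\<lambda>_. 1) k x) UNIV
     + \<Gamma> / (2 * pi) * infsum (tri of_int k x) UNIV"
proof -
  define c1 where "c1 = (\<i> * \<gamma>1 + \<i> * \<gamma>2 * of_int k) / (2 * pi)"
  define c2 where "c2 = complex_of_real (\<Gamma> / (2 * pi))"
  have S1: "tri (\<lambda>_. 1) k x summable_on UNIV"
    by (rule tri_summable[where K = 1 and A = A]) (use x in \<open>auto simp: jap_def\<close>)
  have S2: "tri of_int k x summable_on UNIV"
    by (rule tri_summable[where K = 1 and A = A]) (use x J_pos[of k] in \<open>auto simp: less_imp_le\<close>)
  have "tri (\<mu> k) k x = (\<lambda>i. c1 * tri (\<lambda>_. 1) k x i + c2 * tri of_int k x i)"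
  proof
    fix i
    have "\<mu> k q = c1 + c2 * of_int q" for q
      by (simp add: \<mu>_def c1_def c2_def add_divide_distrib)
    then show "tri (\<mu> k) k x i = c1 * tri (\<lambda>_. 1) k x i + c2 * tri of_int k x i"
      unfolding tri_def case_prod_beta by (simp only: distrib_right mult_1 mult.assoc)
  qed
  then have "nonlin k x = infsum (\<lambda>i. c1 * tri (\<lambda>_. 1) k x i + c2 * tri of_int k x i) UNIV"
    by (simp only: nonlin_def)
  also have "\<dots> = infsum (\<lambda>i. c1 * tri (\<lambda>_. 1) k x i) UNIV + infsum (\<lambda>i. c2 * tri of_int k x i) UNIV"
    by (intro infsum_add summable_on_cmult_right S1 S2)
  also have "\<dots> = c1 * infsum (tri (\<lambda>_. 1) k x) UNIV + c2 * infsum (tri of_int k x) UNIV"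
    by (simp only: infsum_cmult_right')
  finally show ?thesis by (simp only: c1_def c2_def of_real_divide of_real_mult of_real_numeral)
qed

text \<open>With \<open>(- i k)^3 = i k^3\<close> and \<open>(- i k)^2 = - k^2\<close> the
  derivatives of the test function combine to \<open>- i \<omega> k\<close>.\<close>

lemma linear_cubic_torus_integral:
  assumes f: "in_Hs r f" and small: "small_l1 A (\<lambda>l. cmod (fourier f l))"
  shows "torus_integral (\<lambda>x. f x * (- of_real \<alpha>1 * ((- (\<i> * of_int k)) ^ 3 * (Y * emode (- k) x))
           + \<i> * of_real \<alpha>2 * ((- (\<i> * of_int k)) ^ 2 * (Y * emode (- k) x)))
          + of_real ((cmod (f x))\<^sup>2) * f x * (\<i> * of_real \<gamma>1 * (Y * emode (- k) x)
              - of_real \<gamma>2 * (- (\<i> * of_int k) * (Y * emode (- k) x))))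
     = Y * (complex_of_real (sqrt (2 * pi)) * (- (\<i> * \<omega> k) * fourier f k +
          (\<i> * \<gamma>1 + \<i> * \<gamma>2 * of_int k) / (2 * pi) * infsum (tri (\<lambda>_. 1) k (fourier f)) UNIV))"
proof -
  note If = in_Hs_integrable[OF f]
  define c1 where "c1 = \<i> * \<gamma>1 + \<i> * \<gamma>2 * of_int k"
  define P where "P x = f x * (- (\<i> * \<omega> k) * Y * emode (- k) x)" for x
  define Q where "Q x = (of_real ((cmod (f x))\<^sup>2) * f x) * (c1 * Y * emode (- k) x)" for x
  have cub: "integrable circ (\<lambda>x. of_real ((cmod (f x))\<^sup>2) * f x)"
    by (rule integrable_mult_fourier[OF If(1) small If(2)])
  have IP: "integrable circ P"
  proof -
    have "integrable circ (\<lambda>x. (- (\<i> * \<omega> k) * Y) * (emode (- k) x * f x))"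
      by (intro integrable_mult_right integrable_circ_emode If)
    then show ?thesis by (simp add: P_def[abs_def] mult_ac)
  qed
  have IQ: "integrable circ Q"
  proof -
    have "integrable circ (\<lambda>x. (c1 * Y) * (emode (- k) x * (of_real ((cmod (f x))\<^sup>2) * f x)))"
      by (intro integrable_mult_right integrable_circ_emode cub)
    moreover have "(\<lambda>x. (c1 * Y) * (emode (- k) x * (of_real ((cmod (f x))\<^sup>2) * f x))) = Q"
      by (rule ext) (simp add: Q_def mult_ac)
    ultimately show ?thesis by simp
  qed
  have k3: "(- (\<i> * of_int k)) ^ 3 = \<i> * complex_of_real (real_of_int k ^ 3)"
  proof -
    have "(- (\<i> * of_int k)) ^ 3 = - (\<i> * \<i>) * \<i> * (of_int k * of_int k * of_int k :: complex)"
      unfolding power3_eq_cube by (simp only: mult_minus_left mult_minus_right minus_minus mult_ac)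
    then show ?thesis by (simp add: power3_eq_cube)
  qed
  have k2: "(- (\<i> * of_int k)) ^ 2 = - complex_of_real ((real_of_int k)\<^sup>2)"
  proof -
    have "(- (\<i> * of_int k)) ^ 2 = \<i> * \<i> * (of_int k * of_int k :: complex)"
      unfolding power2_eq_square by (simp only: mult_minus_left mult_minus_right minus_minus mult_ac)
    then show ?thesis by (simp add: power2_eq_square)
  qed
  have "f x * (- of_real \<alpha>1 * ((- (\<i> * of_int k)) ^ 3 * (Y * emode (- k) x))
           + \<i> * of_real \<alpha>2 * ((- (\<i> * of_int k)) ^ 2 * (Y * emode (- k) x)))
          + of_real ((cmod (f x))\<^sup>2) * f x * (\<i> * of_real \<gamma>1 * (Y * emode (- k) x)
              - of_real \<gamma>2 * (- (\<i> * of_int k) * (Y * emode (- k) x))) = P x + Q x" for x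
    unfolding k3 k2 P_def Q_def c1_def \<omega>_def by (simp add: algebra_simps)
  then have "torus_integral (\<lambda>x. f x * (- of_real \<alpha>1 * ((- (\<i> * of_int k)) ^ 3 * (Y * emode (- k) x))
           + \<i> * of_real \<alpha>2 * ((- (\<i> * of_int k)) ^ 2 * (Y * emode (- k) x)))
          + of_real ((cmod (f x))\<^sup>2) * f x * (\<i> * of_real \<gamma>1 * (Y * emode (- k) x)
              - of_real \<gamma>2 * (- (\<i> * of_int k) * (Y * emode (- k) x)))) = torus_integral (\<lambda>x. P x + Q x)"
    by (simp only:)
  also have "\<dots> = torus_integral P + torus_integral Q"
    unfolding torus_integral_def using IP IQ by (rule Bochner_Integration.integral_add)
  also have "torus_integral P = (- (\<i> * \<omega> k) * Y) * (complex_of_real (sqrt (2 * pi)) * fourier f k)"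
    unfolding P_def by (rule torus_integral_mode_test)
  also have "torus_integral Q = (c1 * Y) * (complex_of_real (sqrt (2 * pi)) * (infsum (tri (\<lambda>_. 1) k (fourier f)) UNIV / (2 * pi)))"
    unfolding Q_def fourier_cubic[OF If(1) small If(2), symmetric] by (rule torus_integral_mode_test)
  finally show ?thesis unfolding c1_def[symmetric] by (simp add: algebra_simps)
qed

lemma integrated_mode:
  fixes u :: "real \<Rightarrow> real \<Rightarrow> complex" and u0 :: "real \<Rightarrow> complex"
  assumes \<sigma>: "\<sigma> = 1 \<or> \<sigma> = - 1" and c: "0 < c" "c < \<tau>"
    and Hs: "\<And>t. t \<in> {0..\<tau>} \<Longrightarrow> in_Hs r (u (\<sigma> * t))"
    and small: "\<And>t. t \<in> {0..\<tau>} \<Longrightarrow> small_l1 A (\<lambda>l. cmod (fourier (u (\<sigma> * t)) l))"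
    and cont: "\<And>l. continuous_on {0..\<tau>} (\<lambda>t. fourier (u (\<sigma> * t)) l)"
    and weak: "\<And>\<phi>. test_function (time_interval \<sigma> \<tau>) \<phi> \<Longrightarrow>
        weak_identity \<alpha>1 \<alpha>2 \<gamma>1 \<gamma>2 \<Gamma> (time_interval \<sigma> \<tau>) \<sigma> u0 u \<phi>"
  shows "fourier (u (\<sigma> * c)) k = fourier u0 k +
     integral {0..c} (\<lambda>t. of_real \<sigma> * (- (\<i> * \<omega> k) * fourier (u (\<sigma> * t)) k + nonlin k (fourier (u (\<sigma> * t)))))"
proof -
  define v where "v t = fourier (u (\<sigma> * t))" for t
  let ?I = "time_interval \<sigma> \<tau>"
  define s where "s = complex_of_real (sqrt (2 * pi))"
  have s0: "s \<noteq> 0" by (simp add: s_def)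
  have ss: "s * s = 2 * pi" unfolding s_def by (simp flip: of_real_mult)
  have \<sigma>\<sigma>: "\<sigma> * \<sigma> = 1" "\<And>t. \<sigma> * (\<sigma> * t) = t" using \<sigma> by auto
  define c1 where "c1 = (\<i> * \<gamma>1 + \<i> * \<gamma>2 * of_int k) / (2 * pi)"
  define T1 where "T1 t = infsum (tri (\<lambda>_. 1) k (fourier (u t))) UNIV" for t
  define T2 where "T2 t = infsum (tri of_int k (fourier (u t))) UNIV" for t
  define G1 where "G1 t = - (\<i> * \<omega> k) * fourier (u t) k + c1 * T1 t" for t
  define G2 where "G2 t = \<Gamma> / (2 * pi) * T2 t" for t
  define F where "F t = G1 (\<sigma> * t) + G2 (\<sigma> * t)" for t
  have J1: "cmod 1 \<le> 1 * (J k + \<bar>real_of_int q\<bar>)" for q by (simp add: jap_def)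
  have J2: "cmod (of_int q) \<le> 1 * (J k + \<bar>real_of_int q\<bar>)" for q by (simp add: jap_def)
  have contG: "continuous_on {0..\<tau>} (\<lambda>t. G1 (\<sigma> * t))" "continuous_on {0..\<tau>} (\<lambda>t. G2 (\<sigma> * t))"
    unfolding G1_def G2_def T1_def T2_def
    by (intro continuous_intros cont
        continuous_on_tri_infsum[where a = "\<lambda>t. fourier (u (\<sigma> * t))" and m = "\<lambda>_. 1", OF J1 small cont]
        continuous_on_tri_infsum[where a = "\<lambda>t. fourier (u (\<sigma> * t))" and m = of_int, OF J2 small cont]; assumption)+
  have F_eq: "F t = - (\<i> * \<omega> k) * v t k + nonlin k (v t)" if "t \<in> {0..\<tau>}" for t
    unfolding F_def G1_def G2_def T1_def T2_def v_def nonlin_split[OF small[OF that]] c1_def by simp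
  have contF: "continuous_on {0..\<tau>} F" unfolding F_def using contG by (intro continuous_intros)
  have cc: "continuous_on S (\<lambda>t. complex_of_real (bump m (real n * (c - t))))" for S m n
    by (intro continuous_intros continuous_on_cutoff)
  \<comment> \<open>All integrands contain the cutoff or the spike, which vanish from
    \<open>c\<close> on.\<close>
  have cut: "integral {0..\<tau>} h = integral {0..c} h" if "\<And>t. c \<le> t \<Longrightarrow> h t = 0" "continuous_on {0..\<tau>} h"
    for h :: "real \<Rightarrow> complex"
  proof -
    have "integral {0..\<tau>} h = integral {0..c} h + integral {c..\<tau>} h"
      using c that(2) by (intro Henstock_Kurzweil_Integration.integral_combine[symmetric] integrable_continuous_real) auto
    also have "integral {c..\<tau>} h = integral {c..\<tau>} (\<lambda>_. 0)" by (rule Henstock_Kurzweil_Integration.integral_cong) (use that in auto)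
    finally show ?thesis by simp
  qed
  have main: "integral {0..c} (\<lambda>t. spike n c t * v t k) - bump 0 (real n * c) * fourier u0 k =
       integral {0..c} (\<lambda>t. bump 0 (real n * (c - t)) * (of_real \<sigma> * F t))" for n
  proof -
    let ?\<phi> = "mode_test \<sigma> n c k"
    define Y where "Y t = complex_of_real (bump 0 (real n * (c - \<sigma> * t)))" for t
    have \<phi>: "?\<phi> t x = Y t * emode (- k) x" for t x by (simp add: mode_test_def Y_def)
    have Ys: "Y (\<sigma> * t) = complex_of_real (bump 0 (real n * (c - t)))" for t by (simp add: Y_def \<sigma>\<sigma>)
    have I1: "(LINT t|lebesgue_on ?I. torus_integral (\<lambda>x. u t x * dt ?\<phi> t x)) =
        integral {0..\<tau>} (\<lambda>t. - of_real \<sigma> * s * (spike n c t * v t k))"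
    proof -
      have "torus_integral (\<lambda>x. u t x * dt ?\<phi> t x) = complex_of_real (- (\<sigma> * spike n c (\<sigma> * t))) * (s * fourier (u t) k)" for t
        unfolding dt_mode_test s_def by (rule torus_integral_mode_test)
      then have "(LINT t|lebesgue_on ?I. torus_integral (\<lambda>x. u t x * dt ?\<phi> t x)) =
          (LINT t|lebesgue_on ?I. complex_of_real (- (\<sigma> * spike n c (\<sigma> * t))) * (s * fourier (u t) k))" by (simp only:)
      also have "\<dots> = integral {0..\<tau>} (\<lambda>t. complex_of_real (- (\<sigma> * spike n c (\<sigma> * (\<sigma> * t)))) * (s * fourier (u (\<sigma> * t)) k))"
        by (rule lebesgue_integral_time[OF \<sigma>]) (unfold \<sigma>\<sigma>, intro continuous_intros continuous_on_spike cont)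
      also have "\<dots> = integral {0..\<tau>} (\<lambda>t. - of_real \<sigma> * s * (spike n c t * v t k))"
        unfolding \<sigma>\<sigma> v_def by (simp add: mult_ac)
      finally show ?thesis .
    qed
    have I0: "torus_integral (\<lambda>x. u0 x * ?\<phi> 0 x) = bump 0 (real n * c) * (s * fourier u0 k)"
      unfolding mode_test_def s_def using torus_integral_mode_test[of u0 "complex_of_real (bump 0 (real n * c))" k] by simp
    have inI: "\<exists>t'\<in>{0..\<tau>}. t = \<sigma> * t'" if "t \<in> ?I" for t
      using that by (auto simp: time_interval_def)
    have sp: "space (lebesgue_on ?I) = ?I" by (simp add: space_restrict_space)
    have I2: "(LINT t|lebesgue_on ?I. torus_integral (\<lambda>x.
          u t x * (- of_real \<alpha>1 * (dx ^^ 3) ?\<phi> t x + \<i> * of_real \<alpha>2 * (dx ^^ 2) ?\<phi> t x)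
          + of_real ((cmod (u t x))\<^sup>2) * u t x * (\<i> * of_real \<gamma>1 * ?\<phi> t x - of_real \<gamma>2 * dx ?\<phi> t x)))
        = integral {0..\<tau>} (\<lambda>t. s * (bump 0 (real n * (c - t)) * G1 (\<sigma> * t)))"
    proof -
      have dx1: "dx ?\<phi> t x = - (\<i> * of_int k) * ?\<phi> t x" for t x
        using dx_pow_mode_test[of 1 \<sigma> n c k] by simp
      have "(LINT t|lebesgue_on ?I. torus_integral (\<lambda>x.
          u t x * (- of_real \<alpha>1 * (dx ^^ 3) ?\<phi> t x + \<i> * of_real \<alpha>2 * (dx ^^ 2) ?\<phi> t x)
          + of_real ((cmod (u t x))\<^sup>2) * u t x * (\<i> * of_real \<gamma>1 * ?\<phi> t x - of_real \<gamma>2 * dx ?\<phi> t x)))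
         = (LINT t|lebesgue_on ?I. Y t * (s * G1 t))"
      proof (rule Bochner_Integration.integral_cong[OF refl], unfold sp)
        fix t assume "t \<in> ?I"
        then obtain t' where t': "t' \<in> {0..\<tau>}" "t = \<sigma> * t'" using inI by blast
        show "torus_integral (\<lambda>x.
          u t x * (- of_real \<alpha>1 * (dx ^^ 3) ?\<phi> t x + \<i> * of_real \<alpha>2 * (dx ^^ 2) ?\<phi> t x)
          + of_real ((cmod (u t x))\<^sup>2) * u t x * (\<i> * of_real \<gamma>1 * ?\<phi> t x - of_real \<gamma>2 * dx ?\<phi> t x)) = Y t * (s * G1 t)"
          unfolding dx1 dx_pow_mode_test \<phi> s_def G1_def c1_def T1_def
          by (rule linear_cubic_torus_integral[where r = r and A = A]) (use t' Hs small in auto)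
      qed
      also have "\<dots> = integral {0..\<tau>} (\<lambda>t. Y (\<sigma> * t) * (s * G1 (\<sigma> * t)))"
        by (rule lebesgue_integral_time[OF \<sigma>]) (unfold Ys, intro continuous_intros continuous_on_cutoff contG)
      also have "\<dots> = integral {0..\<tau>} (\<lambda>t. s * (bump 0 (real n * (c - t)) * G1 (\<sigma> * t)))"
        unfolding Ys by (simp add: mult_ac)
      finally show ?thesis .
    qed
    have I3: "(LINT t|lebesgue_on ?I. hs_pairing (dist_deriv (fourier (\<lambda>x. of_real ((cmod (u t x))\<^sup>2)))) (fourier (\<lambda>x. u t x * ?\<phi> t x)))
        = integral {0..\<tau>} (\<lambda>t. \<i> * complex_of_real (1 / sqrt (2 * pi)) * (bump 0 (real n * (c - t)) * T2 (\<sigma> * t)))"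
    proof -
      have "(LINT t|lebesgue_on ?I. hs_pairing (dist_deriv (fourier (\<lambda>x. of_real ((cmod (u t x))\<^sup>2)))) (fourier (\<lambda>x. u t x * ?\<phi> t x)))
         = (LINT t|lebesgue_on ?I. Y t * (\<i> * complex_of_real (1 / sqrt (2 * pi)) * T2 t))"
      proof (rule Bochner_Integration.integral_cong[OF refl], unfold sp)
        fix t assume "t \<in> ?I"
        then obtain t' where t': "t' \<in> {0..\<tau>}" "t = \<sigma> * t'" using inI by blast
        show "hs_pairing (dist_deriv (fourier (\<lambda>x. of_real ((cmod (u t x))\<^sup>2)))) (fourier (\<lambda>x. u t x * ?\<phi> t x))
           = Y t * (\<i> * complex_of_real (1 / sqrt (2 * pi)) * T2 t)"
          unfolding \<phi> T2_def by (rule pairing_tri[where A = A]) (use t' in_Hs_integrable[OF Hs] small in auto)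
      qed
      also have "\<dots> = integral {0..\<tau>} (\<lambda>t. Y (\<sigma> * t) * (\<i> * complex_of_real (1 / sqrt (2 * pi)) * T2 (\<sigma> * t)))"
      proof (rule lebesgue_integral_time[OF \<sigma>])
        have "continuous_on {0..\<tau>} (\<lambda>t. T2 (\<sigma> * t))" unfolding T2_def
          by (rule continuous_on_tri_infsum[where a = "\<lambda>t. fourier (u (\<sigma> * t))" and m = of_int, OF J2 small cont]; assumption)
        then show "continuous_on {0..\<tau>} (\<lambda>t. Y (\<sigma> * t) * (\<i> * complex_of_real (1 / sqrt (2 * pi)) * T2 (\<sigma> * t)))"
          unfolding Ys by (intro continuous_intros continuous_on_cutoff)
      qed
      also have "\<dots> = integral {0..\<tau>} (\<lambda>t. \<i> * complex_of_real (1 / sqrt (2 * pi)) * (bump 0 (real n * (c - t)) * T2 (\<sigma> * t)))"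
        unfolding Ys by (simp add: mult_ac)
      finally show ?thesis .
    qed
    define S where "S = integral {0..\<tau>} (\<lambda>t. spike n c t * v t k)"
    define P where "P = integral {0..\<tau>} (\<lambda>t. bump 0 (real n * (c - t)) * G1 (\<sigma> * t))"
    define Q where "Q = integral {0..\<tau>} (\<lambda>t. bump 0 (real n * (c - t)) * G2 (\<sigma> * t))"
    have "weak_identity \<alpha>1 \<alpha>2 \<gamma>1 \<gamma>2 \<Gamma> ?I \<sigma> u0 u ?\<phi>"
      by (rule weak[OF test_function_mode_test[OF \<sigma> c]])
    then have "- (- of_real \<sigma> * s * S) - of_real \<sigma> * (bump 0 (real n * c) * (s * fourier u0 k)) =
        s * P - \<i> * of_real \<Gamma> * (\<i> * complex_of_real (1 / sqrt (2 * pi)) *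
          integral {0..\<tau>} (\<lambda>t. bump 0 (real n * (c - t)) * T2 (\<sigma> * t)))"
      unfolding weak_identity_def I1 I0 I2 I3 S_def P_def
      by (simp only: Henstock_Kurzweil_Integration.integral_mult_right)
    moreover have "- \<i> * of_real \<Gamma> * (\<i> * complex_of_real (1 / sqrt (2 * pi)) *
          integral {0..\<tau>} (\<lambda>t. bump 0 (real n * (c - t)) * T2 (\<sigma> * t))) = s * Q"
    proof -
      \<comment> \<open>The pairing carries the normalising factor \<open>1 / sqrt (2 * pi)\<close>;
        writing it as \<open>s / (2 * pi)\<close> exposes the common factor \<open>s\<close> of all
        terms.\<close>
      have cs: "complex_of_real (1 / sqrt (2 * pi)) = s / (2 * pi)"
        using ss s0 by (simp add: s_def field_simps)
      have "Q = \<Gamma> / (2 * pi) * integral {0..\<tau>} (\<lambda>t. bump 0 (real n * (c - t)) * T2 (\<sigma> * t))"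
        unfolding Q_def G2_def by (subst Henstock_Kurzweil_Integration.integral_mult_right[symmetric]) (simp add: mult_ac)
      moreover have "- \<i> * G * (\<i> * C * X) = - (\<i> * \<i>) * (G * C * X)" for G C X :: complex
        by (simp only: mult_minus_left mult_minus_right mult_ac)
      ultimately show ?thesis unfolding cs by simp
    qed
    ultimately have "s * (of_real \<sigma> * (S - bump 0 (real n * c) * fourier u0 k)) = s * (P + Q)"
      by (simp add: algebra_simps)
    then have "of_real \<sigma> * (S - bump 0 (real n * c) * fourier u0 k) = P + Q" using s0 by simp
    \<comment> \<open>The time derivative of the test function and the boundary term both bring a
      factor \<open>\<sigma>\<close>. As its square is 1, it can be moved to the right-hand
      side.\<close>
    then have twice: "of_real \<sigma> * (of_real \<sigma> * (S - bump 0 (real n * c) * fourier u0 k)) = of_real \<sigma> * (P + Q)" by simp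
    have eq: "S - bump 0 (real n * c) * fourier u0 k = of_real \<sigma> * (P + Q)"
    proof -
      have "of_real \<sigma> * (of_real \<sigma> * X) = X" for X :: complex using \<sigma> by auto
      then show ?thesis using twice by metis
    qed
    have "P + Q = integral {0..\<tau>} (\<lambda>t. bump 0 (real n * (c - t)) * G1 (\<sigma> * t) + bump 0 (real n * (c - t)) * G2 (\<sigma> * t))"
      unfolding P_def Q_def
      by (intro Henstock_Kurzweil_Integration.integral_add[symmetric] integrable_continuous_real continuous_intros
          continuous_on_cutoff contG)
    also have "\<dots> = integral {0..\<tau>} (\<lambda>t. bump 0 (real n * (c - t)) * F t)"
      by (simp add: F_def distrib_left)
    finally have "of_real \<sigma> * (P + Q) = integral {0..\<tau>} (\<lambda>t. bump 0 (real n * (c - t)) * (of_real \<sigma> * F t))"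
      by (simp add: mult.left_commute)
    also have "\<dots> = integral {0..c} (\<lambda>t. bump 0 (real n * (c - t)) * (of_real \<sigma> * F t))"
      by (rule cut) (auto simp: bump_nonpos mult_nonneg_nonpos intro!: continuous_intros continuous_on_cutoff contF)
    finally have R: "of_real \<sigma> * (P + Q) = integral {0..c} (\<lambda>t. bump 0 (real n * (c - t)) * (of_real \<sigma> * F t))" .
    have "S = integral {0..c} (\<lambda>t. spike n c t * v t k)"
      unfolding S_def
    proof (rule cut)
      show "continuous_on {0..\<tau>} (\<lambda>t. spike n c t * v t k)"
        unfolding v_def by (intro continuous_intros continuous_on_spike cont)
    qed (auto simp: spike_def bump_nonpos mult_nonneg_nonpos)
    with eq R show ?thesis by simp
  qed
  have sub: "{0..c} \<subseteq> {0..\<tau>}" using c by auto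
  have "v c k = fourier u0 k + integral {0..c} (\<lambda>t. of_real \<sigma> * F t)"
  proof (rule weak_ode_integrated[OF c(1) _ _ main])
    show "continuous_on {0..c} (\<lambda>t. v t k)" unfolding v_def by (rule continuous_on_subset[OF cont sub])
    show "continuous_on {0..c} (\<lambda>t. of_real \<sigma> * F t)"
      by (intro continuous_intros continuous_on_subset[OF contF sub])
  qed
  also have "integral {0..c} (\<lambda>t. of_real \<sigma> * F t) =
      integral {0..c} (\<lambda>t. of_real \<sigma> * (- (\<i> * \<omega> k) * v t k + nonlin k (v t)))"
    by (rule Henstock_Kurzweil_Integration.integral_cong) (use sub F_eq in auto)
  finally show ?thesis by (simp only: v_def)
qed

end

section \<open>Sobolev norms and initial data\<close>

lemma sum_square_L2: "(\<Sum>k\<in>S. (J k powr s * cmod (a k))\<^sup>2) = (L2_set (\<lambda>k. J k powr s * cmod (a k)) S)\<^sup>2"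
  by (simp add: L2_set_def sum_nonneg)

lemma hs_normI:
  assumes fin: "\<And>S. finite S \<Longrightarrow> L2_set (\<lambda>k. J k powr s * cmod (a k)) S \<le> C"
  shows "hs_coeffs s a" "hs_norm s a \<le> C"
proof -
  have C: "0 \<le> C" using fin[of "{}"] by simp
  have b: "(\<Sum>k\<in>S. (J k powr s * cmod (a k))\<^sup>2) \<le> C\<^sup>2" if "finite S" for S
    unfolding sum_square_L2 using fin[OF that] by (intro power_mono L2_set_nonneg)
  then have "bdd_above (sum (\<lambda>k. (J k powr s * cmod (a k))\<^sup>2) ` {F. F \<subseteq> UNIV \<and> finite F})"
    by (intro bdd_aboveI2) auto
  then show h: "hs_coeffs s a" unfolding hs_coeffs_def by (intro nonneg_bdd_above_summable_on) auto
  have "(\<Sum>\<^sub>\<infinity>k. (J k powr s * cmod (a k))\<^sup>2) \<le> C\<^sup>2"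
    using h unfolding hs_coeffs_def by (rule infsum_le_finite_sums) (rule b)
  then show "hs_norm s a \<le> C" unfolding hs_norm_def using C by (rule real_le_lsqrt[rotated 1])
qed

lemma L2_le_hs_norm:
  assumes "hs_coeffs s a" "finite S"
  shows "L2_set (\<lambda>k. J k powr s * cmod (a k)) S \<le> hs_norm s a"
  using hs_coeffs_finite_sum[OF assms] hs_norm_nonneg unfolding sum_square_L2 by (rule power2_le_imp_le)

lemma hs_triangle:
  assumes a: "hs_coeffs s a" and b: "hs_coeffs s b"
  shows "hs_coeffs s (\<lambda>k. a k - b k)" "hs_norm s (\<lambda>k. a k - b k) \<le> hs_norm s a + hs_norm s b"
proof -
  have "L2_set (\<lambda>k. J k powr s * cmod (a k - b k)) S \<le> hs_norm s a + hs_norm s b" if S: "finite S" for S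
  proof -
    have "L2_set (\<lambda>k. J k powr s * cmod (a k - b k)) S \<le> L2_set (\<lambda>k. J k powr s * cmod (a k) + J k powr s * cmod (b k)) S"
      by (rule L2_set_mono) (auto simp: distrib_left[symmetric] intro!: mult_left_mono norm_triangle_ineq4)
    also have "\<dots> \<le> L2_set (\<lambda>k. J k powr s * cmod (a k)) S + L2_set (\<lambda>k. J k powr s * cmod (b k)) S"
      by (rule L2_set_triangle_ineq)
    also have "\<dots> \<le> hs_norm s a + hs_norm s b"
      by (intro add_mono L2_le_hs_norm a b S)
    finally show ?thesis .
  qed
  from hs_normI[OF this]
  show "hs_coeffs s (\<lambda>k. a k - b k)" "hs_norm s (\<lambda>k. a k - b k) \<le> hs_norm s a + hs_norm s b" by blast+
qed

lemma coeff_le_hs_norm: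
  assumes "hs_coeffs s a" "0 \<le> s"
  shows "cmod (a k) \<le> hs_norm s a"
proof -
  have "1 * cmod (a k) \<le> J k powr s * cmod (a k)"
    using J_ge_1[of k] assms(2) by (intro mult_right_mono ge_one_powr_ge_zero) auto
  also have "\<dots> \<le> hs_norm s a" using L2_le_hs_norm[OF assms(1), of "{k}"] by simp
  finally show ?thesis by simp
qed

section \<open>Continuity in time of the coefficients and of the norm\<close>

context
  fixes s :: real and I :: "real set" and u :: "real \<Rightarrow> real \<Rightarrow> complex"
  assumes u: "continuous_in_Hs s I u"
begin

lemma continuous_Hs_in: "t \<in> I \<Longrightarrow> in_Hs s (u t)"
  using u by (simp add: continuous_in_Hs_def)

lemma continuous_Hs_coeffs: "t \<in> I \<Longrightarrow> hs_coeffs s (fourier (u t))"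
  using continuous_Hs_in by (simp add: in_Hs_def)

lemma Hs_norm_diff:
  assumes "t \<in> I" "t0 \<in> I"
  shows "Hs_norm s (\<lambda>x. u t x - u t0 x) = hs_norm s (\<lambda>k. fourier (u t) k - fourier (u t0) k)"
proof -
  have "fourier (\<lambda>x. u t x - u t0 x) = (\<lambda>k. fourier (u t) k - fourier (u t0) k)"
    by (rule ext, rule fourier_diff) (use assms continuous_Hs_in in_Hs_integrable(1) in blast)+
  then show ?thesis by (simp only: Hs_norm_def)
qed

lemma Hs_difference_tendsto:
  assumes "t0 \<in> I"
  shows "((\<lambda>t. hs_norm s (\<lambda>k. fourier (u t) k - fourier (u t0) k)) \<longlongrightarrow> 0) (at t0 within I)"
proof (rule Lim_transform_eventually)
  show "((\<lambda>t. Hs_norm s (\<lambda>x. u t x - u t0 x)) \<longlongrightarrow> 0) (at t0 within I)"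
    using u assms by (simp add: continuous_in_Hs_def)
  show "\<forall>\<^sub>F t in at t0 within I. Hs_norm s (\<lambda>x. u t x - u t0 x) = hs_norm s (\<lambda>k. fourier (u t) k - fourier (u t0) k)"
    unfolding eventually_at_filter using Hs_norm_diff assms by (intro always_eventually) auto
qed

lemma continuous_on_coeff:
  assumes "0 \<le> s"
  shows "continuous_on I (\<lambda>t. fourier (u t) k)"
  unfolding continuous_on
proof
  fix t0 assume t0: "t0 \<in> I"
  show "((\<lambda>t. fourier (u t) k) \<longlongrightarrow> fourier (u t0) k) (at t0 within I)"
  proof (rule LIM_zero_cancel, rule Lim_null_comparison[OF _ Hs_difference_tendsto[OF t0]])
    show "\<forall>\<^sub>F t in at t0 within I. cmod (fourier (u t) k - fourier (u t0) k) \<le> hs_norm s (\<lambda>k. fourier (u t) k - fourier (u t0) k)"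
      unfolding eventually_at_filter
      using coeff_le_hs_norm[OF hs_triangle(1)[OF continuous_Hs_coeffs continuous_Hs_coeffs[OF t0]] assms]
      by (intro always_eventually) auto
  qed
qed

lemma continuous_on_Hs_norm: "continuous_on I (\<lambda>t. Hs_norm s (u t))"
  unfolding continuous_on
proof
  fix t0 assume t0: "t0 \<in> I"
  show "((\<lambda>t. Hs_norm s (u t)) \<longlongrightarrow> Hs_norm s (u t0)) (at t0 within I)"
  proof (rule LIM_zero_cancel, rule Lim_null_comparison[OF _ Hs_difference_tendsto[OF t0]])
    have "\<bar>Hs_norm s (u t) - Hs_norm s (u t0)\<bar> \<le> hs_norm s (\<lambda>k. fourier (u t) k - fourier (u t0) k)" if t: "t \<in> I" for t
    proof -
      let ?a = "fourier (u t)" and ?b = "fourier (u t0)"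
      note c = continuous_Hs_coeffs[OF t] continuous_Hs_coeffs[OF t0]
      note d = hs_triangle(1)[OF c] hs_triangle(1)[OF c(2,1)]
      have "hs_norm s (\<lambda>k. ?a k - (?a k - ?b k)) \<le> hs_norm s ?a + hs_norm s (\<lambda>k. ?a k - ?b k)"
        by (rule hs_triangle(2)[OF c(1) d(1)])
      moreover have "hs_norm s (\<lambda>k. ?b k - (?b k - ?a k)) \<le> hs_norm s ?b + hs_norm s (\<lambda>k. ?b k - ?a k)"
        by (rule hs_triangle(2)[OF c(2) d(2)])
      moreover have "hs_norm s (\<lambda>k. ?b k - ?a k) = hs_norm s (\<lambda>k. ?a k - ?b k)"
        by (simp add: hs_norm_def norm_minus_commute)
      ultimately show ?thesis unfolding Hs_norm_def by simp
    qed
    then show "\<forall>\<^sub>F t in at t0 within I. norm (Hs_norm s (u t) - Hs_norm s (u t0)) \<le> hs_norm s (\<lambda>k. fourier (u t) k - fourier (u t0) k)"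
      unfolding eventually_at_filter by (intro always_eventually) auto
  qed
qed

text \<open>Continuity on a compact interval gives the boundedness without which the real supremum
  would be meaningless.\<close>

lemma Hs_norm_le_SUP:
  assumes "compact I" "t \<in> I"
  shows "Hs_norm s (u t) \<le> (SUP t\<in>I. Hs_norm s (u t))"
proof (rule cSUP_upper[OF assms(2)])
  show "bdd_above ((\<lambda>t. Hs_norm s (u t)) ` I)"
    by (intro bounded_imp_bdd_above compact_imp_bounded compact_continuous_image continuous_on_Hs_norm assms)
qed

end

section \<open>Two-mode initial data\<close>

lemma emode_real_analytic: "\<exists>r>0. \<exists>a. \<forall>x. \<bar>x - x0\<bar> < r \<longrightarrow> (\<lambda>n. a n * complex_of_real (x - x0) ^ n) sums emode k x"
proof (intro exI conjI allI impI)
  show "(0::real) < 1" by simp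
  fix x :: real
  have "(\<lambda>n. (\<i> * of_int k * complex_of_real (x - x0)) ^ n /\<^sub>R fact n) sums exp (\<i> * of_int k * complex_of_real (x - x0))"
    by (rule exp_converges)
  then have "(\<lambda>n. emode k x0 * ((\<i> * of_int k * complex_of_real (x - x0)) ^ n /\<^sub>R fact n)) sums
      (emode k x0 * exp (\<i> * of_int k * complex_of_real (x - x0)))"
    by (rule sums_mult)
  moreover have "emode k x0 * exp (\<i> * of_int k * complex_of_real (x - x0)) = emode k x"
    by (simp add: emode_def exp_add[symmetric] algebra_simps)
  moreover have "E * ((c * z) ^ n /\<^sub>R fact n) = (E * c ^ n / fact n) * z ^ n" for E c z :: complex and n
    by (simp add: power_mult_distrib scaleR_conv_of_real field_simps)
  ultimately show "(\<lambda>n. (emode k x0 * (\<i> * of_int k) ^ n / fact n) * complex_of_real (x - x0) ^ n) sums emode k x"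
    by (simp only:)
qed

text \<open>The prefactor cancels the normalisation of \<open>fourier\<close>: the coefficients are
  exactly \<open>a\<close> at 0 and \<open>b\<close> at \<open>N\<close>.\<close>

definition two_modes :: "real \<Rightarrow> real \<Rightarrow> int \<Rightarrow> real \<Rightarrow> complex" where
  "two_modes a b N x = complex_of_real (1 / sqrt (2 * pi)) * (complex_of_real a + complex_of_real b * emode N x)"

lemma two_modes_analytic: "real_analytic_torus (two_modes a b N)"
  unfolding real_analytic_torus_def
proof (intro conjI allI)
  show "periodic (two_modes a b N)" unfolding periodic_def two_modes_def by (simp only: periodic_emode) simp
  fix x0
  define C where "C = complex_of_real (1 / sqrt (2 * pi))"
  obtain r c where rc: "0 < r" "\<And>x. \<bar>x - x0\<bar> < r \<Longrightarrow> (\<lambda>n. c n * complex_of_real (x - x0) ^ n) sums emode N x"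
    using emode_real_analytic by metis
  show "\<exists>r>0. \<exists>c. \<forall>x. \<bar>x - x0\<bar> < r \<longrightarrow> (\<lambda>n. c n * complex_of_real (x - x0) ^ n) sums two_modes a b N x"
  proof (intro exI conjI allI impI)
    fix x assume x: "\<bar>x - x0\<bar> < r"
    have "(\<lambda>n. if n = 0 then complex_of_real a else 0) sums complex_of_real a"
      using sums_single[of 0 "\<lambda>_. complex_of_real a"] by simp
    then have "(\<lambda>n. C * ((if n = 0 then complex_of_real a else 0) + complex_of_real b * (c n * complex_of_real (x - x0) ^ n))) sums
        (C * (complex_of_real a + complex_of_real b * emode N x))"
      by (intro sums_mult sums_add rc x)
    moreover have "C * ((if n = 0 then complex_of_real a else 0) + complex_of_real b * (c n * complex_of_real (x - x0) ^ n))
       = (C * ((if n = 0 then complex_of_real a else 0) + complex_of_real b * c n)) * complex_of_real (x - x0) ^ n" for n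
      by (simp add: algebra_simps)
    ultimately show "(\<lambda>n. (C * ((if n = 0 then complex_of_real a else 0) + complex_of_real b * c n)) * complex_of_real (x - x0) ^ n)
        sums two_modes a b N x" by (simp only: two_modes_def C_def)
  qed (rule rc)
qed

lemma fourier_two_modes:
  assumes "N \<noteq> 0"
  shows "fourier (two_modes a b N) k = (if k = 0 then a else if k = N then b else 0)"
proof -
  define C where "C = complex_of_real (1 / sqrt (2 * pi))"
  have CC: "C * C * (2 * pi) = 1" unfolding C_def c0_sq by simp
  have I: "integrable circ (emode l)" for l
    by (intro integrable_circ_continuous continuous_on_emode)
  have "(\<lambda>x. emode (- k) x * two_modes a b N x) = (\<lambda>x. (C * a) * emode (- k) x + (C * b) * emode (N - k) x)"
  proof
    fix x show "emode (- k) x * two_modes a b N x = (C * a) * emode (- k) x + (C * b) * emode (N - k) x"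
      using emode_add[of N "- k" x] by (simp add: two_modes_def C_def add_divide_distrib algebra_simps)
  qed
  then have "integral\<^sup>L circ (\<lambda>x. emode (- k) x * two_modes a b N x) =
      (C * a) * integral\<^sup>L circ (emode (- k)) + (C * b) * integral\<^sup>L circ (emode (N - k))"
    using I by simp
  then have "fourier (two_modes a b N) k = C * ((C * a) * (if k = 0 then 2 * pi else 0) + (C * b) * (if k = N then 2 * pi else 0))"
    by (simp add: fourier_emode C_def integral_emode)
  also have "\<dots> = (if k = 0 then C * C * (2 * pi) * a else 0) + (if k = N then C * C * (2 * pi) * b else 0)"
    by (simp add: algebra_simps)
  finally show ?thesis unfolding CC using assms by simp
qed

lemma two_modes_Hs:
  assumes N: "N \<noteq> 0" and e: "0 \<le> e" and a: "\<bar>a\<bar> \<le> e / 2" and b: "J N powr s * \<bar>b\<bar> \<le> e / 2"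
  shows "in_Hs s (two_modes a b N)" "Hs_norm s (two_modes a b N) \<le> e"
proof -
  let ?f = "two_modes a b N"
  have cont: "continuous_on {0..2*pi} ?f" unfolding two_modes_def by (intro continuous_intros)
  have L2: "L2_set (\<lambda>k. J k powr s * cmod (fourier ?f k)) S \<le> e" if S: "finite S" for S
  proof -
    have "L2_set (\<lambda>k. J k powr s * cmod (fourier ?f k)) S \<le> (\<Sum>k\<in>S. J k powr s * cmod (fourier ?f k))"
      by (rule L2_set_le_sum) auto
    also have "\<dots> \<le> (\<Sum>k\<in>S \<union> {0, N}. J k powr s * cmod (fourier ?f k))"
      using S by (intro sum_mono2) auto
    also have "\<dots> = (\<Sum>k\<in>{0, N}. J k powr s * cmod (fourier ?f k))"
      using S by (intro sum.mono_neutral_right) (auto simp: fourier_two_modes[OF N])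
    also have "\<dots> = \<bar>a\<bar> + J N powr s * \<bar>b\<bar>"
      using N by (simp add: fourier_two_modes[OF N] jap_def)
    also have "\<dots> \<le> e" using a b by simp
    finally show ?thesis .
  qed
  show "Hs_norm s ?f \<le> e" unfolding Hs_norm_def using L2 by (rule hs_normI(2))
  have "hs_coeffs s (fourier ?f)" using L2 by (rule hs_normI(1))
  moreover have "periodic ?f" using two_modes_analytic by (simp add: real_analytic_torus_def)
  moreover have "?f \<in> borel_measurable circ"
    by (intro borel_measurable_integrable integrable_circ_continuous cont)
  moreover have "integrable circ (\<lambda>x. (cmod (?f x))\<^sup>2)"
  proof -
    have "integrable circ (\<lambda>x. complex_of_real ((cmod (?f x))\<^sup>2))"
      by (intro integrable_circ_continuous continuous_intros cont)
    from integrable_Re[OF this] show ?thesis by simp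
  qed
  ultimately show "in_Hs s ?f" by (simp add: in_Hs_def)
qed

context raman
begin

text \<open>The integrated equation holds strictly inside the interval; differentiating it gives the
  mode equation. The initial value, imposed only weakly, is recovered by comparing both sides as
  time tends to 0 from the right.\<close>

lemma mode_ode:
  fixes u :: "real \<Rightarrow> real \<Rightarrow> complex"
  assumes \<sigma>: "\<sigma> = 1 \<or> \<sigma> = - 1" and \<tau>: "0 < \<tau>"
    and Hs: "\<And>t. t \<in> {0..\<tau>} \<Longrightarrow> in_Hs r (u (\<sigma> * t))"
    and small: "\<And>t. t \<in> {0..\<tau>} \<Longrightarrow> small_l1 A (\<lambda>l. cmod (fourier (u (\<sigma> * t)) l))"
    and cont: "\<And>l. continuous_on {0..\<tau>} (\<lambda>t. fourier (u (\<sigma> * t)) l)"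
    and weak: "\<And>\<phi>. test_function (time_interval \<sigma> \<tau>) \<phi> \<Longrightarrow>
        weak_identity \<alpha>1 \<alpha>2 \<gamma>1 \<gamma>2 \<Gamma> (time_interval \<sigma> \<tau>) \<sigma> u0 u \<phi>"
  shows "fourier (u 0) k = fourier u0 k"
    and "t \<in> {0<..<\<tau>} \<Longrightarrow> ((\<lambda>t. fourier (u (\<sigma> * t)) k) has_vector_derivative
       of_real \<sigma> * (- (\<i> * \<omega> k) * fourier (u (\<sigma> * t)) k + nonlin k (fourier (u (\<sigma> * t))))) (at t)"
proof -
  define v where "v t = fourier (u (\<sigma> * t)) k" for t
  define F where "F t = of_real \<sigma> * (- (\<i> * \<omega> k) * fourier (u (\<sigma> * t)) k + nonlin k (fourier (u (\<sigma> * t))))" for t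
  have F: "continuous_on {0..\<tau>} F"
    unfolding F_def nonlin_def
    by (intro continuous_intros cont continuous_on_tri_infsum[where a = "\<lambda>t. fourier (u (\<sigma> * t))", OF \<mu>_le' small cont]; assumption)
  have v: "v c = fourier u0 k + integral {0..c} F" if "0 < c" "c < \<tau>" for c
    unfolding v_def F_def by (rule integrated_mode[OF \<sigma> that Hs small cont weak])
  define w where "w t = fourier u0 k + integral {0..t} F" for t
  have wd: "(w has_vector_derivative F t) (at t within {0..\<tau>})" if "t \<in> {0..\<tau>}" for t
    unfolding w_def by (auto intro!: derivative_eq_intros integral_has_vector_derivative[OF F that])
  show "((\<lambda>t. fourier (u (\<sigma> * t)) k) has_vector_derivative
       of_real \<sigma> * (- (\<i> * \<omega> k) * fourier (u (\<sigma> * t)) k + nonlin k (fourier (u (\<sigma> * t))))) (at t)"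
    if t: "t \<in> {0<..<\<tau>}"
  proof -
    have "(w has_vector_derivative F t) (at t)"
      using wd[of t] t by (simp add: at_within_Icc_at)
    then have "(v has_vector_derivative F t) (at t)"
      by (rule has_vector_derivative_transform_within_open[where S = "{0<..<\<tau>}"]) (use t v in \<open>auto simp: w_def\<close>)
    then show ?thesis by (simp add: v_def[abs_def] F_def)
  qed
  have "continuous_on {0..\<tau>} w"
    by (rule continuous_on_vector_derivative[OF wd])
  then have "(w \<longlongrightarrow> w 0) (at_right 0)" using \<tau>
    by (auto simp: continuous_on at_within_Icc_at_right dest: bspec[of _ _ 0])
  moreover have "continuous_on {0..\<tau>} v" unfolding v_def by (rule cont)
  then have "(v \<longlongrightarrow> v 0) (at_right 0)" using \<tau>
    by (auto simp: continuous_on at_within_Icc_at_right dest: bspec[of _ _ 0])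
  moreover have "\<forall>\<^sub>F t in at_right 0. v t = w t"
    by (rule eventually_at_rightI[OF _ \<tau>]) (use v in \<open>auto simp: w_def\<close>)
  ultimately have "(v \<longlongrightarrow> w 0) (at_right 0)" "(v \<longlongrightarrow> v 0) (at_right 0)"
    by (auto simp: tendsto_cong)
  then have "v 0 = w 0" by (intro tendsto_unique[of "at_right (0::real)"]) auto
  then show "fourier (u 0) k = fourier u0 k" by (simp add: v_def w_def)
qed

end

text \<open>Reversing time and reflecting space preserves the class of equations and the sign of \<open>\<Gamma>\<close>.\<close>

lemma raman_reflect: "raman \<alpha>1 \<alpha>2 \<Gamma> \<Longrightarrow> raman \<alpha>1 (- \<alpha>2) \<Gamma>"
  unfolding raman_def by (metis Ints_minus minus_divide_left minus_minus mult_minus_right)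

text \<open>\<open>\<mu>\<close> changes sign when both frequencies and \<open>\<gamma>1\<close> do.
  This sign cancels the one from time reversal, so \<open>\<Gamma>\<close> keeps its own.\<close>

lemma nonlin_reflect:
  assumes "raman \<alpha>1 \<alpha>2 \<Gamma>"
  shows "raman.nonlin (- \<gamma>1) \<gamma>2 \<Gamma> k (\<lambda>l. x (- l)) = - raman.nonlin \<gamma>1 \<gamma>2 \<Gamma> (- k) x"
proof -
  interpret R: raman \<alpha>1 \<alpha>2 \<gamma>1 \<gamma>2 \<Gamma> by fact
  interpret R': raman \<alpha>1 "- \<alpha>2" "- \<gamma>1" \<gamma>2 \<Gamma> by (rule raman_reflect) fact
  define n :: "int \<times> int \<Rightarrow> int \<times> int" where "n = (\<lambda>(p, q). (- p, - q))"
  have n: "range n = (UNIV :: (int \<times> int) set)" "inj n"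
  proof -
    have "n (n i) = i" for i by (simp add: n_def case_prod_beta)
    then show "range n = (UNIV :: (int \<times> int) set)" "inj n" by (metis surjI, metis injI)
  qed
  have "R'.nonlin k (\<lambda>l. x (- l)) = infsum (tri (R'.\<mu> k) k (\<lambda>l. x (- l))) (range n)"
    by (simp only: R'.nonlin_def n)
  also have "\<dots> = infsum (tri (R'.\<mu> k) k (\<lambda>l. x (- l)) \<circ> n) UNIV"
    by (rule infsum_reindex[OF n(2)])
  also have "tri (R'.\<mu> k) k (\<lambda>l. x (- l)) \<circ> n = (\<lambda>i. - tri (R.\<mu> (- k)) (- k) x i)"
  proof
    fix i :: "int \<times> int"
    obtain p q where i: "i = (p, q)" by force
    have "R'.\<mu> k (k + q) = - R.\<mu> (- k) (- k - q)"
      by (simp add: R'.\<mu>_def R.\<mu>_def algebra_simps add_divide_distrib diff_divide_distrib)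
    then show "(tri (R'.\<mu> k) k (\<lambda>l. x (- l)) \<circ> n) i = - tri (R.\<mu> (- k)) (- k) x i"
      by (simp add: i n_def tri_def algebra_simps)
  qed
  also have "infsum (\<lambda>i. - tri (R.\<mu> (- k)) (- k) x i) UNIV = - R.nonlin (- k) x"
    unfolding R.nonlin_def by (rule infsum_uminus)
  finally show ?thesis .
qed

section \<open>Norm inflation\<close>

lemma small_l1_reflect:
  assumes "small_l1 A f"
  shows "small_l1 A (\<lambda>l. f (- l))"
  unfolding small_l1_def
proof (intro conjI allI impI; (elim conjE)?)
  show "0 \<le> f (- l)" for l by (rule small_l1_nonneg[OF assms])
  show "J l * f (- l) \<le> A" for l using small_l1_J[OF assms, of "- l"] by (simp add: jap_def)
  fix R :: real and S :: "int set"
  assume R: "0 \<le> R" and S: "finite S" "\<forall>l\<in>S. R \<le> \<bar>real_of_int l\<bar>"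
  have "(\<Sum>l\<in>S. f (- l)) = sum f (uminus ` S)"
    by (subst sum.reindex) (auto simp: inj_on_def)
  also have "\<dots> \<le> A / sqrt (1 + R)"
    using assms R S unfolding small_l1_def by (metis (no_types, lifting) abs_minus_cancel finite_imageI imageE of_int_minus)
  finally show "(\<Sum>l\<in>S. f (- l)) \<le> A / sqrt (1 + R)" .
qed

context raman
begin

text \<open>\<open>initial_decay\<close> yields its constant before \<open>N\<close> is chosen, and
  that constant limits the coefficient at every frequency. The constant
  \<open>2 * (1 / \<epsilon>)\<close> is the one belonging to a norm below
  \<open>1 / \<epsilon>\<close>.\<close>

lemma incompatible_mode:
  assumes \<epsilon>: "0 < \<epsilon>" and \<tau>: "0 < \<tau>"
  shows "\<exists>N>0. \<forall>b. mode_system \<tau> (2 * (1 / \<epsilon>)) b \<longrightarrow> (\<forall>k. b 0 k = (if k = 0 then complex_of_real (\<epsilon> / 2) else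
     if k = N then complex_of_real (\<epsilon> / 2 * J N powr - s) else 0)) \<longrightarrow> False"
proof -
  \<comment> \<open>One power more than \<open>s\<close>, so that the weighted coefficient at
    \<open>N\<close> still grows like \<open>J N\<close>.\<close>
  define n where "n = nat \<lceil>s\<rceil> + 1"
  have n: "s + 1 \<le> real n" unfolding n_def by linarith
  have A: "0 < 2 * (1 / \<epsilon>)" and e: "0 < \<epsilon> / 2" using \<epsilon> by auto
  from initial_decay[OF A e \<tau>, of n] obtain D where D: "\<forall>a. mode_system \<tau> (2 * (1 / \<epsilon>)) a \<longrightarrow> \<epsilon> / 2 \<le> cmod (a 0 0) \<longrightarrow> (\<forall>k<0. a 0 k = 0) \<longrightarrow>
     (\<forall>k. cmod (a 0 k) * J k ^ n \<le> D)" by (elim exE) (rule that)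
  define N where "N = 1 + \<bar>\<lceil>2 * D / \<epsilon>\<rceil>\<bar>"
  have N: "0 < N" by (simp add: N_def)
  have "2 * D / \<epsilon> < J N" unfolding N_def jap_def by linarith
  then have DN: "D < \<epsilon> / 2 * J N" using \<epsilon> by (simp add: field_simps)
  show ?thesis
  proof (rule exI[of _ N], intro conjI allI impI N)
    fix b assume sys: "mode_system \<tau> (2 * (1 / \<epsilon>)) b" and b: "\<forall>k. b 0 k = (if k = 0 then complex_of_real (\<epsilon> / 2) else
       if k = N then complex_of_real (\<epsilon> / 2 * J N powr - s) else 0)"
    have "\<epsilon> / 2 \<le> cmod (b 0 0)" using b \<epsilon> by simp
    moreover have "\<forall>k<0. b 0 k = 0" using b N by auto
    ultimately have "cmod (b 0 N) * J N ^ n \<le> D"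
      using D[THEN spec, THEN mp, OF sys] by blast
    moreover have "cmod (b 0 N) = \<epsilon> / 2 * J N powr - s"
    proof -
      have "b 0 N = complex_of_real (\<epsilon> / 2 * J N powr - s)" using b N by simp
      then show ?thesis using \<epsilon> by (simp only: norm_of_real) simp
    qed
    moreover have "J N \<le> J N powr - s * J N ^ n"
    proof -
      have "J N = J N powr 1" using J_pos[of N] by simp
      also have "\<dots> \<le> J N powr (real n - s)" using n J_ge_1 by (intro powr_mono) auto
      also have "\<dots> = J N powr - s * J N ^ n"
        using J_pos[of N] by (simp add: powr_realpow[symmetric] powr_add[symmetric])
      finally show ?thesis .
    qed
    then have "\<epsilon> / 2 * J N \<le> \<epsilon> / 2 * (J N powr - s * J N ^ n)" using \<epsilon> by (intro mult_left_mono) auto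
    ultimately show False using DN by (simp add: mult.assoc)
  qed
qed

end

lemma two_modes_data:
  assumes "0 < \<epsilon>" "N \<noteq> 0"
  shows "in_Hs s (two_modes (\<epsilon> / 2) (\<epsilon> / 2 * J N powr - s) N)"
    "Hs_norm s (two_modes (\<epsilon> / 2) (\<epsilon> / 2 * J N powr - s) N) \<le> \<epsilon>"
proof -
  have "J N powr s * \<bar>\<epsilon> / 2 * J N powr - s\<bar> = \<epsilon> / 2"
    using assms J_pos[of N] by (simp add: abs_mult powr_minus)
  then have "J N powr s * \<bar>\<epsilon> / 2 * J N powr - s\<bar> \<le> \<epsilon> / 2" by simp
  from two_modes_Hs[OF assms(2) _ _ this] assms(1)
  show "in_Hs s (two_modes (\<epsilon> / 2) (\<epsilon> / 2 * J N powr - s) N)"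
    "Hs_norm s (two_modes (\<epsilon> / 2) (\<epsilon> / 2 * J N powr - s) N) \<le> \<epsilon>" by auto
qed

lemma continuous_Hs_small_l1:
  assumes u: "continuous_in_Hs s1 I u" and I: "compact I" and s1: "1 \<le> s1"
    and less: "(SUP t\<in>I. Hs_norm s1 (u t)) < M" and t: "t \<in> I"
  shows "small_l1 (2 * M) (\<lambda>k. cmod (fourier (u t) k))"
proof (rule hs_coeffs_small_l1[OF continuous_Hs_coeffs[OF u t] s1])
  show "hs_norm s1 (fourier (u t)) \<le> M"
    using Hs_norm_le_SUP[OF u I t] less by (simp add: Hs_norm_def)
qed

lemma forward_inflation:
  assumes raman: "raman \<alpha>1 \<alpha>2 \<Gamma>" and s1: "1 \<le> s1" and \<epsilon>: "0 < \<epsilon>" and \<tau>: "0 < \<tau>"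
  shows "\<exists>\<psi>. real_analytic_torus \<psi> \<and> in_Hs s \<psi> \<and> Hs_norm s \<psi> \<le> \<epsilon> \<and>
        (\<forall>u. continuous_in_Hs s1 {0..\<tau>} u \<and> forward_solution \<alpha>1 \<alpha>2 \<gamma>1 \<gamma>2 \<Gamma> \<tau> \<psi> u \<longrightarrow>
           (SUP t\<in>{0..\<tau>}. Hs_norm s1 (u t)) \<ge> 1 / \<epsilon>)"
proof -
  interpret raman \<alpha>1 \<alpha>2 \<gamma>1 \<gamma>2 \<Gamma> by fact
  obtain N where N: "0 < N" and no: "\<forall>b. mode_system \<tau> (2 * (1 / \<epsilon>)) b \<longrightarrow> (\<forall>k. b 0 k = (if k = 0 then complex_of_real (\<epsilon> / 2) else
     if k = N then complex_of_real (\<epsilon> / 2 * J N powr - s) else 0)) \<longrightarrow> False"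
    using incompatible_mode[OF \<epsilon> \<tau>, of s] by (elim exE conjE) (rule that)
  have N0: "N \<noteq> 0" using N by simp
  define \<psi> where "\<psi> = two_modes (\<epsilon> / 2) (\<epsilon> / 2 * J N powr - s) N"
  show ?thesis
  proof (intro exI[of _ \<psi>] conjI allI impI; (elim conjE)?)
    show "real_analytic_torus \<psi>" unfolding \<psi>_def by (rule two_modes_analytic)
    show "in_Hs s \<psi>" "Hs_norm s \<psi> \<le> \<epsilon>" unfolding \<psi>_def by (rule two_modes_data[OF \<epsilon> N0])+
    fix u assume u: "continuous_in_Hs s1 {0..\<tau>} u" and sol: "forward_solution \<alpha>1 \<alpha>2 \<gamma>1 \<gamma>2 \<Gamma> \<tau> \<psi> u"
    show "1 / \<epsilon> \<le> (SUP t\<in>{0..\<tau>}. Hs_norm s1 (u t))"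
    proof (rule ccontr)
      assume "\<not> 1 / \<epsilon> \<le> (SUP t\<in>{0..\<tau>}. Hs_norm s1 (u t))"
      then have less: "(SUP t\<in>{0..\<tau>}. Hs_norm s1 (u t)) < 1 / \<epsilon>" by simp
      have weak: "weak_identity \<alpha>1 \<alpha>2 \<gamma>1 \<gamma>2 \<Gamma> (time_interval 1 \<tau>) 1 \<psi> u \<phi>" if "test_function (time_interval 1 \<tau>) \<phi>" for \<phi>
        using sol that unfolding forward_solution_def solution_on_def time_interval_forward by blast
      have Hs: "in_Hs s1 (u (1 * t))" if "t \<in> {0..\<tau>}" for t
        using continuous_Hs_in[OF u] that by simp
      have small: "small_l1 (2 * (1 / \<epsilon>)) (\<lambda>l. cmod (fourier (u (1 * t)) l))" if "t \<in> {0..\<tau>}" for t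
        using continuous_Hs_small_l1[OF u compact_Icc s1 less that] by simp
      have cont: "continuous_on {0..\<tau>} (\<lambda>t. fourier (u (1 * t)) l)" for l
        using continuous_on_coeff[OF u] s1 by simp
      have one: "1 = (1::real) \<or> 1 = - (1::real)" by simp
      have init: "fourier (u 0) k = fourier \<psi> k" for k
        by (rule mode_ode(1)[OF one \<tau>], erule Hs, erule small, rule cont, erule weak)
      have ode: "((\<lambda>t. fourier (u (1 * t)) k) has_vector_derivative
          of_real 1 * (- (\<i> * \<omega> k) * fourier (u (1 * t)) k + nonlin k (fourier (u (1 * t))))) (at t)"
        if "t \<in> {0<..<\<tau>}" for k t
        by (rule mode_ode(2)[OF one \<tau>], erule Hs, erule small, rule cont, erule weak, rule that)
      have "mode_system \<tau> (2 * (1 / \<epsilon>)) (\<lambda>t. fourier (u t))"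
        unfolding mode_system_def using small cont ode by simp
      moreover have "\<forall>k. fourier (u 0) k = (if k = 0 then complex_of_real (\<epsilon> / 2) else
         if k = N then complex_of_real (\<epsilon> / 2 * J N powr - s) else 0)"
        unfolding init \<psi>_def fourier_two_modes[OF N0] by simp
      ultimately show False using no by blast
    qed
  qed
qed

lemma backward_inflation:
  assumes raman: "raman \<alpha>1 \<alpha>2 \<Gamma>" and s1: "1 \<le> s1" and \<epsilon>: "0 < \<epsilon>" and \<tau>: "0 < \<tau>"
  shows "\<exists>\<psi>. real_analytic_torus \<psi> \<and> in_Hs s \<psi> \<and> Hs_norm s \<psi> \<le> \<epsilon> \<and>
        (\<forall>u. continuous_in_Hs s1 {-\<tau>..0} u \<and> backward_solution \<alpha>1 \<alpha>2 \<gamma>1 \<gamma>2 \<Gamma> \<tau> \<psi> u \<longrightarrow>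
           (SUP t\<in>{-\<tau>..0}. Hs_norm s1 (u t)) \<ge> 1 / \<epsilon>)"
proof -
  interpret R: raman \<alpha>1 \<alpha>2 \<gamma>1 \<gamma>2 \<Gamma> by fact
  interpret R': raman \<alpha>1 "- \<alpha>2" "- \<gamma>1" \<gamma>2 \<Gamma> by (rule raman_reflect) fact
  obtain N where N: "0 < N" and no: "\<forall>b. R'.mode_system \<tau> (2 * (1 / \<epsilon>)) b \<longrightarrow> (\<forall>k. b 0 k = (if k = 0 then complex_of_real (\<epsilon> / 2) else
     if k = N then complex_of_real (\<epsilon> / 2 * J N powr - s) else 0)) \<longrightarrow> False"
    using R'.incompatible_mode[OF \<epsilon> \<tau>, of s] by (elim exE conjE) (rule that)
  have N0: "- N \<noteq> 0" using N by simp
  \<comment> \<open>The mode sits at \<open>- N\<close>, since reflection in space moves it to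
    \<open>N\<close>.\<close>
  define \<psi> where "\<psi> = two_modes (\<epsilon> / 2) (\<epsilon> / 2 * J (- N) powr - s) (- N)"
  show ?thesis
  proof (intro exI[of _ \<psi>] conjI allI impI; (elim conjE)?)
    show "real_analytic_torus \<psi>" unfolding \<psi>_def by (rule two_modes_analytic)
    show "in_Hs s \<psi>" "Hs_norm s \<psi> \<le> \<epsilon>" unfolding \<psi>_def by (rule two_modes_data[OF \<epsilon> N0])+
    fix u assume u: "continuous_in_Hs s1 {-\<tau>..0} u" and sol: "backward_solution \<alpha>1 \<alpha>2 \<gamma>1 \<gamma>2 \<Gamma> \<tau> \<psi> u"
    show "1 / \<epsilon> \<le> (SUP t\<in>{-\<tau>..0}. Hs_norm s1 (u t))"
    proof (rule ccontr)
      assume "\<not> 1 / \<epsilon> \<le> (SUP t\<in>{-\<tau>..0}. Hs_norm s1 (u t))"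
      then have less: "(SUP t\<in>{-\<tau>..0}. Hs_norm s1 (u t)) < 1 / \<epsilon>" by simp
      have weak: "weak_identity \<alpha>1 \<alpha>2 \<gamma>1 \<gamma>2 \<Gamma> (time_interval (- 1) \<tau>) (- 1) \<psi> u \<phi>"
        if "test_function (time_interval (- 1) \<tau>) \<phi>" for \<phi>
        using sol that unfolding backward_solution_def solution_on_def time_interval_backward by blast
      have m: "- 1 * t \<in> {-\<tau>..0}" if "t \<in> {0..\<tau>}" for t using that by auto
      note Hs = continuous_Hs_in[OF u m]
      note small = continuous_Hs_small_l1[OF u compact_Icc s1 less m]
      have cont: "continuous_on {0..\<tau>} (\<lambda>t. fourier (u (- 1 * t)) l)" for l
        by (rule continuous_on_compose2[OF continuous_on_coeff[OF u]]) (use s1 in \<open>auto intro!: continuous_intros\<close>)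
      have one: "- 1 = (1::real) \<or> - 1 = - (1::real)" by simp
      have init: "fourier (u 0) k = fourier \<psi> k" for k
        by (rule R.mode_ode(1)[OF one \<tau>], erule Hs, erule small, rule cont, erule weak)
      have ode: "((\<lambda>t. fourier (u (- 1 * t)) k) has_vector_derivative
          of_real (- 1) * (- (\<i> * R.\<omega> k) * fourier (u (- 1 * t)) k + R.nonlin k (fourier (u (- 1 * t))))) (at t)"
        if "t \<in> {0<..<\<tau>}" for k t
        by (rule R.mode_ode(2)[OF one \<tau>], erule Hs, erule small, rule cont, erule weak, rule that)
      define b where "b t k = fourier (u (- 1 * t)) (- k)" for t k
      have "R'.mode_system \<tau> (2 * (1 / \<epsilon>)) b"
        unfolding R'.mode_system_def
      proof (intro conjI allI ballI)
        show "continuous_on {0..\<tau>} (\<lambda>t. b t k)" for k unfolding b_def by (rule cont)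
        show "small_l1 (2 * (1 / \<epsilon>)) (\<lambda>l. cmod (b t l))" if "t \<in> {0..\<tau>}" for t
          unfolding b_def by (rule small_l1_reflect[OF small[OF that]])
        fix k t assume t: "t \<in> {0<..<\<tau>}"
        have "((\<lambda>t. b t k) has_vector_derivative of_real (- 1) * (- (\<i> * R.\<omega> (- k)) * b t k +
            R.nonlin (- k) (fourier (u (- 1 * t))))) (at t)"
          unfolding b_def by (rule ode[OF t])
        also have "of_real (- 1) * (- (\<i> * R.\<omega> (- k)) * b t k + R.nonlin (- k) (fourier (u (- 1 * t)))) =
            - (\<i> * R'.\<omega> k) * b t k + R'.nonlin k (b t)"
        proof -
          have "R'.nonlin k (b t) = - R.nonlin (- k) (fourier (u (- 1 * t)))"
            unfolding b_def[abs_def] by (rule nonlin_reflect[OF raman])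
          \<comment> \<open>The cubic part of the dispersion relation is odd; the quadratic part is
            even, and its coefficient has changed sign.\<close>
          moreover have "R'.\<omega> k = - R.\<omega> (- k)" by (simp add: R'.\<omega>_def R.\<omega>_def)
          ultimately show ?thesis by simp
        qed
        finally show "((\<lambda>t. b t k) has_vector_derivative (- (\<i> * R'.\<omega> k) * b t k + R'.nonlin k (b t))) (at t)" .
      qed
      moreover have "\<forall>k. b 0 k = (if k = 0 then complex_of_real (\<epsilon> / 2) else
         if k = N then complex_of_real (\<epsilon> / 2 * J N powr - s) else 0)"
      proof
        fix k
        have "b 0 k = fourier \<psi> (- k)" using init[of "- k"] by (simp add: b_def)
        also have "J (- N) = J N" by (simp add: jap_def)
        then have "fourier \<psi> (- k) = (if - k = 0 then complex_of_real (\<epsilon> / 2) else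
            if - k = - N then complex_of_real (\<epsilon> / 2 * J N powr - s) else 0)"
          unfolding \<psi>_def fourier_two_modes[OF N0] by simp
        finally show "b 0 k = (if k = 0 then complex_of_real (\<epsilon> / 2) else
            if k = N then complex_of_real (\<epsilon> / 2 * J N powr - s) else 0)" by simp
      qed
      ultimately show False using no by blast
    qed
  qed
qed

theorem theorem3p1:
  fixes \<alpha>1 \<alpha>2 \<gamma>1 \<gamma>2 \<Gamma> s s1 :: real
  assumes "\<Gamma> > 0" and "\<alpha>1 \<noteq> 0" and "2 * \<alpha>2 / (3 * \<alpha>1) \<notin> \<int>"
    and "1 \<le> s1" and "s1 \<le> s" and "s < min (5/3 * s1 + 1/2) (s1 + 3/2)"
  shows
    "(\<forall>\<epsilon>>0. \<forall>\<tau>>0. \<exists>\<psi>. real_analytic_torus \<psi> \<and> in_Hs s \<psi> \<and> Hs_norm s \<psi> \<le> \<epsilon> \<and>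
        (\<forall>u. continuous_in_Hs s1 {0..\<tau>} u \<and> forward_solution \<alpha>1 \<alpha>2 \<gamma>1 \<gamma>2 \<Gamma> \<tau> \<psi> u \<longrightarrow>
           (SUP t\<in>{0..\<tau>}. Hs_norm s1 (u t)) \<ge> 1 / \<epsilon>)) \<and>
     (\<forall>\<epsilon>>0. \<forall>\<tau>>0. \<exists>\<psi>. real_analytic_torus \<psi> \<and> in_Hs s \<psi> \<and> Hs_norm s \<psi> \<le> \<epsilon> \<and>
        (\<forall>u. continuous_in_Hs s1 {-\<tau>..0} u \<and> backward_solution \<alpha>1 \<alpha>2 \<gamma>1 \<gamma>2 \<Gamma> \<tau> \<psi> u \<longrightarrow>
           (SUP t\<in>{-\<tau>..0}. Hs_norm s1 (u t)) \<ge> 1 / \<epsilon>))"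
proof -
  have "raman \<alpha>1 \<alpha>2 \<Gamma>" using assms(1-3) by unfold_locales
  then show ?thesis
    using forward_inflation[OF _ assms(4)] backward_inflation[OF _ assms(4)] by blast
qed

end
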